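(* Let $\lambda$ be a partition of $N$ and $\mathcal{P}$ a path in $G_\lambda$ from the root to a vertex $(\tau,v)$. Then $\hat J_{\mathcal{P}}$ is a simultaneous eigenfunction of $\hat\xi_1,\dots,\hat\xi_N$ with $\hat J_{\mathcal{P}}\hat\xi_i=\zeta_{v,\tau}[i]\hat J_{\mathcal{P}}$, and the leading monomial of its homogeneous component of highest degree is $x^{v,\tau}$. Consequently $\hat J_{\mathcal{P}}$ depends only on $(\tau,v)$ (denote it $\hat J_{v,\tau}$), and the family $(\hat J_{v,\tau})$, over all RSTs $\tau$ of shape $\lambda$ and $v\in\mathbb{N}^N$, is a basis of $M_\lambda$ of simultaneous eigenfunctions of the $\hat\xi_i$. Furthermore, if $\mathcal{P}$ leads to $\varnothing$ then $\hat J_{\mathcal{P}}=0$.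
   Context: Partitions in French convention (rows numbered bottom to top). An RST of shape $\lambda\vdash N$ is a bijective filling with $1,\dots,N$ strictly decreasing along rows (left to right) and columns (bottom to top); $\mathrm{CT}_\tau[i]=c-r$ if $i$ is in column $c$, row $r$; $\tau_\lambda$ fills the columns left to right, each bottom to top, with $N,\dots,1$. For $v\in\mathbb{N}^N$: $v^+$ decreasing rearrangement; $\sigma_v$ labels positions by $1,\dots,N$ in order of decreasing entries, ties left to right; $vs_i$ swaps entries $i,i+1$; $v\Psi=[v[2],\dots,v[N],v[1]+1]$. $\alpha$ indeterminate; $\zeta_{v,\tau}[i]=\alpha v[i]+\mathrm{CT}_\tau[\sigma_v[i]]$. Graph $G_\lambda$: vertices pairs $(\tau,v)$ reachable from the root $(\tau_\lambda,0^N)$ plus $\varnothing$; from $(\tau,v)$: edge $\Psi$ to $(\tau,v\Psi)$; edge $s_i$ to $(\tau,vs_i)$ if $v[i]<v[i+1]$; if $v[i]=v[i+1]$ and $\mathrm{CT}_\tau[\sigma_v[i]]-\mathrm{CT}_\tau[\sigma_v[i]+1]\ge2$, edge $s_i$ to $(\tau',v)$, $\tau'$ obtained by interchanging $\sigma_v[i],\sigma_v[i]+1$; if $v[i]=v[i+1]$ and this interchange is not an RST, edge $s_i$ to $\varnothing$. A path is a sequence of consecutive edges from the root. $V_\lambda$: $\mathbb{Q}(\alpha)$-space with basis the RSTs of shape $\lambda$, right action: with $b=1/(\mathrm{CT}_\tau[i]-\mathrm{CT}_\tau[i+1])$, $\tau s_i=b\tau$ if $b=\pm1$; $b\tau+\tau^{(i,i+1)}$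 if $0<b\le\frac12$; $b\tau+(1-b^2)\tau^{(i,i+1)}$ otherwise. $M_\lambda=\mathbb{Q}(\alpha)[x_1,\dots,x_N]\otimes V_\lambda$; operators on the right, products read left to right. $fs_i$ exchanges $x_i,x_{i+1}$; $f\partial_i=(f-fs_i)/(x_i-x_{i+1})$. $(f\otimes t)\varsigma_i=(f\partial_i)\otimes t+(fs_i)\otimes(ts_i)$; $(f\otimes t)\mathsf{T}=f(x_N-\alpha,x_1,\dots,x_{N-1})\otimes(ts_1\cdots s_{N-1})$; $P\hat\Psi=(x_N+N-1)\cdot(P\mathsf{T})$; $P\hat\xi_i=x_iP+(N-1)P-P\varsigma_i\cdots\varsigma_{N-1}\hat\Psi\varsigma_1\cdots\varsigma_{i-1}$. $x^{v,\tau}=x^v\otimes(\tau\sigma_v)$, $x^v=\prod x_i^{v[i]}$; $v\lhd v'$ iff $v^+\prec v'^+$ strictly in dominance order, or $v^+=v'^+$ and $v\prec v'$ strictly; a polynomial has leading monomial $x^{v,\tau}$ if it equals $c\,x^{v,\tau}+\sum_{v'\lhd v}c_{v',\tau'}x^{v',\tau'}$ with $c\neq0$. $\hat J_{\mathcal P}$: $\hat J_{[]}=1\otimes\tau_\lambda$; if $[a_1,\dots,a_{k-1}]$ ends at $(\tau,v)$ and $a_k$ is labeled $s_i$, $\hat J_{[a_1..a_k]}=\hat J_{[a_1..a_{k-1}]}\big(\varsigma_i+\frac1{\zeta_{v,\tau}[i+1]-\zeta_{v,\tau}[i]}\big)$; if $a_k$ is labeled $\Psi$, $\hat J_{[a_1..a_k]}=\hat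 J_{[a_1..a_{k-1}]}\hat\Psi$.
   Formalization: In ξ̂_i the product is applied in the reverse order, Pς_{i-1}⋯ς_1 Ψ̂ ς_{N-1}⋯ς_i, since read left to right as printed the claim fails (N=2, λ=(2): 1⊗τ is sent by ξ̂_1 to (x_1−x_2)⊗τ); N ≥ 1 is assumed. *)

theory Defs
  imports
    "HOL-Library.Poly_Mapping"
    "HOL-Computational_Algebra.Polynomial"
    "HOL-Computational_Algebra.Fraction_Field"
    "HOL-Combinatorics.Transposition"
begin

section \<open>Partitions and reverse standard tableaux\<close>

definition is_partition :: "nat list \<Rightarrow> bool" where
  "is_partition lam \<longleftrightarrow> sorted_wrt (\<ge>) lam \<and> 0 \<notin> set lam"

text \<open>Cells are pairs (row, column), both numbered from 1; row 1 is the bottom row and the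
  longest one (French convention).\<close>

definition diagram :: "nat list \<Rightarrow> (nat \<times> nat) set" where
  "diagram lam = {(r, c). 1 \<le> r \<and> r \<le> length lam \<and> 1 \<le> c \<and> c \<le> lam ! (r - 1)}"

text \<open>A filling is extended by 0 outside the diagram, so that equal tableaux are equal functions.\<close>

type_synonym tableau = "nat \<times> nat \<Rightarrow> nat"

definition RST :: "nat list \<Rightarrow> tableau set" where
  "RST lam = {\<tau>. bij_betw \<tau> (diagram lam) {1..sum_list lam}
      \<and> (\<forall>p. p \<notin> diagram lam \<longrightarrow> \<tau> p = 0)
      \<and> (\<forall>r c c'. (r, c) \<in> diagram lam \<longrightarrow> (r, c') \<in> diagram lam \<longrightarrow> c < c' \<longrightarrow> \<tau> (r, c') < \<tau> (r, c))
      \<and> (\<forall>r r' c. (r, c) \<in> diagram lam \<longrightarrow> (r', c) \<in> diagram lam \<longrightarrow> r < r' \<longrightarrow> \<tau> (r', c) < \<tau> (r, c))}"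

definition CT :: "tableau \<Rightarrow> nat \<Rightarrow> int" where
  "CT \<tau> i = (case (THE p. \<tau> p = i) of (r, c) \<Rightarrow> int c - int r)"

definition root_tableau :: "nat list \<Rightarrow> tableau" where
  "root_tableau lam = (\<lambda>(r, c). if (r, c) \<in> diagram lam
      then sum_list lam - card {(r', c') \<in> diagram lam. c' < c \<or> c' = c \<and> r' < r}
      else 0)"

definition tableau_swap :: "nat \<Rightarrow> tableau \<Rightarrow> tableau" where
  "tableau_swap i \<tau> = (\<lambda>p. transpose i (Suc i) (\<tau> p))"

section \<open>Exponent vectors\<close>

text \<open>Vectors of length \<open>N\<close> are indexed by 1, ..., \<open>N\<close> and extended by 0.\<close>

type_synonym expvec = "nat \<Rightarrow> nat"

definition expvecs :: "nat \<Rightarrow> expvec set" where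
  "expvecs N = {v. \<forall>i. i \<notin> {1..N} \<longrightarrow> v i = 0}"

definition vec_swap :: "nat \<Rightarrow> expvec \<Rightarrow> expvec" where
  "vec_swap i v = (\<lambda>j. v (transpose i (Suc i) j))"

definition vec_Psi :: "nat \<Rightarrow> expvec \<Rightarrow> expvec" where
  "vec_Psi N v = (\<lambda>j. if j \<in> {1..<N} then v (Suc j) else if j = N then v 1 + 1 else 0)"

definition vec_sort :: "nat \<Rightarrow> expvec \<Rightarrow> expvec" where
  "vec_sort N v = (\<lambda>j. if j \<in> {1..N} then rev (sort (map v [1..<Suc N])) ! (j - 1) else 0)"

definition sigma :: "nat \<Rightarrow> expvec \<Rightarrow> nat \<Rightarrow> nat" where
  "sigma N v i = (if i \<in> {1..N}
      then card {j \<in> {1..N}. v i < v j \<or> v j = v i \<and> j \<le> i} else i)"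

definition dominated :: "nat \<Rightarrow> expvec \<Rightarrow> expvec \<Rightarrow> bool" where
  "dominated N v w \<longleftrightarrow> (\<forall>k\<in>{1..N}. (\<Sum>i=1..k. v i) \<le> (\<Sum>i=1..k. w i))
      \<and> (\<Sum>i=1..N. v i) = (\<Sum>i=1..N. w i)"

definition strictly_dominated :: "nat \<Rightarrow> expvec \<Rightarrow> expvec \<Rightarrow> bool" where
  "strictly_dominated N v w \<longleftrightarrow> dominated N v w \<and> v \<noteq> w"

definition lhd :: "nat \<Rightarrow> expvec \<Rightarrow> expvec \<Rightarrow> bool" where
  "lhd N v w \<longleftrightarrow> strictly_dominated N (vec_sort N v) (vec_sort N w)
      \<or> vec_sort N v = vec_sort N w \<and> strictly_dominated N v w"

section \<open>The base field and polynomials\<close>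

type_synonym ratfun = "rat poly fract"

definition alpha :: ratfun where
  "alpha = Fract [:0, 1:] 1"

definition zeta :: "nat \<Rightarrow> expvec \<Rightarrow> tableau \<Rightarrow> nat \<Rightarrow> ratfun" where
  "zeta N v \<tau> i = alpha * of_nat (v i) + of_int (CT \<tau> (sigma N v i))"

type_synonym mpoly = "(nat \<Rightarrow>\<^sub>0 nat) \<Rightarrow>\<^sub>0 ratfun"

definition pconst :: "ratfun \<Rightarrow> mpoly" where
  "pconst c = Poly_Mapping.single 0 c"

definition pvar :: "nat \<Rightarrow> mpoly" where
  "pvar i = Poly_Mapping.single (Poly_Mapping.single i 1) 1"

definition psubst :: "(nat \<Rightarrow> mpoly) \<Rightarrow> mpoly \<Rightarrow> mpoly" where
  "psubst g f = (\<Sum>m\<in>Poly_Mapping.keys f. pconst (Poly_Mapping.lookup f m) *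
      (\<Prod>i\<in>Poly_Mapping.keys m. g i ^ Poly_Mapping.lookup m i))"

definition pswap :: "nat \<Rightarrow> mpoly \<Rightarrow> mpoly" where
  "pswap i f = psubst (\<lambda>j. pvar (transpose i (Suc i) j)) f"

text \<open>The polynomial ring is an integral domain, so the quotient is unique.\<close>

definition divdiff :: "nat \<Rightarrow> mpoly \<Rightarrow> mpoly" where
  "divdiff i f = (THE g. (pvar i - pvar (Suc i)) * g = f - pswap i f)"

section \<open>The module spanned by the tableaux\<close>

type_synonym vmod = "tableau \<Rightarrow>\<^sub>0 ratfun"

definition vscale :: "ratfun \<Rightarrow> vmod \<Rightarrow> vmod" where
  "vscale c t = Poly_Mapping.map ((*) c) t"

definition tableau_act :: "nat \<Rightarrow> tableau \<Rightarrow> vmod" where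
  "tableau_act i \<tau> =
    (let b = 1 / rat_of_int (CT \<tau> i - CT \<tau> (Suc i)) in
      if b = 1 \<or> b = - 1 then Poly_Mapping.single \<tau> (of_rat b)
      else if 0 < b \<and> b \<le> 1 / 2
        then Poly_Mapping.single \<tau> (of_rat b) + Poly_Mapping.single (tableau_swap i \<tau>) 1
      else Poly_Mapping.single \<tau> (of_rat b)
        + Poly_Mapping.single (tableau_swap i \<tau>) (of_rat (1 - b\<^sup>2)))"

definition vact :: "nat \<Rightarrow> vmod \<Rightarrow> vmod" where
  "vact i t = (\<Sum>\<tau>\<in>Poly_Mapping.keys t. vscale (Poly_Mapping.lookup t \<tau>) (tableau_act i \<tau>))"

definition vact_word :: "nat list \<Rightarrow> vmod \<Rightarrow> vmod" where
  "vact_word w t = fold vact w t"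

text \<open>Since \<open>v s\<^sub>i\<close> is the function \<open>v \<circ> s\<^sub>i\<close>, the product \<open>s\<^sub>a s\<^sub>b ...\<close> of right operators, read
  from left to right, corresponds to the composition \<open>s\<^sub>a \<circ> s\<^sub>b \<circ> ...\<close> of functions on indices;
  in this convention \<open>v = v\<^sup>+ \<sigma>\<^sub>v\<close>.\<close>

definition word_perm :: "nat list \<Rightarrow> nat \<Rightarrow> nat" where
  "word_perm w = foldr (\<lambda>i p. transpose i (Suc i) \<circ> p) w id"

definition vact_perm :: "nat \<Rightarrow> (nat \<Rightarrow> nat) \<Rightarrow> vmod \<Rightarrow> vmod" where
  "vact_perm N s t =
    (THE u. \<exists>w. set w \<subseteq> {1..<N} \<and> word_perm w = s \<and> u = vact_word w t)"

section \<open>Vector-valued polynomials\<close>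

text \<open>An element \<open>P\<close> stands for the sum of the tensors \<open>lookup P \<tau> \<otimes> \<tau>\<close> over the tableaux \<open>\<tau>\<close>.\<close>

type_synonym mmod = "tableau \<Rightarrow>\<^sub>0 mpoly"

definition M_space :: "nat \<Rightarrow> nat list \<Rightarrow> mmod set" where
  "M_space N lam = {P. Poly_Mapping.keys P \<subseteq> RST lam
      \<and> (\<forall>\<tau>. \<forall>m\<in>Poly_Mapping.keys (Poly_Mapping.lookup P \<tau>). Poly_Mapping.keys m \<subseteq> {1..N})}"

definition tensor :: "mpoly \<Rightarrow> vmod \<Rightarrow> mmod" where
  "tensor f t = Poly_Mapping.map (\<lambda>c. pconst c * f) t"

definition mmult :: "mpoly \<Rightarrow> mmod \<Rightarrow> mmod" where
  "mmult f P = Poly_Mapping.map ((*) f) P"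

definition mscale :: "ratfun \<Rightarrow> mmod \<Rightarrow> mmod" where
  "mscale c P = mmult (pconst c) P"

lemma lookup_mscale:
  "Poly_Mapping.lookup (mscale c P) \<tau> = pconst c * Poly_Mapping.lookup P \<tau>"
  by (simp add: mscale_def mmult_def Poly_Mapping.map.rep_eq when_def)

interpretation mmod: vector_space mscale
proof
  fix a b :: ratfun and x y :: mmod
  show "mscale a (x + y) = mscale a x + mscale a y"
    by (rule poly_mapping_eqI) (simp add: lookup_mscale lookup_add distrib_left)
  show "mscale (a + b) x = mscale a x + mscale b x"
    by (rule poly_mapping_eqI)
      (simp add: lookup_mscale lookup_add pconst_def single_add distrib_right)
  show "mscale a (mscale b x) = mscale (a * b) x"
    by (rule poly_mapping_eqI)
      (simp add: lookup_mscale pconst_def mult.assoc [symmetric] mult_single)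
  show "mscale 1 x = x"
    by (rule poly_mapping_eqI) (simp add: lookup_mscale pconst_def)
qed

definition varsigma :: "nat \<Rightarrow> mmod \<Rightarrow> mmod" where
  "varsigma i P = (\<Sum>\<tau>\<in>Poly_Mapping.keys P.
      tensor (divdiff i (Poly_Mapping.lookup P \<tau>)) (Poly_Mapping.single \<tau> 1)
      + tensor (pswap i (Poly_Mapping.lookup P \<tau>)) (vact i (Poly_Mapping.single \<tau> 1)))"

definition T_op :: "nat \<Rightarrow> mmod \<Rightarrow> mmod" where
  "T_op N P = (\<Sum>\<tau>\<in>Poly_Mapping.keys P.
      tensor (psubst (\<lambda>j. if j = 1 then pvar N - pconst alpha else pvar (j - 1))
          (Poly_Mapping.lookup P \<tau>))
        (vact_word [1..<N] (Poly_Mapping.single \<tau> 1)))"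

definition Psi_hat :: "nat \<Rightarrow> mmod \<Rightarrow> mmod" where
  "Psi_hat N P = mmult (pvar N + of_nat (N - 1)) (T_op N P)"

text \<open>The product \<open>\<varsigma>\<^sub>i ... \<varsigma>\<^bsub>N-1\<^esub> \<Psi> \<varsigma>\<^sub>1 ... \<varsigma>\<^bsub>i-1\<^esub>\<close> in the Knop-Sahi formula is a
  composition of maps: \<open>\<varsigma>\<^bsub>i-1\<^esub>\<close> is applied first and \<open>\<varsigma>\<^sub>i\<close> last.  In this order
  the terms of degree \<open>deg P + 1\<close> cancel against \<open>x\<^sub>i P\<close>.  Applying the factors in the opposite
  order would, for \<open>N = 2\<close>, \<open>\<lambda> = (2)\<close>, \<open>i = 1\<close>, map \<open>1 \<otimes> \<tau>\<close> to \<open>(x\<^sub>1 - x\<^sub>2) \<otimes> \<tau>\<close>,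
  so \<open>1 \<otimes> \<tau>\<close> would not be an eigenfunction.\<close>

definition xi_hat :: "nat \<Rightarrow> nat \<Rightarrow> mmod \<Rightarrow> mmod" where
  "xi_hat N i P = mmult (pvar i) P + mscale (of_nat (N - 1)) P
      - fold varsigma (rev [i..<N]) (Psi_hat N (fold varsigma (rev [1..<i]) P))"

section \<open>Leading monomials\<close>

definition xmon :: "nat \<Rightarrow> expvec \<Rightarrow> tableau \<Rightarrow> mmod" where
  "xmon N v \<tau> = tensor (\<Prod>i=1..N. pvar i ^ v i)
      (vact_perm N (sigma N v) (Poly_Mapping.single \<tau> 1))"

definition has_leading_monomial :: "nat \<Rightarrow> nat list \<Rightarrow> mmod \<Rightarrow> expvec \<Rightarrow> tableau \<Rightarrow> bool" where
  "has_leading_monomial N lam Q v \<tau> \<longleftrightarrow>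
    (\<exists>c R. c \<noteq> 0
      \<and> R \<in> mmod.span {xmon N v' \<tau>' | v' \<tau>'. v' \<in> expvecs N \<and> \<tau>' \<in> RST lam \<and> lhd N v' v}
      \<and> Q = mscale c (xmon N v \<tau>) + R)"

definition mon_degree :: "(nat \<Rightarrow>\<^sub>0 nat) \<Rightarrow> nat" where
  "mon_degree m = (\<Sum>i\<in>Poly_Mapping.keys m. Poly_Mapping.lookup m i)"

definition mdegree :: "mmod \<Rightarrow> nat" where
  "mdegree P = Max (insert 0
      (\<Union>\<tau>\<in>Poly_Mapping.keys P. mon_degree ` Poly_Mapping.keys (Poly_Mapping.lookup P \<tau>)))"

definition homogeneous_component :: "nat \<Rightarrow> mmod \<Rightarrow> mmod" where
  "homogeneous_component d P = (\<Sum>\<tau>\<in>Poly_Mapping.keys P.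
      \<Sum>m\<in>{m \<in> Poly_Mapping.keys (Poly_Mapping.lookup P \<tau>). mon_degree m = d}.
        Poly_Mapping.single \<tau>
          (Poly_Mapping.single m (Poly_Mapping.lookup (Poly_Mapping.lookup P \<tau>) m)))"

definition top_component :: "mmod \<Rightarrow> mmod" where
  "top_component P = homogeneous_component (mdegree P) P"

section \<open>The Yang-Baxter graph\<close>

datatype vertex = Vtx tableau expvec | Empty

datatype label = Lab_s nat | Lab_Psi

text \<open>An edge is (source, label, target); no edge starts at the vertex \<open>Empty\<close>.\<close>

type_synonym edge = "(tableau \<times> expvec) \<times> label \<times> vertex"

inductive is_edge :: "nat \<Rightarrow> nat list \<Rightarrow> edge \<Rightarrow> bool" for N lam where
  edge_Psi: "is_edge N lam ((\<tau>, v), Lab_Psi, Vtx \<tau> (vec_Psi N v))"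
| edge_vec: "i \<in> {1..<N} \<Longrightarrow> v i < v (Suc i) \<Longrightarrow>
    is_edge N lam ((\<tau>, v), Lab_s i, Vtx \<tau> (vec_swap i v))"
| edge_tab: "i \<in> {1..<N} \<Longrightarrow> v i = v (Suc i) \<Longrightarrow>
    CT \<tau> (sigma N v i) - CT \<tau> (sigma N v i + 1) \<ge> 2 \<Longrightarrow>
    is_edge N lam ((\<tau>, v), Lab_s i, Vtx (tableau_swap (sigma N v i) \<tau>) v)"
| edge_Empty: "i \<in> {1..<N} \<Longrightarrow> v i = v (Suc i) \<Longrightarrow>
    tableau_swap (sigma N v i) \<tau> \<notin> RST lam \<Longrightarrow>
    is_edge N lam ((\<tau>, v), Lab_s i, Empty)"

inductive is_path :: "nat \<Rightarrow> nat list \<Rightarrow> edge list \<Rightarrow> vertex \<Rightarrow> bool" for N lam where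
  path_root: "is_path N lam [] (Vtx (root_tableau lam) (\<lambda>_. 0))"
| path_step: "is_path N lam p (Vtx \<tau> v) \<Longrightarrow> is_edge N lam ((\<tau>, v), a, u) \<Longrightarrow>
    is_path N lam (p @ [((\<tau>, v), a, u)]) u"

fun J_step :: "nat \<Rightarrow> mmod \<Rightarrow> edge \<Rightarrow> mmod" where
  "J_step N P ((\<tau>, v), Lab_s i, u) =
     varsigma i P + mscale (1 / (zeta N v \<tau> (i + 1) - zeta N v \<tau> i)) P"
| "J_step N P ((\<tau>, v), Lab_Psi, u) = Psi_hat N P"

definition J_path :: "nat \<Rightarrow> nat list \<Rightarrow> edge list \<Rightarrow> mmod" where
  "J_path N lam p = foldl (J_step N) (tensor 1 (Poly_Mapping.single (root_tableau lam) 1)) p"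

definition J_hat :: "nat \<Rightarrow> nat list \<Rightarrow> expvec \<Rightarrow> tableau \<Rightarrow> mmod" where
  "J_hat N lam v \<tau> = (THE P. \<exists>p. is_path N lam p (Vtx \<tau> v) \<and> P = J_path N lam p)"

definition simultaneous_eigenfunction ::
    "nat \<Rightarrow> (nat \<Rightarrow> ratfun) \<Rightarrow> mmod \<Rightarrow> bool" where
  "simultaneous_eigenfunction N z P \<longleftrightarrow>
    P \<noteq> 0 \<and> (\<forall>i\<in>{1..N}. xi_hat N i P = mscale (z i) P)"

end

theory Submission
  imports Defs "HOL-Library.Multiset"
begin

text \<open>The operators \<open>\<varsigma>\<^sub>i\<close>, \<open>\<Psi>\<close> and \<open>\<xi>\<^sub>i\<close> satisfy, with products read from left to right,
  the relations of a degenerate double affine Hecke algebra: \<open>\<xi>\<^sub>i \<varsigma>\<^sub>i = \<varsigma>\<^sub>i \<xi>\<^bsub>i+1\<^esub> + 1\<close>, \<open>\<Psi> \<xi>\<^sub>i = \<xi>\<^bsub>i+1\<^esub> \<Psi>\<close> and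
  \<open>\<Psi> \<xi>\<^sub>N = (\<xi>\<^sub>1 + \<alpha>) \<Psi>\<close>. Each of these only has to be checked on constants and to be stable under
  multiplication by the variables. Hence every edge of the graph turns a simultaneous eigenfunction
  into one whose spectral vector is that of the target vertex, starting from the constants, on
  which the \<open>\<xi>\<^sub>i\<close> act as Jucys-Murphy elements.

  In the highest degree \<open>\<varsigma>\<^sub>i\<close> is the diagonal action of \<open>s\<^sub>i\<close> and \<open>\<Psi>\<close> is \<open>x\<^sub>N\<close> times a cyclic
  rotation, so the top component of a path polynomial stays below \<open>v\<close> in an affine Bruhat order
  contained in \<open>lhd\<close>, with coefficient \<open>\<tau> \<sigma>\<^sub>v\<close> at \<open>x\<^sup>v\<close>. By triangularity the path polynomials span, and
  as the spectral vectors determine \<open>(v, \<tau>)\<close>, an eigenfunction with spectral vector \<open>\<zeta>\<close> is a multiple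
  of the basis element belonging to \<open>\<zeta>\<close>, or zero if there is none. Comparing leading coefficients
  gives independence of the path; for a path to the empty vertex there is no such basis element,
  because contents determine a filling that decreases along diagonals.\<close>

text \<open>The seminormal formulas are known to satisfy the braid relation only where three
  consecutive entries have distinct contents. The Coxeter relations are therefore proved on the
  carriers \<open>V_space\<close> and \<open>M\<close>, which the operators preserve. The
  presentation of the symmetric group then makes words with the same permutation act equally; this
  gives \<open>vact_perm\<close> its meaning and turns rearrangements of products of the \<varsigma>
  into identities between permutations. Path independence uses no relations between paths of the
  graph. Every path polynomial carries the coefficient \<open>lead \<tau> v\<close> with scalar
  exactly 1: for a content difference of at least 2 the seminormal action has off-diagonal
  coefficient 1, so a tableau edge produces the new tableau without a factor. The spectrum fixes an
  eigenfunction up to a scalar, and this normalization forces the scalar to be 1.\<close>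

abbreviation "lookup \<equiv> Poly_Mapping.lookup"
abbreviation "keys \<equiv> Poly_Mapping.keys"
abbreviation "single \<equiv> Poly_Mapping.single"

section \<open>Polynomials\<close>

lemma poly_mapping_eq_sum_single:
  fixes f :: "'a \<Rightarrow>\<^sub>0 'b::comm_monoid_add"
  shows "f = (\<Sum>k\<in>keys f. single k (lookup f k))"
proof (rule poly_mapping_eqI)
  fix k
  have "(\<Sum>x\<in>keys f. lookup (single x (lookup f x)) k)
      = (\<Sum>x\<in>keys f. if x = k then lookup f k else 0)"
    by (rule sum.cong) (auto simp: lookup_single when_def)
  also have "\<dots> = lookup f k"
    by (simp add: sum.delta in_keys_iff)
  finally show "lookup f k = lookup (\<Sum>k\<in>keys f. single k (lookup f k)) k"
    by (simp add: lookup_sum)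
qed

lemma poly_mapping_single_induct [case_names single add]:
  fixes f :: "'a \<Rightarrow>\<^sub>0 'b::comm_monoid_add"
  assumes "\<And>k c. Q (single k c)" and "\<And>f g. Q f \<Longrightarrow> Q g \<Longrightarrow> Q (f + g)"
  shows "Q f"
proof -
  have "Q (\<Sum>k\<in>A. single k (lookup f k))" if "finite A" for A
    using that
  proof (induction A)
    case empty
    then show ?case using assms(1)[of undefined 0] by simp
  next
    case (insert x F)
    then show ?case using assms by simp
  qed
  from this[of "keys f"] show ?thesis
    by (simp add: poly_mapping_eq_sum_single[symmetric])
qed

lemma pconst_simps [simp]: "pconst 0 = 0" "pconst 1 = 1"
  by (simp_all add: pconst_def)

lemma pconst_add: "pconst (a + b) = pconst a + pconst b"
  by (simp add: pconst_def single_add)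

lemma pconst_mult: "pconst (a * b) = pconst a * pconst b"
  by (simp add: pconst_def mult_single)

lemma pconst_of_nat: "pconst (of_nat n) = of_nat n"
  by (simp add: pconst_def)

lemma lookup_pconst_mult: "lookup (pconst c * f) m = c * lookup f m"
  unfolding pconst_def mult_map_scale_conv_mult[symmetric]
  by (simp add: Poly_Mapping.map.rep_eq when_def)

lemma pvar_mult_single: "pvar j * single m c = single (single j 1 + m) c"
  by (simp add: pvar_def mult_single)

lemma pvar_power: "pvar j ^ k = single (single j k) 1"
  by (induction k) (simp_all add: pvar_mult_single single_add[symmetric])

lemma prod_single: "(\<Prod>i\<in>A. single (h i) (1::ratfun)) = single (\<Sum>i\<in>A. h i :: nat \<Rightarrow>\<^sub>0 nat) 1"
  by (induction A rule: infinite_finite_induct) (simp_all add: mult_single)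

section \<open>Degree filtration and induction over polynomials\<close>

lemma mon_degree_superset:
  "finite A \<Longrightarrow> keys m \<subseteq> A \<Longrightarrow> mon_degree m = (\<Sum>i\<in>A. lookup m i)"
  unfolding mon_degree_def by (rule sum.mono_neutral_left) (auto simp: in_keys_iff)

lemma mon_degree_add: "mon_degree (m + n) = mon_degree m + mon_degree n"
proof -
  let ?A = "keys m \<union> keys n"
  have "keys (m + n) \<subseteq> ?A" by (rule keys_add)
  then show ?thesis
    by (simp add: mon_degree_superset[of ?A] lookup_add sum.distrib)
qed

lemma mon_degree_single [simp]: "mon_degree (single j k) = k"
  by (simp add: mon_degree_def)

lemma mon_degree_zero [simp]: "mon_degree 0 = 0"
  by (simp add: mon_degree_def)

text \<open>The bound is strict, so \<open>Fil A 0\<close> contains only 0 and a divided difference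
  lowers the index by one with no exception for constants.\<close>

definition Fil :: "nat set \<Rightarrow> nat \<Rightarrow> mpoly set" where
  "Fil A d = {f. \<forall>m\<in>keys f. keys m \<subseteq> A \<and> mon_degree m < d}"

lemma Fil_zero [simp]: "0 \<in> Fil A d"
  by (simp add: Fil_def)

lemma Fil_add: "f \<in> Fil A d \<Longrightarrow> g \<in> Fil A d \<Longrightarrow> f + g \<in> Fil A d"
  using keys_add[of f g] unfolding Fil_def by blast

lemma Fil_uminus: "f \<in> Fil A d \<Longrightarrow> - f \<in> Fil A d"
  unfolding Fil_def by (auto simp: in_keys_iff)

lemma Fil_diff: "f \<in> Fil A d \<Longrightarrow> g \<in> Fil A d \<Longrightarrow> f - g \<in> Fil A d"
  using Fil_add[of f A d "- g"] Fil_uminus[of g A d] by simp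

lemma Fil_mono: "f \<in> Fil A d \<Longrightarrow> d \<le> e \<Longrightarrow> f \<in> Fil A e"
  unfolding Fil_def by fastforce

lemma Fil_pconst: "pconst c \<in> Fil A (Suc d)"
  unfolding Fil_def pconst_def by (auto split: if_splits)

lemma Fil_pconst_mult: "f \<in> Fil A d \<Longrightarrow> pconst c * f \<in> Fil A d"
  unfolding Fil_def by (auto simp: in_keys_iff lookup_pconst_mult)

lemma Fil_pvar_mult:
  assumes "f \<in> Fil A d" "j \<in> A"
  shows "pvar j * f \<in> Fil A (Suc d)"
proof -
  have "keys m \<subseteq> A \<and> mon_degree m < Suc d" if "m \<in> keys (pvar j * f)" for m
  proof -
    from that keys_mult[of "pvar j" f] obtain n where n: "n \<in> keys f" "m = single j 1 + n"
      unfolding pvar_def by (auto split: if_splits)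
    then have "keys m \<subseteq> insert j (keys n)"
      using keys_add[of "single j (1::nat)" n] by auto
    with n assms show ?thesis
      unfolding Fil_def by (auto simp: mon_degree_add)
  qed
  then show ?thesis unfolding Fil_def by blast
qed

lemma single_Fil_induct:
  assumes "\<And>d. Q d 0" and "\<And>d c. Q (Suc d) (pconst c)"
    and "\<And>d j f. j \<in> A \<Longrightarrow> f \<in> Fil A d \<Longrightarrow> Q d f \<Longrightarrow> Q (Suc d) (pvar j * f)"
    and "keys m \<subseteq> A" "mon_degree m < d"
  shows "Q d (single m c)"
  using assms(4,5)
proof (induction "mon_degree m" arbitrary: m d)
  case 0
  then have "m = 0"
    by (auto simp: mon_degree_def poly_mapping_eq_iff in_keys_iff fun_eq_iff)
  moreover obtain d' where "d = Suc d'" using 0 by (cases d) auto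
  ultimately show ?case using assms(2) by (simp add: pconst_def)
next
  case (Suc n)
  then have "keys m \<noteq> {}" unfolding mon_degree_def by auto
  then obtain j where j: "j \<in> keys m" by blast
  define m' where "m' = m - single j 1"
  have m: "m = single j 1 + m'"
  proof (rule poly_mapping_eqI)
    fix k show "lookup m k = lookup (single j 1 + m') k"
      using j by (auto simp: m'_def lookup_add lookup_minus lookup_single in_keys_iff when_def)
  qed
  have k': "keys m' \<subseteq> A"
  proof
    fix k assume "k \<in> keys m'"
    then have "k \<in> keys m" unfolding in_keys_iff m'_def by (auto simp: lookup_minus)
    then show "k \<in> A" using Suc.prems by blast
  qed
  obtain d' where d: "d = Suc d'" using Suc.prems by (cases d) auto
  have deg: "mon_degree m = Suc (mon_degree m')"
    using arg_cong[OF m, of mon_degree] by (simp add: mon_degree_add)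
  have "Q d' (single m' c)"
    using Suc.hyps Suc.prems k' deg d by auto
  moreover have "single m' c \<in> Fil A d'"
    using Suc.prems k' deg d by (auto simp: Fil_def split: if_splits)
  ultimately have "Q (Suc d') (pvar j * single m' c)"
    using assms(3) j Suc.prems by blast
  then show ?case using m d by (simp add: pvar_mult_single)
qed

text \<open>The bound \<open>d\<close> is an argument of \<open>Q\<close> and grows with each
  factor, so an identity and the degree estimate that goes with it can be proved by a single
  induction.\<close>

lemma Fil_induct [consumes 1, case_names zero const add mult]:
  assumes "f \<in> Fil A d"
    and zero: "\<And>d. Q d 0" and const: "\<And>d c. Q (Suc d) (pconst c)"
    and add: "\<And>d f g. f \<in> Fil A d \<Longrightarrow> g \<in> Fil A d \<Longrightarrow> Q d f \<Longrightarrow> Q d g \<Longrightarrow> Q d (f + g)"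
    and mult: "\<And>d j f. j \<in> A \<Longrightarrow> f \<in> Fil A d \<Longrightarrow> Q d f \<Longrightarrow> Q (Suc d) (pvar j * f)"
  shows "Q d f"
proof -
  have mon: "Q d (single m (lookup f m)) \<and> single m (lookup f m) \<in> Fil A d" if "m \<in> keys f" for m
    using that assms(1) single_Fil_induct[of Q A, OF zero const mult]
    by (auto simp: Fil_def split: if_splits)
  have "Q d (\<Sum>k\<in>B. single k (lookup f k)) \<and> (\<Sum>k\<in>B. single k (lookup f k)) \<in> Fil A d"
    if "finite B" "B \<subseteq> keys f" for B
    using that
  proof (induction B)
    case empty
    then show ?case using zero by simp
  next
    case (insert x F)
    then show ?case using mon[of x] add Fil_add by simp
  qed
  from this[of "keys f"] show ?thesis
    by (simp add: poly_mapping_eq_sum_single[symmetric])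
qed

lemma Fil_exhaust: "\<exists>d. f \<in> Fil UNIV d"
proof -
  have "finite (mon_degree ` keys f)" by simp
  then obtain d where "\<forall>k \<in> mon_degree ` keys f. k < d"
    using finite_nat_set_iff_bounded by blast
  then show ?thesis unfolding Fil_def by auto
qed

lemma mpoly_induct [case_names const add mult]:
  assumes "\<And>c. Q (pconst c)" and "\<And>f g. Q f \<Longrightarrow> Q g \<Longrightarrow> Q (f + g)"
    and "\<And>j f. Q f \<Longrightarrow> Q (pvar j * f)"
  shows "Q f"
proof -
  obtain d where "f \<in> Fil UNIV d" using Fil_exhaust by blast
  then show ?thesis
    by (induction rule: Fil_induct) (use assms assms(1)[of 0] in auto)
qed

subsection \<open>Substitution\<close>

lemma psubst_superset:
  assumes "finite A" "keys f \<subseteq> A"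
  shows "psubst g f = (\<Sum>m\<in>A. pconst (lookup f m) * (\<Prod>i\<in>keys m. g i ^ lookup m i))"
  unfolding psubst_def
  using assms by (intro sum.mono_neutral_left) (auto simp: in_keys_iff)

lemma psubst_add: "psubst g (f + h) = psubst g f + psubst g h"
proof -
  let ?A = "keys f \<union> keys h"
  have "keys (f + h) \<subseteq> ?A" by (rule keys_add)
  then show ?thesis
    by (simp add: psubst_superset[of ?A] lookup_add pconst_add distrib_right sum.distrib)
qed

lemma psubst_single:
  "psubst g (single m c) = pconst c * (\<Prod>i\<in>keys m. g i ^ lookup m i)"
  by (simp add: psubst_def)

lemma psubst_pconst [simp]: "psubst g (pconst c) = pconst c"
  by (simp add: pconst_def psubst_single[unfolded pconst_def])

lemma psubst_0 [simp]: "psubst g 0 = 0"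
  by (simp add: psubst_def)

lemma psubst_pvar [simp]: "psubst g (pvar j) = g j"
  by (simp add: pvar_def psubst_single)

lemma prod_power_add:
  fixes g :: "nat \<Rightarrow> mpoly"
  shows "(\<Prod>i\<in>keys (m + n). g i ^ lookup (m + n) i)
    = (\<Prod>i\<in>keys m. g i ^ lookup m i) * (\<Prod>i\<in>keys n. g i ^ lookup n i)"
proof -
  let ?A = "keys m \<union> keys n"
  have *: "(\<Prod>i\<in>keys u. g i ^ lookup u i) = (\<Prod>i\<in>?A. g i ^ lookup u i)" if "keys u \<subseteq> ?A" for u
    using that by (intro prod.mono_neutral_left) (auto simp: in_keys_iff)
  have "keys (m + n) \<subseteq> ?A" by (rule keys_add)
  then show ?thesis
    unfolding *[OF \<open>keys (m + n) \<subseteq> ?A\<close>] *[of m, OF Un_upper1] *[of n, OF Un_upper2]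
    by (simp add: lookup_add power_add prod.distrib)
qed

lemma psubst_mult: "psubst g (f * h) = psubst g f * psubst g h"
proof (induction f rule: poly_mapping_single_induct)
  case (single m c)
  show ?case
  proof (induction h rule: poly_mapping_single_induct)
    case (single n d)
    show ?case
      by (simp add: mult_single psubst_single prod_power_add pconst_mult)
  next
    case (add f g)
    then show ?case by (simp add: distrib_left psubst_add)
  qed
next
  case (add f g)
  then show ?case by (simp add: distrib_right psubst_add)
qed

lemma psubst_Fil:
  assumes "f \<in> Fil A d"
    and "\<And>j d f. j \<in> A \<Longrightarrow> f \<in> Fil B d \<Longrightarrow> g j * f \<in> Fil B (Suc d)"
  shows "psubst g f \<in> Fil B d"
  using assms(1)
  by (induction rule: Fil_induct) (simp_all add: psubst_add psubst_mult assms(2) Fil_pconst Fil_add)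

lemma lookup_map_key: "inj p \<Longrightarrow> lookup (Poly_Mapping.map_key p m) j = lookup m (p j)"
  by (simp add: map_key.rep_eq)

text \<open>The monomial with exponent \<open>n\<close> becomes the one with exponent
  \<open>n'\<close>, whose pullback along \<open>p\<close> is \<open>n\<close>. Surjectivity of
  \<open>p\<close> makes the pullback determine the exponent.\<close>

lemma lookup_psubst_bij:
  assumes "bij p"
  shows "lookup (psubst (\<lambda>j. pvar (p j)) f) m = lookup f (Poly_Mapping.map_key p m)"
proof (induction f rule: poly_mapping_single_induct)
  case (single n c)
  have inj: "inj p" using assms by (rule bij_is_inj)
  define n' where "n' = (\<Sum>i\<in>keys n. single (p i) (lookup n i))"
  have n': "Poly_Mapping.map_key p n' = n"
  proof (rule poly_mapping_eqI)
    fix k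
    have "lookup (Poly_Mapping.map_key p n') k = (\<Sum>i\<in>keys n. if i = k then lookup n k else 0)"
      unfolding lookup_map_key[OF inj] n'_def lookup_sum
      by (rule sum.cong) (auto simp: lookup_single when_def inj_eq[OF inj])
    then show "lookup (Poly_Mapping.map_key p n') k = lookup n k"
      by (simp add: sum.delta in_keys_iff)
  qed
  have "m = n' \<longleftrightarrow> Poly_Mapping.map_key p m = Poly_Mapping.map_key p n'"
  proof
    assume "Poly_Mapping.map_key p m = Poly_Mapping.map_key p n'"
    then have "lookup m (p k) = lookup n' (p k)" for k
      by (metis lookup_map_key[OF inj])
    then show "m = n'"
      using assms by (metis poly_mapping_eqI bij_pointE)
  qed simp
  then have eq: "n' = m \<longleftrightarrow> n = Poly_Mapping.map_key p m" using n' by metis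
  have "psubst (\<lambda>j. pvar (p j)) (single n c) = single n' c"
    by (simp add: psubst_single pvar_power prod_single pconst_def mult_single n'_def)
  then show ?case by (simp add: lookup_single when_def eq)
next
  case (add f g)
  then show ?case by (simp add: psubst_add lookup_add)
qed

subsection \<open>Exchange of variables and divided differences\<close>

lemma pswap_add: "pswap i (f + g) = pswap i f + pswap i g"
  and pswap_mult: "pswap i (f * g) = pswap i f * pswap i g"
  and pswap_0 [simp]: "pswap i 0 = 0"
  and pswap_pconst [simp]: "pswap i (pconst c) = pconst c"
  and pswap_pvar [simp]: "pswap i (pvar j) = pvar (transpose i (Suc i) j)"
  by (simp_all add: pswap_def psubst_add psubst_mult)

lemma pswap_pswap [simp]: "pswap i (pswap i f) = f"
  by (induction f rule: mpoly_induct) (simp_all add: pswap_add pswap_mult)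

lemma lookup_pswap:
  "lookup (pswap i f) m = lookup f (Poly_Mapping.map_key (transpose i (Suc i)) m)"
  unfolding pswap_def by (rule lookup_psubst_bij) simp

lemma pswap_Fil:
  assumes "f \<in> Fil A d" "i \<in> A" "Suc i \<in> A"
  shows "pswap i f \<in> Fil A d"
  unfolding pswap_def
  by (rule psubst_Fil[OF assms(1)]) (use assms(2,3) in \<open>auto simp: transpose_def intro: Fil_pvar_mult\<close>)

lemma pvar_eq_iff [simp]: "pvar i = pvar j \<longleftrightarrow> i = j"
proof
  assume "pvar i = pvar j"
  then have "lookup (pvar i) (single i 1) = lookup (pvar j) (single i 1)" by simp
  then have "single i (1::nat) = single j 1"
    by (auto simp: pvar_def lookup_single when_def split: if_splits)
  then have "lookup (single i (1::nat)) i = lookup (single j 1) i" by simp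
  then show "i = j" by (auto simp: lookup_single when_def split: if_splits)
qed simp

text \<open>Existence of the quotient and its degree come from the same induction. In the product
  step the quotient is given by the twisted Leibniz rule, with \<open>g\<close> the quotient for the
  factor \<open>f\<close> and \<open>c\<close> the one for the variable.\<close>

lemma divdiff_exists_Fil:
  assumes "f \<in> Fil A (Suc d)" "i \<in> A" "Suc i \<in> A"
  shows "\<exists>g\<in>Fil A d. (pvar i - pvar (Suc i)) * g = f - pswap i f"
proof -
  \<comment> \<open>The induction passes through \<open>d = 0\<close>, where \<open>d - 1\<close> is
    again 0; this is harmless because \<open>Fil A 0\<close> contains only 0.\<close>
  have "\<exists>g\<in>Fil A (d - 1). (pvar i - pvar (Suc i)) * g = f - pswap i f" if "f \<in> Fil A d" for d f
    using that
  proof (induction rule: Fil_induct)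
    case (add d f g)
    then obtain f' g' where "f' \<in> Fil A (d - 1)" "g' \<in> Fil A (d - 1)"
      "(pvar i - pvar (Suc i)) * f' = f - pswap i f" "(pvar i - pvar (Suc i)) * g' = g - pswap i g"
      by blast
    then show ?case
      by (intro bexI[of _ "f' + g'"]) (simp_all add: distrib_left pswap_add Fil_add)
  next
    case (mult d j f)
    then obtain g where g: "g \<in> Fil A (d - 1)" "(pvar i - pvar (Suc i)) * g = f - pswap i f"
      by blast
    define c :: mpoly where "c = (if j = i then 1 else if j = Suc i then - 1 else 0)"
    have sf: "pswap i f \<in> Fil A d" using pswap_Fil mult assms by blast
    have jg: "pvar j * g \<in> Fil A d"
    proof (cases d)
      case 0
      then have "g = 0" using g by (auto simp: Fil_def)
      then show ?thesis by simp
    next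
      case (Suc d')
      then show ?thesis using Fil_pvar_mult[OF g(1) mult(1)] by simp
    qed
    have c: "(pvar i - pvar (Suc i)) * c = pvar j - pswap i (pvar j)"
      by (auto simp: c_def transpose_def)
    have "(pvar i - pvar (Suc i)) * (pvar j * g + c * pswap i f)
        = pvar j * ((pvar i - pvar (Suc i)) * g) + ((pvar i - pvar (Suc i)) * c) * pswap i f"
      by (simp only: distrib_left mult.assoc mult.left_commute)
    also have "\<dots> = pvar j * f - pswap i (pvar j * f)"
      unfolding g(2) c pswap_mult by (simp add: algebra_simps)
    finally have "(pvar i - pvar (Suc i)) * (pvar j * g + c * pswap i f)
      = pvar j * f - pswap i (pvar j * f)" .
    moreover have "pvar j * g + c * pswap i f \<in> Fil A d"
      using jg sf by (auto simp: c_def intro: Fil_add Fil_diff)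
    ultimately show ?case by auto
  qed auto
  from this[OF assms(1)] show ?thesis by simp
qed

lemma divdiff_eqI:
  assumes "(pvar i - pvar (Suc i)) * g = f - pswap i f"
  shows "divdiff i f = g"
  unfolding divdiff_def
proof (rule the_equality)
  fix h assume "(pvar i - pvar (Suc i)) * h = f - pswap i f"
  with assms have "(pvar i - pvar (Suc i)) * h = (pvar i - pvar (Suc i)) * g" by simp
  moreover have "pvar i - pvar (Suc i) \<noteq> 0" by simp
  ultimately show "h = g" using mult_left_cancel by blast
qed (rule assms)

lemma divdiff_spec: "(pvar i - pvar (Suc i)) * divdiff i f = f - pswap i f"
proof -
  obtain d where "f \<in> Fil UNIV d" using Fil_exhaust by blast
  then have "f \<in> Fil UNIV (Suc d)" using Fil_mono by fastforce
  then obtain g where "(pvar i - pvar (Suc i)) * g = f - pswap i f"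
    using divdiff_exists_Fil[of f UNIV d i] by blast
  then show ?thesis using divdiff_eqI by metis
qed

lemma divdiff_Fil:
  assumes "f \<in> Fil A (Suc d)" "i \<in> A" "Suc i \<in> A"
  shows "divdiff i f \<in> Fil A d"
  using divdiff_exists_Fil[OF assms] divdiff_eqI by metis

lemma divdiff_add: "divdiff i (f + g) = divdiff i f + divdiff i g"
  by (rule divdiff_eqI) (simp add: distrib_left divdiff_spec pswap_add)

lemma divdiff_mult: "divdiff i (f * g) = divdiff i f * g + pswap i f * divdiff i g"
proof (rule divdiff_eqI)
  have "(pvar i - pvar (Suc i)) * (divdiff i f * g + pswap i f * divdiff i g)
    = ((pvar i - pvar (Suc i)) * divdiff i f) * g
      + pswap i f * ((pvar i - pvar (Suc i)) * divdiff i g)"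
    by (simp only: distrib_left mult.assoc mult.left_commute)
  then show "(pvar i - pvar (Suc i)) * (divdiff i f * g + pswap i f * divdiff i g)
    = f * g - pswap i (f * g)"
    unfolding divdiff_spec pswap_mult by (simp add: algebra_simps)
qed

lemma divdiff_pconst [simp]: "divdiff i (pconst c) = 0"
  by (rule divdiff_eqI) simp

lemma divdiff_0 [simp]: "divdiff i 0 = 0"
  by (rule divdiff_eqI) simp

lemma divdiff_pvar:
  "divdiff i (pvar j) = (if j = i then 1 else if j = Suc i then - 1 else 0)"
  by (rule divdiff_eqI) (auto simp: transpose_def)

section \<open>The seminormal representation\<close>

lemma transpose_eq_swap_iff: "transpose a b x = y \<longleftrightarrow> x = transpose a b y"
  by (metis transpose_involutory)

lemma tableau_swap_swap [simp]: "tableau_swap i (tableau_swap i \<tau>) = \<tau>"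
  by (simp add: tableau_swap_def)

lemma tableau_swap_eq_iff: "tableau_swap i \<tau> = \<rho> \<longleftrightarrow> \<tau> = tableau_swap i \<rho>"
  by (metis tableau_swap_swap)

lemma CT_tableau_swap: "CT (tableau_swap i \<tau>) j = CT \<tau> (transpose i (Suc i) j)"
  unfolding CT_def tableau_swap_def transpose_eq_swap_iff ..

lemma tableau_swap_commute:
  "Suc i < j \<Longrightarrow> tableau_swap i (tableau_swap j \<tau>) = tableau_swap j (tableau_swap i \<tau>)"
  by (auto simp: tableau_swap_def transpose_def fun_eq_iff)

lemma tableau_swap_braid:
  "tableau_swap i (tableau_swap (Suc i) (tableau_swap i \<tau>))
    = tableau_swap (Suc i) (tableau_swap i (tableau_swap (Suc i) \<tau>))"
  by (auto simp: tableau_swap_def transpose_def fun_eq_iff)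

definition diag_coeff :: "nat \<Rightarrow> tableau \<Rightarrow> ratfun" where
  "diag_coeff i \<tau> = 1 / of_int (CT \<tau> i - CT \<tau> (Suc i))"

definition swap_fun :: "int \<Rightarrow> ratfun" where
  "swap_fun d = (if d = 1 \<or> d = - 1 then 0 else if d \<ge> 2 then 1 else 1 - (1 / of_int d)\<^sup>2)"

definition swap_coeff :: "nat \<Rightarrow> tableau \<Rightarrow> ratfun" where
  "swap_coeff i \<tau> = swap_fun (CT \<tau> i - CT \<tau> (Suc i))"

text \<open>Only the product of the two off-diagonal coefficients matters for the relations; how it
  is split between a tableau and its neighbour is a normalization of the basis. The formula persists
  at \<open>d = 0\<close>, where division by zero gives 0.\<close>

lemma swap_fun_mult: "swap_fun d * swap_fun (- d) = 1 - (1 / of_int d)\<^sup>2"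
  by (auto simp: swap_fun_def power_divide)

text \<open>For b = 1 or b = -1 the coefficient of the second term vanishes, and 0 < b \<le> 1/2
  means that the content difference is at least 2; so all branches become one formula.\<close>

lemma tableau_act_eq:
  "tableau_act i \<tau> = single \<tau> (diag_coeff i \<tau>) + single (tableau_swap i \<tau>) (swap_coeff i \<tau>)"
proof -
  define d where "d = CT \<tau> i - CT \<tau> (Suc i)"
  have 1: "1 / rat_of_int d = 1 \<longleftrightarrow> d = 1" "1 / rat_of_int d = - 1 \<longleftrightarrow> d = - 1"
    by (auto simp: divide_eq_eq of_int_eq_iff[of d "-1", where 'a = rat, simplified])
  have 2: "0 < 1 / rat_of_int d \<and> 1 / rat_of_int d \<le> 1 / 2 \<longleftrightarrow> d \<ge> 2"
  proof (cases "d > 0")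
    case True
    then show ?thesis by (simp add: field_simps)
  qed (auto simp: zero_less_divide_iff)
  show ?thesis
    unfolding tableau_act_def Let_def d_def[symmetric] 1 2 diag_coeff_def swap_coeff_def swap_fun_def
    by (auto simp: of_rat_divide of_rat_diff of_rat_power)
qed

lemma lookup_vscale: "lookup (vscale c t) \<tau> = c * lookup t \<tau>"
  by (simp add: vscale_def Poly_Mapping.map.rep_eq when_def)

text \<open>The value at \<open>\<rho>\<close> draws only on \<open>\<rho>\<close> and its
  neighbour, so operator identities become field identities and supports need not be
  tracked.\<close>

lemma lookup_vact:
  "lookup (vact i t) \<rho> = diag_coeff i \<rho> * lookup t \<rho>
    + swap_coeff i (tableau_swap i \<rho>) * lookup t (tableau_swap i \<rho>)"
proof -
  have "lookup (vact i t) \<rho> = (\<Sum>\<tau>\<in>keys t.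
      (if \<tau> = \<rho> then diag_coeff i \<rho> * lookup t \<tau> else 0)
      + (if \<tau> = tableau_swap i \<rho> then swap_coeff i (tableau_swap i \<rho>) * lookup t \<tau> else 0))"
    unfolding vact_def lookup_sum tableau_act_eq
    by (rule sum.cong)
      (auto simp: lookup_vscale lookup_add lookup_single when_def tableau_swap_eq_iff algebra_simps)
  then show ?thesis
    by (simp add: sum.distrib in_keys_iff)
qed

lemma vact_add: "vact i (t + u) = vact i t + vact i u"
  by (rule poly_mapping_eqI) (simp add: lookup_vact lookup_add algebra_simps)

lemma vact_zero [simp]: "vact i 0 = 0"
  by (rule poly_mapping_eqI) (simp add: lookup_vact)

lemma vact_vscale: "vact i (vscale c t) = vscale c (vact i t)"
  by (rule poly_mapping_eqI) (simp add: lookup_vact lookup_vscale algebra_simps)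

lemma vact_single: "vact i (single \<tau> 1) = tableau_act i \<tau>"
  by (rule poly_mapping_eqI)
    (auto simp: lookup_vact tableau_act_eq lookup_add lookup_single when_def tableau_swap_eq_iff)

lemma diag_coeff_swap [simp]: "diag_coeff i (tableau_swap i \<tau>) = - diag_coeff i \<tau>"
  by (simp add: diag_coeff_def CT_tableau_swap divide_simps)

lemma swap_coeff_mult:
  "swap_coeff i \<tau> * swap_coeff i (tableau_swap i \<tau>) = 1 - (diag_coeff i \<tau>)\<^sup>2"
  using swap_fun_mult[of "CT \<tau> i - CT \<tau> (Suc i)"]
  by (simp add: diag_coeff_def swap_coeff_def CT_tableau_swap)

lemma vact_vact: "vact i (vact i t) = t"
proof (rule poly_mapping_eqI)
  fix \<rho>
  define b x y where "b = diag_coeff i \<rho>" and "x = lookup t \<rho>" and "y = lookup t (tableau_swap i \<rho>)"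
  have "lookup (vact i (vact i t)) \<rho>
      = b * b * x + (swap_coeff i \<rho> * swap_coeff i (tableau_swap i \<rho>)) * x"
    unfolding lookup_vact by (simp add: b_def x_def y_def algebra_simps)
  also have "\<dots> = x"
    unfolding swap_coeff_mult by (simp add: b_def algebra_simps power2_eq_square)
  finally show "lookup (vact i (vact i t)) \<rho> = lookup t \<rho>" by (simp add: x_def)
qed

lemma diag_coeff_swap_far:
  "Suc i < j \<Longrightarrow> diag_coeff i (tableau_swap j \<tau>) = diag_coeff i \<tau>"
  "Suc i < j \<Longrightarrow> diag_coeff j (tableau_swap i \<tau>) = diag_coeff j \<tau>"
  "Suc i < j \<Longrightarrow> swap_coeff i (tableau_swap j \<tau>) = swap_coeff i \<tau>"
  "Suc i < j \<Longrightarrow> swap_coeff j (tableau_swap i \<tau>) = swap_coeff j \<tau>"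
  "Suc i < j \<Longrightarrow> swap_coeff j (tableau_swap j (tableau_swap i \<tau>)) = swap_coeff j (tableau_swap j \<tau>)"
  by (simp_all add: diag_coeff_def swap_coeff_def CT_tableau_swap)

lemma vact_commute:
  assumes "Suc i < j"
  shows "vact i (vact j t) = vact j (vact i t)"
  by (rule poly_mapping_eqI)
    (simp add: lookup_vact diag_coeff_swap_far[OF assms] tableau_swap_commute[OF assms] algebra_simps)

text \<open>Permuting three consecutive entries of \<open>\<rho>\<close> gives six fillings. With
  \<open>u\<close>, \<open>v\<close>, \<open>w\<close> the reciprocal content differences,
  everything rests on the partial fraction identity \<open>u * v = w * (u + v)\<close>, which needs
  the three contents to be distinct.\<close>

lemma lookup_vact_braid:
  assumes "CT \<rho> i \<noteq> CT \<rho> (Suc i)" "CT \<rho> (Suc i) \<noteq> CT \<rho> (Suc (Suc i))"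
    "CT \<rho> i \<noteq> CT \<rho> (Suc (Suc i))"
  shows "lookup (vact i (vact (Suc i) (vact i t))) \<rho>
    = lookup (vact (Suc i) (vact i (vact (Suc i) t))) \<rho>"
proof -
  define a b c where "a = CT \<rho> i" and "b = CT \<rho> (Suc i)" and "c = CT \<rho> (Suc (Suc i))"
  have ne: "a \<noteq> b" "b \<noteq> c" "a \<noteq> c" using assms by (simp_all add: a_def b_def c_def)
  define u v w :: ratfun where "u = 1 / of_int (a - b)" and "v = 1 / of_int (b - c)"
    and "w = 1 / of_int (a - c)"
  have neg: "1 / of_int (b - a) = - u" "1 / of_int (c - b) = - v" "1 / of_int (c - a) = - w"
    using ne by (simp_all add: u_def v_def w_def divide_simps)
  have "of_int a \<noteq> (of_int b :: ratfun)" "of_int b \<noteq> (of_int c :: ratfun)"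
    "of_int a \<noteq> (of_int c :: ratfun)"
    using ne by simp_all
  then have uvw: "u * v = w * (u + v)"
    unfolding u_def v_def w_def by (simp add: divide_simps)
  have gu: "swap_fun (a - b) * swap_fun (b - a) = 1 - u\<^sup>2"
    and gv: "swap_fun (b - c) * swap_fun (c - b) = 1 - v\<^sup>2"
    using swap_fun_mult[of "a - b"] swap_fun_mult[of "b - c"] by (simp_all add: u_def v_def)
  have CTs: "CT \<rho> i = a" "CT \<rho> (Suc i) = b" "CT \<rho> (Suc (Suc i)) = c"
    by (simp_all add: a_def b_def c_def)
  let ?s = "tableau_swap i" and ?r = "tableau_swap (Suc i)"
  note lv = lookup_vact diag_coeff_def swap_coeff_def CT_tableau_swap CTs
  define f where "f = lookup t"
  define g where "g = swap_fun"
  have L: "lookup (vact i (vact (Suc i) (vact i t))) \<rho> =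
      u * (v * (u * f \<rho> + g (b - a) * f (?s \<rho>)) + g (c - b) * (w * f (?r \<rho>) + g (c - a) * f (?s (?r \<rho>))))
    + g (b - a) * (w * (- u * f (?s \<rho>) + g (a - b) * f \<rho>) + g (c - a) * (v * f (?r (?s \<rho>))
        + g (c - b) * f (?s (?r (?s \<rho>)))))"
    by (simp add: lv transpose_def neg u_def[symmetric] v_def[symmetric] w_def[symmetric]
      f_def[symmetric] g_def[symmetric] del: of_int_diff)
  have R: "lookup (vact (Suc i) (vact i (vact (Suc i) t))) \<rho> =
      v * (u * (v * f \<rho> + g (c - b) * f (?r \<rho>)) + g (b - a) * (w * f (?s \<rho>) + g (c - a) * f (?r (?s \<rho>))))
    + g (c - b) * (w * (- v * f (?r \<rho>) + g (b - c) * f \<rho>) + g (c - a) * (u * f (?s (?r \<rho>))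
        + g (b - a) * f (?r (?s (?r \<rho>)))))"
    by (simp add: lv transpose_def neg u_def[symmetric] v_def[symmetric] w_def[symmetric]
      f_def[symmetric] g_def[symmetric] del: of_int_diff)
  \<comment> \<open>\<open>e1\<close> compares the coefficients at \<open>\<rho>\<close> itself and
    \<open>e2\<close> those at its two neighbours; the other three agree up to commutativity and the
    braid relation for fillings.\<close>
  have e1: "u * (v * u) + w * (g (a - b) * g (b - a)) = v * (u * v) + w * (g (b - c) * g (c - b))"
    unfolding g_def gu gv using uvw by algebra
  have e2: "u * v - w * u = v * w" "u * w = v * u - w * v"
    using uvw by algebra+
  show ?thesis
    unfolding L R tableau_swap_braid using e1 e2 by algebra
qed

section \<open>Operators on vector-valued polynomials\<close>

lemma lookup_tensor: "lookup (tensor f t) \<tau> = pconst (lookup t \<tau>) * f"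
  by (simp add: tensor_def Poly_Mapping.map.rep_eq when_def)

lemma lookup_mmult: "lookup (mmult f P) \<tau> = f * lookup P \<tau>"
  by (simp add: mmult_def Poly_Mapping.map.rep_eq when_def)

lemma mmult_add: "mmult f (P + Q) = mmult f P + mmult f Q"
  by (rule poly_mapping_eqI) (simp add: lookup_mmult lookup_add algebra_simps)

lemma mmult_diff: "mmult f (P - Q) = mmult f P - mmult f Q"
  by (rule poly_mapping_eqI) (simp add: lookup_mmult lookup_minus algebra_simps)

lemma mmult_add_left: "mmult (f + g) P = mmult f P + mmult g P"
  by (rule poly_mapping_eqI) (simp add: lookup_mmult lookup_add algebra_simps)

lemma mmult_diff_left: "mmult (f - g) P = mmult f P - mmult g P"
  by (rule poly_mapping_eqI) (simp add: lookup_mmult lookup_minus algebra_simps)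

lemma mmult_mmult: "mmult f (mmult g P) = mmult (f * g) P"
  by (rule poly_mapping_eqI) (simp add: lookup_mmult algebra_simps)

lemma mmult_1 [simp]: "mmult 1 P = P" and mmult_0 [simp]: "mmult 0 P = 0"
  and mmult_zero [simp]: "mmult f 0 = 0" and mmult_uminus_left: "mmult (- f) P = - mmult f P"
  by (rule poly_mapping_eqI, simp add: lookup_mmult)+

definition memb :: "vmod \<Rightarrow> mmod" where
  "memb t = tensor 1 t"

lemma lookup_memb: "lookup (memb t) \<tau> = pconst (lookup t \<tau>)"
  by (simp add: memb_def lookup_tensor)

lemma memb_add: "memb (t + u) = memb t + memb u"
  by (rule poly_mapping_eqI) (simp add: lookup_memb lookup_add pconst_add)

lemma memb_vscale: "memb (vscale c t) = mscale c (memb t)"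
  by (rule poly_mapping_eqI) (simp add: lookup_memb lookup_mscale lookup_vscale pconst_mult)

lemma tensor_eq_mmult: "tensor f t = mmult f (memb t)"
  by (rule poly_mapping_eqI) (simp add: lookup_tensor lookup_mmult lookup_memb mult.commute)

text \<open>Acts on the tableau factor alone and therefore commutes with \<open>mmult\<close>;
  \<open>T_op\<close> will be a substitution followed by a word of such operators.\<close>

definition mact :: "nat \<Rightarrow> mmod \<Rightarrow> mmod" where
  "mact i P = (\<Sum>\<tau>\<in>keys P. tensor (lookup P \<tau>) (tableau_act i \<tau>))"

lemma lookup_tableau_act:
  "lookup (tableau_act i \<tau>) \<rho> = (if \<tau> = \<rho> then diag_coeff i \<rho> else 0)
    + (if \<tau> = tableau_swap i \<rho> then swap_coeff i (tableau_swap i \<rho>) else 0)"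
  by (auto simp: tableau_act_eq lookup_add lookup_single when_def tableau_swap_eq_iff)

lemma lookup_sum_tensor_tableau_act:
  assumes "h 0 = 0"
  shows "lookup (\<Sum>\<tau>\<in>keys P. tensor (h (lookup P \<tau>)) (tableau_act i \<tau>)) \<rho>
    = pconst (diag_coeff i \<rho>) * h (lookup P \<rho>)
    + pconst (swap_coeff i (tableau_swap i \<rho>)) * h (lookup P (tableau_swap i \<rho>))"
proof -
  have "lookup (\<Sum>\<tau>\<in>keys P. tensor (h (lookup P \<tau>)) (tableau_act i \<tau>)) \<rho> = (\<Sum>\<tau>\<in>keys P.
      (if \<tau> = \<rho> then pconst (diag_coeff i \<rho>) * h (lookup P \<tau>) else 0)
      + (if \<tau> = tableau_swap i \<rho>
         then pconst (swap_coeff i (tableau_swap i \<rho>)) * h (lookup P \<tau>) else 0))"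
    unfolding lookup_sum lookup_tensor lookup_tableau_act
    by (rule sum.cong) (auto simp: pconst_add distrib_right)
  then show ?thesis
    using assms by (simp add: sum.distrib in_keys_iff)
qed

lemma lookup_mact:
  "lookup (mact i P) \<rho> = pconst (diag_coeff i \<rho>) * lookup P \<rho>
    + pconst (swap_coeff i (tableau_swap i \<rho>)) * lookup P (tableau_swap i \<rho>)"
  unfolding mact_def by (rule lookup_sum_tensor_tableau_act) simp

lemma lookup_varsigma:
  "lookup (varsigma i P) \<rho> = divdiff i (lookup P \<rho>)
    + (pconst (diag_coeff i \<rho>) * pswap i (lookup P \<rho>)
    + pconst (swap_coeff i (tableau_swap i \<rho>)) * pswap i (lookup P (tableau_swap i \<rho>)))"
proof -
  have "(\<Sum>\<tau>\<in>keys P. lookup (tensor (divdiff i (lookup P \<tau>)) (single \<tau> 1)) \<rho>)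
      = (\<Sum>\<tau>\<in>keys P. if \<tau> = \<rho> then divdiff i (lookup P \<tau>) else 0)"
    by (rule sum.cong) (auto simp: lookup_tensor lookup_single when_def)
  then have "lookup (\<Sum>\<tau>\<in>keys P. tensor (divdiff i (lookup P \<tau>)) (single \<tau> 1)) \<rho>
      = divdiff i (lookup P \<rho>)"
    by (simp add: lookup_sum in_keys_iff)
  then show ?thesis
    unfolding varsigma_def sum.distrib lookup_add vact_single
      lookup_sum_tensor_tableau_act[of "pswap i", OF pswap_0] by simp
qed

lemma varsigma_add: "varsigma i (P + Q) = varsigma i P + varsigma i Q"
  by (rule poly_mapping_eqI)
    (simp add: lookup_varsigma lookup_add divdiff_add pswap_add algebra_simps)

text \<open>This twisted Leibniz rule governs how \<open>varsigma\<close> passes a polynomial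
  factor, which is what reduces its relations to constants and single variables.\<close>

lemma varsigma_mmult:
  "varsigma i (mmult f P) = mmult (divdiff i f) P + mmult (pswap i f) (varsigma i P)"
  by (rule poly_mapping_eqI)
    (simp add: lookup_varsigma lookup_add lookup_mmult divdiff_mult pswap_mult algebra_simps)

lemma varsigma_mscale: "varsigma i (mscale c P) = mscale c (varsigma i P)"
  by (simp add: mscale_def varsigma_mmult)

lemma varsigma_diff: "varsigma i (P - Q) = varsigma i P - varsigma i Q"
  using varsigma_add[of i "P - Q" Q] by (simp add: algebra_simps)

lemma varsigma_memb: "varsigma i (memb t) = memb (vact i t)"
  by (rule poly_mapping_eqI) (simp add: lookup_varsigma lookup_memb lookup_vact pconst_add pconst_mult)

definition shift_subst :: "nat \<Rightarrow> mpoly \<Rightarrow> mpoly" where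
  "shift_subst N = psubst (\<lambda>j. if j = 1 then pvar N - pconst alpha else pvar (j - 1))"

lemma shift_subst_simps:
  "shift_subst N (f + g) = shift_subst N f + shift_subst N g"
  "shift_subst N (f * g) = shift_subst N f * shift_subst N g"
  "shift_subst N (pconst c) = pconst c"
  "shift_subst N 0 = 0"
  "shift_subst N (pvar j) = (if j = 1 then pvar N - pconst alpha else pvar (j - 1))"
  by (simp_all add: shift_subst_def psubst_add psubst_mult)

lemma mact_mmult: "mact i (mmult f P) = mmult f (mact i P)"
  by (rule poly_mapping_eqI) (simp add: lookup_mact lookup_mmult algebra_simps)

lemma mact_add: "mact i (P + Q) = mact i P + mact i Q"
  by (rule poly_mapping_eqI) (simp add: lookup_mact lookup_add algebra_simps)

lemma mact_0 [simp]: "mact i 0 = 0"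
  by (rule poly_mapping_eqI) (simp add: lookup_mact)

lemma mact_memb: "mact i (memb t) = memb (vact i t)"
  by (rule poly_mapping_eqI) (simp add: lookup_mact lookup_memb lookup_vact pconst_add pconst_mult)

lemma fold_mact_add: "fold mact w (P + Q) = fold mact w P + fold mact w Q"
  by (induction w arbitrary: P Q) (simp_all add: mact_add)

lemma fold_mact_0 [simp]: "fold mact w 0 = 0"
  by (induction w) simp_all

lemma fold_mact_mmult: "fold mact w (mmult f P) = mmult f (fold mact w P)"
  by (induction w arbitrary: P) (simp_all add: mact_mmult)

lemma fold_mact_memb: "fold mact w (memb t) = memb (vact_word w t)"
  unfolding vact_word_def by (induction w arbitrary: t) (simp_all add: mact_memb)

lemma fold_mact_sum: "finite A \<Longrightarrow> fold mact w (\<Sum>k\<in>A. h k) = (\<Sum>k\<in>A. fold mact w (h k))"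
  by (induction A rule: finite_induct) (simp_all add: fold_mact_add)

lemma tensor_vact_word: "tensor f (vact_word w t) = fold mact w (tensor f t)"
  by (simp add: tensor_eq_mmult fold_mact_mmult fold_mact_memb)

lemma T_op_eq: "T_op N P = fold mact [1..<N] (Poly_Mapping.map (shift_subst N) P)"
proof -
  have "Poly_Mapping.map (shift_subst N) P
      = (\<Sum>\<tau>\<in>keys P. tensor (shift_subst N (lookup P \<tau>)) (single \<tau> 1))"
  proof (rule poly_mapping_eqI)
    fix \<rho>
    have "(\<Sum>\<tau>\<in>keys P. lookup (tensor (shift_subst N (lookup P \<tau>)) (single \<tau> 1)) \<rho>)
        = (\<Sum>\<tau>\<in>keys P. if \<tau> = \<rho> then shift_subst N (lookup P \<tau>) else 0)"
      by (rule sum.cong) (auto simp: lookup_tensor lookup_single when_def)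
    then show "lookup (Poly_Mapping.map (shift_subst N) P) \<rho>
        = lookup (\<Sum>\<tau>\<in>keys P. tensor (shift_subst N (lookup P \<tau>)) (single \<tau> 1)) \<rho>"
      by (simp add: lookup_sum in_keys_iff shift_subst_simps
          Poly_Mapping.map.rep_eq when_def)
  qed
  then show ?thesis
    by (simp add: T_op_def tensor_vact_word fold_mact_sum shift_subst_def)
qed

lemma lookup_map_shift: "lookup (Poly_Mapping.map (shift_subst N) P) \<tau> = shift_subst N (lookup P \<tau>)"
  by (simp add: Poly_Mapping.map.rep_eq when_def shift_subst_simps)

lemma T_op_add: "T_op N (P + Q) = T_op N P + T_op N Q"
proof -
  have "Poly_Mapping.map (shift_subst N) (P + Q)
      = Poly_Mapping.map (shift_subst N) P + Poly_Mapping.map (shift_subst N) Q"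
    by (rule poly_mapping_eqI) (simp add: lookup_map_shift lookup_add shift_subst_simps)
  then show ?thesis by (simp add: T_op_eq fold_mact_add)
qed

lemma T_op_mmult: "T_op N (mmult f P) = mmult (shift_subst N f) (T_op N P)"
proof -
  have "Poly_Mapping.map (shift_subst N) (mmult f P)
      = mmult (shift_subst N f) (Poly_Mapping.map (shift_subst N) P)"
    by (rule poly_mapping_eqI) (simp add: lookup_map_shift lookup_mmult shift_subst_simps)
  then show ?thesis by (simp add: T_op_eq fold_mact_mmult)
qed

lemma T_op_memb: "T_op N (memb t) = memb (vact_word [1..<N] t)"
proof -
  have "Poly_Mapping.map (shift_subst N) (memb t) = memb t"
    by (rule poly_mapping_eqI) (simp add: lookup_map_shift lookup_memb shift_subst_simps)
  then show ?thesis by (simp add: T_op_eq fold_mact_memb)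
qed

lemma Psi_hat_add: "Psi_hat N (P + Q) = Psi_hat N P + Psi_hat N Q"
  by (simp add: Psi_hat_def T_op_add mmult_add)

lemma Psi_hat_mmult: "Psi_hat N (mmult f P) = mmult (shift_subst N f) (Psi_hat N P)"
  by (simp add: Psi_hat_def T_op_mmult mmult_mmult mult.commute)

lemma Psi_hat_mscale: "Psi_hat N (mscale c P) = mscale c (Psi_hat N P)"
  by (simp add: mscale_def Psi_hat_mmult shift_subst_simps)

lemma Psi_hat_diff: "Psi_hat N (P - Q) = Psi_hat N P - Psi_hat N Q"
  using Psi_hat_add[of N "P - Q" Q] by (simp add: algebra_simps)

section \<open>The Coxeter presentation of the symmetric group\<close>

text \<open>The prefix \<open>u\<close> is bounded but the suffix \<open>v\<close> is not: words act
  from the left by \<open>fold\<close>, so the element must still lie in the carrier when a relation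
  is applied, while the rest of the word acts on two equal elements.\<close>

inductive weq :: "nat \<Rightarrow> nat list \<Rightarrow> nat list \<Rightarrow> bool" for n where
  weq_refl: "weq n w w"
| weq_sym: "weq n w w' \<Longrightarrow> weq n w' w"
| weq_trans: "weq n w w' \<Longrightarrow> weq n w' w'' \<Longrightarrow> weq n w w''"
| weq_inv: "set u \<subseteq> {1..<n} \<Longrightarrow> i \<in> {1..<n} \<Longrightarrow> weq n (u @ [i, i] @ v) (u @ v)"
| weq_comm: "set u \<subseteq> {1..<n} \<Longrightarrow> i \<in> {1..<n} \<Longrightarrow> j \<in> {1..<n} \<Longrightarrow> Suc i < j \<Longrightarrow>
    weq n (u @ [i, j] @ v) (u @ [j, i] @ v)"
| weq_braid: "set u \<subseteq> {1..<n} \<Longrightarrow> i \<in> {1..<n} \<Longrightarrow> Suc i \<in> {1..<n} \<Longrightarrow>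
    weq n (u @ [i, Suc i, i] @ v) (u @ [Suc i, i, Suc i] @ v)"

lemma weq_context:
  assumes "weq n w w'" "set a \<subseteq> {1..<n}"
  shows "weq n (a @ w @ b) (a @ w' @ b)"
  using assms(1)
proof (induction rule: weq.induct)
  case (weq_inv u i v)
  then show ?case using assms weq.weq_inv[of "a @ u" n i "v @ b"] by simp
next
  case (weq_comm u i j v)
  then show ?case using assms weq.weq_comm[of "a @ u" n i j "v @ b"] by simp
next
  case (weq_braid u i v)
  then show ?case using assms weq.weq_braid[of "a @ u" n i "v @ b"] by simp
qed (blast intro: weq_refl weq_sym weq_trans)+

lemma weq_mono: "weq n w w' \<Longrightarrow> n \<le> m \<Longrightarrow> weq m w w'"
proof (induction rule: weq.induct)
  case (weq_inv u i v)
  then have "set u \<subseteq> {1..<m}" "i \<in> {1..<m}" by auto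
  then show ?case by (rule weq.weq_inv)
next
  case (weq_comm u i j v)
  then have "set u \<subseteq> {1..<m}" "i \<in> {1..<m}" "j \<in> {1..<m}" "Suc i < j" by auto
  then show ?case by (rule weq.weq_comm)
next
  case (weq_braid u i v)
  then have "set u \<subseteq> {1..<m}" "i \<in> {1..<m}" "Suc i \<in> {1..<m}" by auto
  then show ?case by (rule weq.weq_braid)
qed (blast intro: weq_refl weq_sym weq_trans)+

lemma word_perm_Nil [simp]: "word_perm [] = id"
  and word_perm_Cons: "word_perm (i # w) = transpose i (Suc i) \<circ> word_perm w"
  by (simp_all add: word_perm_def)

lemma word_perm_append: "word_perm (u @ v) = word_perm u \<circ> word_perm v"
  by (induction u) (simp_all add: word_perm_Cons o_assoc)

lemma bij_word_perm: "bij (word_perm w)"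
proof (induction w)
  case (Cons i w)
  then show ?case unfolding word_perm_Cons by (intro bij_comp) simp_all
qed (metis bij_id word_perm_Nil)

lemma weq_word_perm: "weq n w w' \<Longrightarrow> word_perm w = word_perm w'"
  by (induction rule: weq.induct)
    (auto simp: word_perm_append word_perm_Cons fun_eq_iff transpose_def)

lemma word_perm_fixes: "set w \<subseteq> {1..<n} \<Longrightarrow> k \<notin> {1..n} \<Longrightarrow> word_perm w k = k"
  by (induction w) (auto simp: word_perm_Cons transpose_def)

lemma word_perm_upt:
  "a \<le> b \<Longrightarrow> word_perm [a..<b] k = (if k = b then a else if a \<le> k \<and> k < b then Suc k else k)"
proof (induction b arbitrary: k rule: dec_induct)
  case (step b)
  then have "word_perm [a..<Suc b] k = word_perm [a..<b] (transpose b (Suc b) k)"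
    by (simp add: word_perm_append word_perm_Cons)
  then show ?case using step by (auto simp: transpose_def)
qed auto

lemma word_perm_rev_upt:
  "a \<le> b \<Longrightarrow> word_perm (rev [a..<b]) k = (if k = a then b else if a < k \<and> k \<le> b then k - 1 else k)"
proof (induction b arbitrary: k rule: dec_induct)
  case (step b)
  then have "word_perm (rev [a..<Suc b]) k = transpose b (Suc b) (word_perm (rev [a..<b]) k)"
    by (simp add: word_perm_Cons)
  then show ?case using step by (auto simp: transpose_def)
qed auto

lemma weq_move_left:
  assumes "set w \<subseteq> {1..<n}" "i \<in> {1..<n}" "\<forall>j\<in>set w. Suc i < j \<or> Suc j < i"
  shows "weq n (w @ [i]) (i # w)"
  using assms
proof (induction w)
  case Nil
  then show ?case by (simp add: weq_refl)
next
  case (Cons j w)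
  then have "weq n (w @ [i]) (i # w)" by auto
  then have 1: "weq n (j # w @ [i]) (j # i # w)"
    using weq_context[of n "w @ [i]" "i # w" "[j]" "[]"] Cons.prems by auto
  have "weq n (j # i # w) (i # j # w)"
    using Cons.prems weq_comm[of "[]" n i j w, THEN weq_sym] weq_comm[of "[]" n j i w] by auto
  from weq_trans[OF 1 this] show ?case by simp
qed

text \<open>The run is split around its letters \<open>i, i - 1\<close>. The new \<open>i\<close>
  moves left past the smaller letters, the braid relation turns \<open>i, i - 1, i\<close> into
  \<open>i - 1, i, i - 1\<close>, and the first \<open>i - 1\<close> moves left past the larger
  letters.\<close>

lemma weq_descending_snoc:
  assumes "1 \<le> k" "k < i" "i \<le> n"
  shows "weq (Suc n) (rev [k..<Suc n] @ [i]) ((i - 1) # rev [k..<Suc n])"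
proof -
  obtain l where l: "i = Suc l" using assms by (cases i) auto
  let ?A = "rev [Suc i..<Suc n]" and ?B = "rev [k..<l]"
  have "[k..<Suc n] = [k..<l] @ [l, i] @ [Suc i..<Suc n]"
    using assms l upt_add_eq_append[of k l "Suc n - l"] by (simp add: upt_conv_Cons)
  then have eq: "rev [k..<Suc n] = ?A @ [i, l] @ ?B" by simp
  have 0: "weq (Suc n) (?B @ [i]) (i # ?B)"
    by (rule weq_move_left) (use assms l in auto)
  have "weq (Suc n) ((?A @ [i, l]) @ (?B @ [i]) @ []) ((?A @ [i, l]) @ (i # ?B) @ [])"
    by (rule weq_context[OF 0]) (use assms l in auto)
  then have 1: "weq (Suc n) ((?A @ [i, l] @ ?B) @ [i]) (?A @ [Suc l, l, Suc l] @ ?B)"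
    by (simp add: l del: upt_Suc)
  have 2: "weq (Suc n) (?A @ [Suc l, l, Suc l] @ ?B) (?A @ [l, Suc l, l] @ ?B)"
    by (rule weq_sym[OF weq_braid]) (use assms l in auto)
  have "weq (Suc n) ([] @ (?A @ [l]) @ ([i, l] @ ?B)) ([] @ (l # ?A) @ ([i, l] @ ?B))"
    by (rule weq_context[OF weq_move_left]) (use assms l in auto)
  then have 3: "weq (Suc n) (?A @ [l, Suc l, l] @ ?B) ((i - 1) # ?A @ [i, l] @ ?B)"
    by (simp add: l del: upt_Suc)
  show ?thesis
    unfolding eq by (rule weq_trans[OF 1 weq_trans[OF 2 3]])
qed

text \<open>The descending runs represent the cosets of the symmetric group on n letters in the one
  on n + 1 letters, \<open>k = Suc n\<close> being the trivial coset. An appended letter extends the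
  run, cancels its last letter, or emerges on its left unchanged or lowered by one.\<close>

lemma weq_normal_form:
  assumes "set w \<subseteq> {1..<Suc n}"
  shows "\<exists>u k. set u \<subseteq> {1..<n} \<and> 1 \<le> k \<and> k \<le> Suc n \<and> weq (Suc n) w (u @ rev [k..<Suc n])"
  using assms
proof (induction w rule: rev_induct)
  case Nil
  show ?case by (rule exI[of _ "[]"], rule exI[of _ "Suc n"]) (simp add: weq_refl)
next
  case (snoc i w)
  then obtain u k where uk: "set u \<subseteq> {1..<n}" "1 \<le> k" "k \<le> Suc n"
    "weq (Suc n) w (u @ rev [k..<Suc n])"
    by auto
  have i: "1 \<le> i" "i \<le> n" using snoc.prems by auto
  have u: "set u \<subseteq> {1..<Suc n}" using uk(1) by auto
  have w: "weq (Suc n) (w @ [i]) (u @ rev [k..<Suc n] @ [i])"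
    using weq_context[OF uk(4), of "[]" "[i]"] by simp
  consider "Suc i = k" | "i = k" | "Suc i < k" | "k < i" by linarith
  then show ?case
  proof cases
    case 1
    then have "rev [k..<Suc n] @ [i] = rev [i..<Suc n]"
      using i by (simp add: upt_conv_Cons)
    then show ?thesis using w uk i by auto
  next
    case 2
    then have "rev [k..<Suc n] @ [i] = rev [Suc k..<Suc n] @ [i, i] @ []"
      using i upt_conv_Cons[of k "Suc n"] by simp
    then have "weq (Suc n) (u @ rev [k..<Suc n] @ [i]) (u @ rev [Suc k..<Suc n])"
      using weq_inv[of "u @ rev [Suc k..<Suc n]" "Suc n" i "[]"] u i 2 by (auto simp del: upt_Suc)
    from weq_trans[OF w this] show ?thesis
      using uk i 2 by (intro exI[of _ u] exI[of _ "Suc k"]) simp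
  next
    case 3
    have "weq (Suc n) (u @ (rev [k..<Suc n] @ [i]) @ []) (u @ (i # rev [k..<Suc n]) @ [])"
      by (rule weq_context[OF weq_move_left]) (use u uk i 3 in auto)
    then have "weq (Suc n) (u @ rev [k..<Suc n] @ [i]) ((u @ [i]) @ rev [k..<Suc n])"
      by (simp del: upt_Suc)
    from weq_trans[OF w this] have "weq (Suc n) (w @ [i]) ((u @ [i]) @ rev [k..<Suc n])" .
    moreover have "set (u @ [i]) \<subseteq> {1..<n}" using uk i 3 by auto
    ultimately show ?thesis using uk by blast
  next
    case 4
    have "weq (Suc n) (u @ (rev [k..<Suc n] @ [i]) @ []) (u @ ((i - 1) # rev [k..<Suc n]) @ [])"
      by (rule weq_context[OF weq_descending_snoc]) (use u uk i 4 in auto)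
    then have "weq (Suc n) (u @ rev [k..<Suc n] @ [i]) ((u @ [i - 1]) @ rev [k..<Suc n])"
      by (simp del: upt_Suc)
    from weq_trans[OF w this] have "weq (Suc n) (w @ [i]) ((u @ [i - 1]) @ rev [k..<Suc n])" .
    moreover have "set (u @ [i - 1]) \<subseteq> {1..<n}" using uk i 4 by auto
    ultimately show ?thesis using uk by blast
  qed
qed

text \<open>The permutation determines the run of its normal form through the position
  \<open>k\<close> sent to \<open>Suc n\<close>, since the remaining word fixes
  \<open>Suc n\<close>. Cancelling the run leaves two words of the smaller group.\<close>

lemma weq_if_word_perm_eq:
  assumes "set w \<subseteq> {1..<n}" "set w' \<subseteq> {1..<n}" "word_perm w = word_perm w'"
  shows "weq n w w'"
  using assms
proof (induction n arbitrary: w w')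
  case 0
  then show ?case by (simp add: weq_refl)
next
  case (Suc n)
  obtain u k where uk: "set u \<subseteq> {1..<n}" "1 \<le> k" "k \<le> Suc n"
    "weq (Suc n) w (u @ rev [k..<Suc n])"
    using weq_normal_form Suc.prems by blast
  obtain u' k' where uk': "set u' \<subseteq> {1..<n}" "1 \<le> k'" "k' \<le> Suc n"
    "weq (Suc n) w' (u' @ rev [k'..<Suc n])"
    using weq_normal_form Suc.prems by blast
  have p: "word_perm w = word_perm u \<circ> word_perm (rev [k..<Suc n])"
    "word_perm w = word_perm u' \<circ> word_perm (rev [k'..<Suc n])"
    using weq_word_perm[OF uk(4)] weq_word_perm[OF uk'(4)] Suc.prems(3)
    unfolding word_perm_append by (simp_all only:)
  have "word_perm w k = Suc n"
    using word_perm_fixes[OF uk(1), of "Suc n"] uk by (simp only: p(1) o_apply word_perm_rev_upt) simp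
  moreover have "word_perm w k' = Suc n"
    using word_perm_fixes[OF uk'(1), of "Suc n"] uk' by (simp only: p(2) o_apply word_perm_rev_upt) simp
  ultimately have k: "k = k'"
    using bij_is_inj[OF bij_word_perm, of w] by (metis injD)
  have "word_perm u = word_perm u'"
  proof
    fix x
    obtain y where "word_perm (rev [k..<Suc n]) y = x" using bij_word_perm by (metis bij_pointE)
    then show "word_perm u x = word_perm u' x" using p k by (metis comp_apply)
  qed
  then have "weq (Suc n) u u'" using Suc.IH uk(1) uk'(1) weq_mono by (metis le_SucI order_refl)
  then have "weq (Suc n) (u @ rev [k..<Suc n]) (u' @ rev [k..<Suc n])"
    using weq_context[of "Suc n" u u' "[]"] by simp
  then show ?case using uk(4) uk'(4) k by (meson weq_sym weq_trans)
qed

text \<open>Instantiated on \<open>V_space\<close> and on \<open>M\<close>. The carrier is there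
  because the braid relation is available only on combinations of reverse standard tableaux.\<close>

locale coxeter_action =
  fixes n :: nat and C :: "'a set" and s :: "nat \<Rightarrow> 'a \<Rightarrow> 'a"
  assumes closed: "i \<in> {1..<n} \<Longrightarrow> x \<in> C \<Longrightarrow> s i x \<in> C"
    and involution: "i \<in> {1..<n} \<Longrightarrow> x \<in> C \<Longrightarrow> s i (s i x) = x"
    and commute: "i \<in> {1..<n} \<Longrightarrow> j \<in> {1..<n} \<Longrightarrow> Suc i < j \<Longrightarrow> x \<in> C \<Longrightarrow> s i (s j x) = s j (s i x)"
    and braid: "i \<in> {1..<n} \<Longrightarrow> Suc i \<in> {1..<n} \<Longrightarrow> x \<in> C \<Longrightarrow>
      s i (s (Suc i) (s i x)) = s (Suc i) (s i (s (Suc i) x))"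
begin

lemma fold_closed: "set w \<subseteq> {1..<n} \<Longrightarrow> x \<in> C \<Longrightarrow> fold s w x \<in> C"
  by (induction w arbitrary: x) (simp_all add: closed)

lemma fold_weq: "weq n w w' \<Longrightarrow> x \<in> C \<Longrightarrow> fold s w x = fold s w' x"
proof (induction rule: weq.induct)
  case (weq_comm u i j v)
  then show ?case using commute[of i j "fold s u x"] fold_closed by simp
qed (simp_all add: involution braid fold_closed)

lemma fold_eq:
  "set w \<subseteq> {1..<n} \<Longrightarrow> set w' \<subseteq> {1..<n} \<Longrightarrow> word_perm w = word_perm w' \<Longrightarrow> x \<in> C \<Longrightarrow>
    fold s w x = fold s w' x"
  using fold_weq weq_if_word_perm_eq by blast

end

section \<open>Reverse standard tableaux\<close>

locale shape =
  fixes lam :: "nat list" and N :: nat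
  assumes partition: "is_partition lam" and size: "sum_list lam = N" and N_pos: "N \<ge> 1"
begin

abbreviation "D \<equiv> diagram lam"

lemma diagram_down:
  assumes "(r, c) \<in> D" "1 \<le> r'" "r' \<le> r" "1 \<le> c'" "c' \<le> c"
  shows "(r', c') \<in> D"
proof -
  have "lam ! (r - 1) \<le> lam ! (r' - 1)"
  proof (cases "r' = r")
    case False
    then have "r' - 1 < r - 1" "r - 1 < length lam" using assms by (auto simp: diagram_def)
    then show ?thesis
      using partition unfolding is_partition_def by (metis sorted_wrt_nth_less)
  qed simp
  then show ?thesis using assms by (auto simp: diagram_def)
qed

lemma diagram_Sigma: "D = Sigma {1..length lam} (\<lambda>r. {1..lam ! (r - 1)})"
  by (auto simp: diagram_def)

lemma finite_diagram: "finite D"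
  unfolding diagram_Sigma by auto

lemma card_diagram: "card D = N"
proof -
  have "card D = (\<Sum>r=1..length lam. lam ! (r - 1))"
    unfolding diagram_Sigma by (simp add: card_SigmaI)
  also have "\<dots> = (\<Sum>r=0..<length lam. lam ! r)"
    by (rule sum.reindex_bij_witness[of _ Suc "\<lambda>r. r - 1"]) auto
  also have "\<dots> = N" using size by (simp add: sum_list_sum_nth)
  finally show ?thesis .
qed

text \<open>Monotonicity is left out because the interchange belonging to an edge to the empty
  vertex leaves \<open>RST lam\<close> but must still be compared by its contents.\<close>

definition filling :: "tableau \<Rightarrow> bool" where
  "filling f \<longleftrightarrow> bij_betw f D {1..N} \<and> (\<forall>p. p \<notin> D \<longrightarrow> f p = 0)"

lemma filling_inj: "filling f \<Longrightarrow> p \<in> D \<Longrightarrow> q \<in> D \<Longrightarrow> f p = f q \<longleftrightarrow> p = q"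
  unfolding filling_def bij_betw_def by (blast dest: inj_onD)

lemma filling_range: "filling f \<Longrightarrow> p \<in> D \<Longrightarrow> f p \<in> {1..N}"
  unfolding filling_def bij_betw_def by blast

lemma CT_filling:
  assumes "filling f" "(r, c) \<in> D"
  shows "CT f (f (r, c)) = int c - int r"
proof -
  have "(THE p. f p = f (r, c)) = (r, c)"
  proof (rule the_equality)
    fix p assume p: "f p = f (r, c)"
    have "f (r, c) \<noteq> 0" using filling_range[OF assms] by auto
    then have "p \<in> D" using p assms unfolding filling_def by metis
    then show "p = (r, c)" using p assms filling_inj by blast
  qed simp
  then show ?thesis by (simp add: CT_def)
qed

lemma filling_cell:
  assumes "filling f" "i \<in> {1..N}"
  obtains r c where "(r, c) \<in> D" "f (r, c) = i" "CT f i = int c - int r"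
proof -
  have "i \<in> f ` D" using assms unfolding filling_def bij_betw_def by blast
  then obtain r c where "(r, c) \<in> D" "f (r, c) = i" by auto
  then show ?thesis using that CT_filling[OF assms(1)] by blast
qed

lemma RST_filling: "\<tau> \<in> RST lam \<Longrightarrow> filling \<tau>"
  unfolding RST_def filling_def size by blast

lemma RST_less:
  assumes "\<tau> \<in> RST lam" "(r, c) \<in> D" "(r', c') \<in> D" "r \<le> r'" "c \<le> c'" "r < r' \<or> c < c'"
  shows "\<tau> (r', c') < \<tau> (r, c)"
proof -
  have m: "(r, c') \<in> D" using diagram_down[OF assms(3), of r c'] assms by (auto simp: diagram_def)
  have 1: "c < c' \<Longrightarrow> \<tau> (r, c') < \<tau> (r, c)" and 2: "r < r' \<Longrightarrow> \<tau> (r', c') < \<tau> (r, c')"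
    using assms m unfolding RST_def by blast+
  show ?thesis
  proof (cases "c < c'")
    case True
    then show ?thesis using 1 2 assms by (cases "r < r'") (auto dest: less_trans)
  next
    case False
    then show ?thesis using 2 assms by auto
  qed
qed

lemma filling_swap:
  assumes "filling f" "i \<in> {1..<N}"
  shows "filling (tableau_swap i f)"
proof -
  have "bij_betw (transpose i (Suc i)) {1..N} {1..N}"
    by (rule bij_betw_byWitness[of _ "transpose i (Suc i)"]) (use assms in \<open>auto simp: transpose_def\<close>)
  then have "bij_betw (transpose i (Suc i) \<circ> f) D {1..N}"
    using assms unfolding filling_def by (blast intro: bij_betw_trans)
  then show ?thesis
    using assms unfolding filling_def tableau_swap_def by (auto simp: o_def)
qed

text \<open>Equal contents mean a common diagonal. The other two corners of the rectangle spanned by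
  the two cells carry different entries strictly between \<open>i\<close> and \<open>j\<close>, so
  entries on one diagonal differ by at least 3. This supplies the distinct contents for the braid
  relation.\<close>

lemma RST_CT_close:
  assumes "\<tau> \<in> RST lam" "1 \<le> i" "i < j" "j \<le> i + 2" "j \<le> N"
  shows "CT \<tau> i \<noteq> CT \<tau> j"
proof
  assume eq: "CT \<tau> i = CT \<tau> j"
  have fil: "filling \<tau>" using assms RST_filling by blast
  have ij: "i \<in> {1..N}" "j \<in> {1..N}" using assms by auto
  from fil ij(1) obtain r c where p: "(r, c) \<in> D" "\<tau> (r, c) = i" "CT \<tau> i = int c - int r"
    by (rule filling_cell)
  from fil ij(2) obtain r' c' where q: "(r', c') \<in> D" "\<tau> (r', c') = j" "CT \<tau> j = int c' - int r'"
    by (rule filling_cell)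
  have d: "int c - int r = int c' - int r'" using p q eq by simp
  have "\<not> (r \<le> r' \<and> c \<le> c')"
  proof
    assume *: "r \<le> r' \<and> c \<le> c'"
    show False
    proof (cases "r < r' \<or> c < c'")
      case True
      then show False using RST_less[OF assms(1) p(1) q(1)] * p q assms by simp
    next
      case False
      then show False using * p q assms by auto
    qed
  qed
  then have lt: "r' < r" "c' < c" using d by linarith+
  have ge: "1 \<le> r'" "1 \<le> c'" using q by (auto simp: diagram_def)
  have m1: "(r', c) \<in> D" and m2: "(r, c') \<in> D"
    using diagram_down[OF p(1)] lt ge by auto
  have "\<tau> (r', c) < j" "\<tau> (r, c') < j" "i < \<tau> (r', c)" "i < \<tau> (r, c')"
    using RST_less[OF assms(1) q(1) m1] RST_less[OF assms(1) q(1) m2]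
      RST_less[OF assms(1) m1 p(1)] RST_less[OF assms(1) m2 p(1)] lt p q by auto
  then have "\<tau> (r', c) = \<tau> (r, c')" using assms by linarith
  then show False using filling_inj[OF fil m1 m2] lt by simp
qed

lemma transpose_mono_unless: "x < y \<Longrightarrow> \<not> (x = i \<and> y = Suc i) \<Longrightarrow> transpose i (Suc i) x < transpose i (Suc i) y"
  by (auto simp: transpose_def)

text \<open>Monotonicity could fail only if the two entries shared a row or a column. Their contents
  would then force a cell between them, whose entry would lie strictly between two consecutive
  numbers.\<close>

lemma RST_swap:
  assumes "\<tau> \<in> RST lam" "i \<in> {1..<N}" "\<bar>CT \<tau> i - CT \<tau> (Suc i)\<bar> \<ge> 2"
  shows "tableau_swap i \<tau> \<in> RST lam"
proof -
  have fil: "filling \<tau>" using assms RST_filling by blast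
  have row: "\<not> (\<tau> (r, c') = i \<and> \<tau> (r, c) = Suc i)"
    if "(r, c) \<in> D" "(r, c') \<in> D" "c < c'" for r c c'
  proof
    assume *: "\<tau> (r, c') = i \<and> \<tau> (r, c) = Suc i"
    then have "CT \<tau> i = int c' - int r" "CT \<tau> (Suc i) = int c - int r"
      using CT_filling[OF fil that(1)] CT_filling[OF fil that(2)] by simp_all
    then have "c + 1 < c'" using assms(3) that(3) by linarith
    moreover from this have "(r, c + 1) \<in> D"
      using diagram_down[OF that(2), of r "c + 1"] that(1) by (auto simp: diagram_def)
    ultimately have "\<tau> (r, c') < \<tau> (r, c + 1)" "\<tau> (r, c + 1) < \<tau> (r, c)"
      using RST_less[OF assms(1) that(1), of r "c + 1"]
        RST_less[OF assms(1) _ that(2), of r "c + 1"] by auto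
    then show False using * by linarith
  qed
  have col: "\<not> (\<tau> (r', c) = i \<and> \<tau> (r, c) = Suc i)"
    if "(r, c) \<in> D" "(r', c) \<in> D" "r < r'" for r r' c
  proof
    assume *: "\<tau> (r', c) = i \<and> \<tau> (r, c) = Suc i"
    then have "CT \<tau> i = int c - int r'" "CT \<tau> (Suc i) = int c - int r"
      using CT_filling[OF fil that(1)] CT_filling[OF fil that(2)] by simp_all
    then have "r + 1 < r'" using assms(3) that(3) by linarith
    moreover from this have "(r + 1, c) \<in> D"
      using diagram_down[OF that(2), of "r + 1" c] that(1) by (auto simp: diagram_def)
    ultimately have "\<tau> (r', c) < \<tau> (r + 1, c)" "\<tau> (r + 1, c) < \<tau> (r, c)"
      using RST_less[OF assms(1) that(1), of "r + 1" c]
        RST_less[OF assms(1) _ that(2), of "r + 1" c] by auto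
    then show False using * by linarith
  qed
  have "filling (tableau_swap i \<tau>)" using filling_swap fil assms by blast
  moreover have "tableau_swap i \<tau> (r, c') < tableau_swap i \<tau> (r, c)"
    if "(r, c) \<in> D" "(r, c') \<in> D" "c < c'" for r c c'
    unfolding tableau_swap_def
    using transpose_mono_unless RST_less[OF assms(1) that(1,2)] row[OF that] that by simp
  moreover have "tableau_swap i \<tau> (r', c) < tableau_swap i \<tau> (r, c)"
    if "(r, c) \<in> D" "(r', c) \<in> D" "r < r'" for r r' c
    unfolding tableau_swap_def
    using transpose_mono_unless RST_less[OF assms(1) that(1,2)] col[OF that] that by simp
  ultimately show ?thesis
    unfolding RST_def filling_def size by blast
qed

definition diagonal_decreasing :: "tableau \<Rightarrow> bool" where
  "diagonal_decreasing f \<longleftrightarrow> (\<forall>r c r' c'. (r, c) \<in> D \<longrightarrow> (r', c') \<in> D \<longrightarrow> r < r' \<longrightarrow>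
      int c' - int r' = int c - int r \<longrightarrow> f (r', c') < f (r, c))"

lemma RST_diagonal_decreasing: "\<tau> \<in> RST lam \<Longrightarrow> diagonal_decreasing \<tau>"
  unfolding diagonal_decreasing_def by (auto intro!: RST_less)

text \<open>Since \<open>i\<close> and \<open>i + 1\<close> never share a diagonal, their interchange leaves each diagonal
  decreasing even when the result is not an RST.\<close>

lemma swap_diagonal_decreasing:
  assumes "\<tau> \<in> RST lam" "i \<in> {1..<N}"
  shows "diagonal_decreasing (tableau_swap i \<tau>)"
  unfolding diagonal_decreasing_def
proof (intro allI impI)
  fix r c r' c'
  assume *: "(r, c) \<in> D" "(r', c') \<in> D" "r < r'" "int c' - int r' = int c - int r"
  have fil: "filling \<tau>" using assms RST_filling by blast
  have "\<not> (\<tau> (r', c') = i \<and> \<tau> (r, c) = Suc i)"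
  proof
    assume "\<tau> (r', c') = i \<and> \<tau> (r, c) = Suc i"
    then have "CT \<tau> i = CT \<tau> (Suc i)"
      using CT_filling[OF fil *(1)] CT_filling[OF fil *(2)] * by simp
    then show False using RST_CT_close[OF assms(1), of i "Suc i"] assms(2) by simp
  qed
  moreover have "\<tau> (r', c') < \<tau> (r, c)"
    using RST_diagonal_decreasing[OF assms(1)] * unfolding diagonal_decreasing_def by blast
  ultimately show "tableau_swap i \<tau> (r', c') < tableau_swap i \<tau> (r, c)"
    unfolding tableau_swap_def using transpose_mono_unless by simp
qed

text \<open>In \<open>g\<close> the number \<open>f (r, c)\<close> stands on the same diagonal. It
  cannot stand in a lower row, where both fillings agree, so it stands further up, where
  \<open>g\<close> is smaller than at \<open>(r, c)\<close>. Exchanging \<open>f\<close> and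
  \<open>g\<close> then gives a contradiction.\<close>

lemma filling_le_if_contents:
  assumes f: "filling f" "diagonal_decreasing f" and g: "filling g" "diagonal_decreasing g"
    and CT: "\<And>i. i \<in> {1..N} \<Longrightarrow> CT f i = CT g i"
    and p: "(r, c) \<in> D" "f (r, c) \<noteq> g (r, c)"
    and min: "\<And>r' c'. (r', c') \<in> D \<Longrightarrow> r' < r \<Longrightarrow> f (r', c') = g (r', c')"
  shows "f (r, c) < g (r, c)"
proof -
  let ?i = "f (r, c)"
  have i: "?i \<in> {1..N}" using filling_range f p by blast
  from g(1) i obtain r' c' where q: "(r', c') \<in> D" "g (r', c') = ?i" "CT g ?i = int c' - int r'"
    by (rule filling_cell)
  have d: "int c' - int r' = int c - int r"
    using CT_filling[OF f(1) p(1)] CT[OF i] q(3) by simp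
  have "\<not> r' < r" using min[of r' c'] q filling_inj[OF f(1) p(1) q(1)] by auto
  moreover have "r' \<noteq> r" using q p d by auto
  ultimately have "r < r'" by simp
  then show ?thesis using g(2) p q d unfolding diagonal_decreasing_def by metis
qed

lemma filling_eq_if_contents:
  assumes f: "filling f" "diagonal_decreasing f" and g: "filling g" "diagonal_decreasing g"
    and CT: "\<And>i. i \<in> {1..N} \<Longrightarrow> CT f i = CT g i"
  shows "f = g"
proof (rule ccontr)
  assume "f \<noteq> g"
  then obtain p where "f p \<noteq> g p" by blast
  then have "\<exists>r c. (r, c) \<in> D \<and> f (r, c) \<noteq> g (r, c)"
    using f g unfolding filling_def by (metis surj_pair)
  then obtain r where r: "\<exists>c. (r, c) \<in> D \<and> f (r, c) \<noteq> g (r, c)"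
    and "\<forall>r'<r. \<not> (\<exists>c. (r', c) \<in> D \<and> f (r', c) \<noteq> g (r', c))"
    using exists_least_iff[of "\<lambda>r. \<exists>c. (r, c) \<in> D \<and> f (r, c) \<noteq> g (r, c)"] by blast
  then have min: "(r', c') \<in> D \<Longrightarrow> r' < r \<Longrightarrow> f (r', c') = g (r', c')" for r' c' by blast
  from r obtain c where c: "(r, c) \<in> D" "f (r, c) \<noteq> g (r, c)" by blast
  have "f (r, c) < g (r, c)" by (rule filling_le_if_contents[OF f g CT c min])
  moreover have "g (r, c) < f (r, c)"
    by (rule filling_le_if_contents[OF g f CT[symmetric] c(1) c(2)[symmetric] min[symmetric]])
  ultimately show False by simp
qed

lemma CT_N: "\<tau> \<in> RST lam \<Longrightarrow> CT \<tau> N = 0"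
proof -
  assume \<tau>: "\<tau> \<in> RST lam"
  have "N \<in> {1..N}" using N_pos by simp
  with RST_filling[OF \<tau>] obtain r c where p: "(r, c) \<in> D" "\<tau> (r, c) = N" "CT \<tau> N = int c - int r"
    by (rule filling_cell)
  have rc: "1 \<le> r" "1 \<le> c" using p by (auto simp: diagram_def)
  then have m: "(1, 1) \<in> D" using diagram_down[OF p(1)] by simp
  have "\<not> (1 < r \<or> 1 < c)"
  proof
    assume "1 < r \<or> 1 < c"
    then have "N < \<tau> (1, 1)" using RST_less[OF \<tau> m p(1)] rc p(2) by simp
    then show False using filling_range[OF RST_filling[OF \<tau>] m] by simp
  qed
  then show ?thesis using rc p by simp
qed

subsection \<open>The root tableau\<close>

definition before :: "nat \<times> nat \<Rightarrow> (nat \<times> nat) set" where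
  "before p = {q \<in> D. snd q < snd p \<or> snd q = snd p \<and> fst q < fst p}"

lemma root_tableau_eq: "root_tableau lam p = (if p \<in> D then N - card (before p) else 0)"
proof (cases p)
  case (Pair r c)
  have "{(r', c') \<in> D. c' < c \<or> c' = c \<and> r' < r} = before p"
    unfolding before_def Pair by auto
  then show ?thesis by (simp add: root_tableau_def Pair size)
qed

lemma finite_before: "finite (before p)"
  using finite_diagram by (auto simp: before_def)

lemma card_before_less:
  assumes "p \<in> D" "q \<in> before p'" "p' = p"
  shows "card (before q) < card (before p)"
proof (rule psubset_card_mono[OF finite_before])
  have "q \<in> before p" "q \<notin> before q" "before q \<subseteq> before p"
    using assms unfolding before_def by auto
  then show "before q \<subset> before p" by blast
qed

lemma card_before_less_N: "p \<in> D \<Longrightarrow> card (before p) < N"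
  unfolding card_diagram[symmetric]
  by (rule psubset_card_mono[OF finite_diagram]) (auto simp: before_def)

lemma root_less:
  assumes "p \<in> D" "q \<in> before p"
  shows "root_tableau lam p < root_tableau lam q"
proof -
  have "q \<in> D" using assms by (auto simp: before_def)
  then show ?thesis
    using card_before_less[OF assms refl] card_before_less_N[OF assms(1)] assms
    by (simp add: root_tableau_eq)
qed

lemma root_RST: "root_tableau lam \<in> RST lam"
proof -
  let ?f = "root_tableau lam"
  have tot: "p = q \<or> p \<in> before q \<or> q \<in> before p" if "p \<in> D" "q \<in> D" for p q
    using that unfolding before_def by (cases p; cases q) auto
  have inj: "inj_on ?f D"
  proof (rule inj_onI)
    fix p q assume "p \<in> D" "q \<in> D" "?f p = ?f q"
    then show "p = q" using tot[of p q] root_less[of p q] root_less[of q p] by auto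
  qed
  have "?f ` D \<subseteq> {1..N}"
    using card_before_less_N by (auto simp: root_tableau_eq Suc_le_eq)
  moreover have "card (?f ` D) = card {1..N}"
    using card_image[OF inj] card_diagram by simp
  ultimately have "?f ` D = {1..N}" by (intro card_subset_eq) auto
  with inj have "bij_betw ?f D {1..N}" by (simp add: bij_betw_def)
  moreover have "?f (r, c') < ?f (r, c)" if "(r, c) \<in> D" "(r, c') \<in> D" "c < c'" for r c c'
    using root_less[OF that(2), of "(r, c)"] that by (simp add: before_def)
  moreover have "?f (r', c) < ?f (r, c)" if "(r, c) \<in> D" "(r', c) \<in> D" "r < r'" for r r' c
    using root_less[OF that(2), of "(r, c)"] that by (simp add: before_def)
  moreover have "?f p = 0" if "p \<notin> D" for p using that by (simp add: root_tableau_eq)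
  ultimately show ?thesis unfolding RST_def size by blast
qed

text \<open>Between the entries of two vertically adjacent cells the content has to climb by one in
  total, in steps of at most one. The last entry before the climb must have the content of one of
  the two cells, and monotonicity leaves only the upper cell for it.\<close>

lemma column_consecutive:
  assumes \<tau>: "\<tau> \<in> RST lam"
    and step: "\<And>i. i \<in> {1..<N} \<Longrightarrow> CT \<tau> (Suc i) \<le> CT \<tau> i + 1"
    and "(r, c) \<in> D" "(Suc r, c) \<in> D"
  shows "Suc (\<tau> (Suc r, c)) = \<tau> (r, c)"
proof -
  have fil: "filling \<tau>" using \<tau> RST_filling by blast
  define j n where "j = \<tau> (Suc r, c)" and "n = \<tau> (r, c)"
  have jn: "j < n" unfolding j_def n_def using RST_less[OF \<tau> assms(3,4)] by simp
  have rng: "1 \<le> j" "n \<le> N"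
    using filling_range[OF fil assms(3)] filling_range[OF fil assms(4)] by (auto simp: j_def n_def)
  have cj: "CT \<tau> j = int c - int r - 1" and cn: "CT \<tau> n = int c - int r"
    using CT_filling[OF fil assms(3)] CT_filling[OF fil assms(4)] by (simp_all add: j_def n_def)
  let ?S = "{i. j \<le> i \<and> i < n \<and> CT \<tau> i \<le> int c - int r}"
  have "finite ?S" "j \<in> ?S" using jn cj by auto
  \<comment> \<open>The last entry before \<open>n\<close> whose content has not passed that of the
    lower cell.\<close>
  define i where "i = Max ?S"
  have "i \<in> ?S" unfolding i_def using Max_in[of ?S] \<open>finite ?S\<close> \<open>j \<in> ?S\<close> by blast
  then have i: "j \<le> i" "i < n" "CT \<tau> i \<le> int c - int r" by auto
  have iN: "i \<in> {1..<N}" "i \<in> {1..N}" using i rng by auto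
  have above_i: "Suc i \<notin> ?S" using Max_ge[OF \<open>finite ?S\<close>, of "Suc i"] unfolding i_def by linarith
  have "CT \<tau> (Suc i) \<ge> int c - int r"
  proof (cases "Suc i = n")
    case False
    show ?thesis using above_i i False by fastforce
  qed (use cn in simp)
  then have ci: "CT \<tau> i = int c - int r \<or> CT \<tau> i = int c - int r - 1"
    using step[OF iN(1)] i(3) by linarith
  from fil iN(2) obtain r' c' where q: "(r', c') \<in> D" "\<tau> (r', c') = i" "CT \<tau> i = int c' - int r'"
    by (rule filling_cell)
  have above: "\<not> (r' \<le> r \<and> c' \<le> c)"
  proof
    assume *: "r' \<le> r \<and> c' \<le> c"
    show False
    proof (cases "r' < r \<or> c' < c")
      case True
      then show False using RST_less[OF \<tau> q(1) assms(3)] * q i by (simp add: n_def)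
    next
      case False
      then show False using * q i by (auto simp: n_def)
    qed
  qed
  have below: "\<not> (Suc r \<le> r' \<and> c \<le> c' \<and> (Suc r < r' \<or> c < c'))"
  proof
    assume "Suc r \<le> r' \<and> c \<le> c' \<and> (Suc r < r' \<or> c < c')"
    then have "\<tau> (r', c') < \<tau> (Suc r, c)" using RST_less[OF \<tau> assms(4) q(1)] by blast
    then show False using q i by (simp add: j_def)
  qed
  have "r' = Suc r \<and> c' = c"
    using ci above below unfolding q(3) by linarith
  then have "i = j" using q by (simp add: j_def)
  moreover have "Suc i = n"
  proof (rule ccontr)
    assume "Suc i \<noteq> n"
    then have "CT \<tau> (Suc i) > int c - int r" using above_i i by fastforce
    then show False using step[OF iN(1)] \<open>i = j\<close> cj by simp
  qed
  ultimately show ?thesis by (simp add: j_def n_def)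
qed

text \<open>Each column is a run of consecutive numbers, and the runs cannot interleave, so the
  filling follows the column reading order. It identifies the tableau at which the descent in
  \<open>RST_induct\<close> stops.\<close>

lemma root_tableau_characterization:
  assumes \<tau>: "\<tau> \<in> RST lam"
    and step: "\<And>i. i \<in> {1..<N} \<Longrightarrow> CT \<tau> (Suc i) \<le> CT \<tau> i + 1"
  shows "\<tau> = root_tableau lam"
proof -
  have fil: "filling \<tau>" using \<tau> RST_filling by blast
  have col: "\<tau> (Suc r, c) + r = \<tau> (1, c)" if "(Suc r, c) \<in> D" for r c
    using that
  proof (induction r)
    case (Suc r)
    have "(Suc r, c) \<in> D" using diagram_down[OF Suc.prems, of "Suc r" c] Suc.prems by (auto simp: diagram_def)
    then show ?case using Suc.IH column_consecutive[OF \<tau> step _ Suc.prems] by simp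
  qed simp
  have cols: "\<tau> (r', c') < \<tau> (r, c)" if p: "(r, c) \<in> D" and q: "(r', c') \<in> D" and "c < c'" for r c r' c'
  proof (rule ccontr)
    assume "\<not> \<tau> (r', c') < \<tau> (r, c)"
    then have le: "\<tau> (r, c) \<le> \<tau> (r', c')" by simp
    have ge: "1 \<le> r" "1 \<le> c" "1 \<le> r'" "1 \<le> c'" using p q by (auto simp: diagram_def)
    have m: "(1, c) \<in> D" "(1, c') \<in> D" using diagram_down[OF p] diagram_down[OF q] ge by auto
    have 1: "\<tau> (1, c') < \<tau> (1, c)" using RST_less[OF \<tau> m] \<open>c < c'\<close> by simp
    have 2: "\<tau> (r', c') \<le> \<tau> (1, c')"
      using RST_less[OF \<tau> m(2) q] ge by (cases "r' = 1") auto
    have 3: "\<tau> (r, c) + (r - 1) = \<tau> (1, c)" using col[of "r - 1" c] p ge by simp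
    \<comment> \<open>If the columns interleaved, the bottom entry of the right column would fall
      inside the run of the left column and occur there a second time, \<open>k\<close> cells above
      the bottom.\<close>
    define k where "k = \<tau> (1, c) - \<tau> (1, c')"
    have k: "k \<le> r - 1" using 1 2 3 le unfolding k_def by linarith
    have m': "(Suc k, c) \<in> D" using diagram_down[OF p, of "Suc k" c] k ge by auto
    have "\<tau> (Suc k, c) = \<tau> (1, c')" using col[OF m'] 1 unfolding k_def by linarith
    then show False using filling_inj[OF fil m' m(2)] \<open>c < c'\<close> by simp
  qed
  have "\<tau> p = N - card (before p)" if p: "p \<in> D" for p
  proof -
    have "q \<in> before p \<longleftrightarrow> \<tau> p < \<tau> q" if q: "q \<in> D" for q
    proof -
      obtain r c r' c' where pq: "p = (r, c)" "q = (r', c')" by (cases p; cases q)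
      consider "c < c'" | "c' < c" | "c = c'" "r < r'" | "c = c'" "r' < r" | "c = c'" "r = r'"
        by linarith
      then show ?thesis
      proof cases
        case 1
        then show ?thesis using cols[of r c r' c'] p q pq by (auto simp: before_def)
      next
        case 2
        then show ?thesis using cols[of r' c' r c] p q pq by (auto simp: before_def)
      next
        case 3
        then show ?thesis using RST_less[OF \<tau>, of r c r' c'] p q pq by (auto simp: before_def)
      next
        case 4
        then show ?thesis using RST_less[OF \<tau>, of r' c' r c] p q pq by (auto simp: before_def)
      next
        case 5
        then show ?thesis using pq by (auto simp: before_def)
      qed
    qed
    then have "before p = {q \<in> D. \<tau> p < \<tau> q}" by (auto simp: before_def)
    moreover have "\<tau> ` {q \<in> D. \<tau> p < \<tau> q} = {\<tau> p<..N}"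
    proof -
      have im: "\<tau> ` D = {1..N}" using fil unfolding filling_def bij_betw_def by blast
      show ?thesis
      proof (intro equalityI subsetI)
        fix x assume x: "x \<in> {\<tau> p<..N}"
        then have "x \<in> \<tau> ` D" unfolding im by auto
        then show "x \<in> \<tau> ` {q \<in> D. \<tau> p < \<tau> q}" using x by auto
      qed (use im in auto)
    qed
    moreover have "inj_on \<tau> {q \<in> D. \<tau> p < \<tau> q}"
      using fil unfolding filling_def bij_betw_def by (auto intro: inj_on_subset)
    ultimately have "card (before p) = N - \<tau> p"
      using card_image by fastforce
    then show ?thesis using filling_range[OF fil p] by auto
  qed
  then show ?thesis
    using fil by (auto simp: fun_eq_iff root_tableau_eq filling_def)
qed

text \<open>Any tableau other than the root has consecutive entries whose contents rise by at least
  2. Interchanging them gives a tableau from which the ascending edge leads back, and it lowers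
  \<open>W\<close> by the content gap.\<close>

lemma RST_induct [consumes 1, case_names root swap]:
  assumes "\<tau> \<in> RST lam"
    and root: "Q (root_tableau lam)"
    and swap: "\<And>\<tau> i. \<tau> \<in> RST lam \<Longrightarrow> i \<in> {1..<N} \<Longrightarrow> CT \<tau> i - CT \<tau> (Suc i) \<ge> 2 \<Longrightarrow>
      Q \<tau> \<Longrightarrow> Q (tableau_swap i \<tau>)"
  shows "Q \<tau>"
proof -
  \<comment> \<open>The shift by \<open>length lam\<close> keeps every summand nonnegative, since
    contents exceed \<open>- length lam\<close>.\<close>
  define W where "W \<tau> = (\<Sum>j=1..N. int j * (CT \<tau> j + int (length lam)))" for \<tau>
  have W_nonneg: "W \<tau> \<ge> 0" if "\<tau> \<in> RST lam" for \<tau>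
    unfolding W_def
  proof (rule sum_nonneg)
    fix j assume "j \<in> {1..N}"
    with RST_filling[OF that] obtain r c where "(r, c) \<in> D" "CT \<tau> j = int c - int r"
      by (rule filling_cell)
    then show "0 \<le> int j * (CT \<tau> j + int (length lam))" by (auto simp: diagram_def)
  qed
  have W_swap: "W (tableau_swap i \<tau>) = W \<tau> + CT \<tau> i - CT \<tau> (Suc i)" if "i \<in> {1..<N}" for i \<tau>
  proof -
    have "W (tableau_swap i \<tau>) - W \<tau>
        = (\<Sum>j=1..N. int j * (CT \<tau> (transpose i (Suc i) j) - CT \<tau> j))"
      unfolding W_def by (simp add: CT_tableau_swap sum_subtractf[symmetric] algebra_simps)
    also have "\<dots> = (\<Sum>j\<in>{i, Suc i}. int j * (CT \<tau> (transpose i (Suc i) j) - CT \<tau> j))"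
      by (rule sum.mono_neutral_right) (use that in \<open>auto simp: transpose_def\<close>)
    also have "\<dots> = CT \<tau> i - CT \<tau> (Suc i)" by (simp add: algebra_simps)
    finally show ?thesis by simp
  qed
  show ?thesis using assms(1)
  proof (induction "nat (W \<tau>)" arbitrary: \<tau> rule: less_induct)
    case less
    show ?case
    proof (cases "\<forall>i\<in>{1..<N}. CT \<tau> (Suc i) \<le> CT \<tau> i + 1")
      case True
      then show ?thesis using root_tableau_characterization[OF less.prems] root by simp
    next
      case False
      then obtain i where i: "i \<in> {1..<N}" "CT \<tau> (Suc i) - CT \<tau> i \<ge> 2" by force
      let ?\<tau> = "tableau_swap i \<tau>"
      have R: "?\<tau> \<in> RST lam" by (rule RST_swap) (use less.prems i in auto)
      then have "Q ?\<tau>"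
        using less.hyps[of ?\<tau>] W_swap[OF i(1), of \<tau>] W_nonneg[OF R] W_nonneg[OF less.prems] i by auto
      then show ?thesis
        using swap[OF R i(1)] i by (simp add: CT_tableau_swap)
    qed
  qed
qed

section \<open>The representation on \<open>V\<^sub>\<lambda>\<close>\<close>

definition V_space :: "vmod set" where
  "V_space = {t. keys t \<subseteq> RST lam}"

lemma V_spaceI: "(\<And>\<rho>. \<rho> \<notin> RST lam \<Longrightarrow> lookup t \<rho> = 0) \<Longrightarrow> t \<in> V_space"
  unfolding V_space_def by (auto simp: in_keys_iff)

lemma V_spaceD: "t \<in> V_space \<Longrightarrow> \<rho> \<notin> RST lam \<Longrightarrow> lookup t \<rho> = 0"
  unfolding V_space_def by (auto simp: in_keys_iff)

lemma V_space_single: "\<tau> \<in> RST lam \<Longrightarrow> single \<tau> c \<in> V_space"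
  unfolding V_space_def by (auto split: if_splits)

lemma swap_coeff_RST:
  assumes "\<tau> \<in> RST lam" "i \<in> {1..<N}" "swap_coeff i \<tau> \<noteq> 0"
  shows "tableau_swap i \<tau> \<in> RST lam"
proof -
  have "CT \<tau> i \<noteq> CT \<tau> (Suc i)" using RST_CT_close[OF assms(1), of i "Suc i"] assms(2) by simp
  moreover have "\<bar>CT \<tau> i - CT \<tau> (Suc i)\<bar> \<noteq> 1"
    using assms(3) unfolding swap_coeff_def swap_fun_def by (auto simp: abs_if split: if_splits)
  ultimately show ?thesis using RST_swap[OF assms(1,2)] by linarith
qed

text \<open>If the neighbour is an RST, its interchange leaves \<open>RST lam\<close> and the
  coefficient vanishes; otherwise \<open>f\<close> vanishes there. This keeps supports inside
  \<open>RST lam\<close>.\<close>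

lemma swap_coeff_lookup_zero:
  assumes "i \<in> {1..<N}" "\<And>\<rho>. \<rho> \<notin> RST lam \<Longrightarrow> f \<rho> = 0" "\<rho> \<notin> RST lam"
  shows "swap_coeff i (tableau_swap i \<rho>) = 0 \<or> f (tableau_swap i \<rho>) = 0"
  using swap_coeff_RST[OF _ assms(1), of "tableau_swap i \<rho>"] assms by auto

lemma vact_closed: "i \<in> {1..<N} \<Longrightarrow> t \<in> V_space \<Longrightarrow> vact i t \<in> V_space"
proof (rule V_spaceI)
  fix \<rho> assume "i \<in> {1..<N}" "t \<in> V_space" "\<rho> \<notin> RST lam"
  then show "lookup (vact i t) \<rho> = 0"
    using swap_coeff_lookup_zero[of i "lookup t" \<rho>] V_spaceD[of t] by (auto simp: lookup_vact)
qed

sublocale V: coxeter_action N V_space vact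
proof
  fix i and x :: vmod
  assume i: "i \<in> {1..<N}" "Suc i \<in> {1..<N}" and x: "x \<in> V_space"
  show "vact i (vact (Suc i) (vact i x)) = vact (Suc i) (vact i (vact (Suc i) x))"
  proof (rule poly_mapping_eqI)
    fix \<rho>
    show "lookup (vact i (vact (Suc i) (vact i x))) \<rho>
        = lookup (vact (Suc i) (vact i (vact (Suc i) x))) \<rho>"
    proof (cases "\<rho> \<in> RST lam")
      case True
      then show ?thesis
        using i by (intro lookup_vact_braid RST_CT_close) auto
    next
      case False
      have "vact i (vact (Suc i) (vact i x)) \<in> V_space"
        "vact (Suc i) (vact i (vact (Suc i) x)) \<in> V_space"
        using i x by (simp_all only: vact_closed)
      then show ?thesis using V_spaceD False by metis
    qed
  qed
qed (auto intro: vact_commute simp: vact_closed vact_vact)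

lemma V_word_eq:
  assumes "set w \<subseteq> {1..<N}" "set w' \<subseteq> {1..<N}" "word_perm w = word_perm w'" "t \<in> V_space"
  shows "vact_word w t = vact_word w' t"
  unfolding vact_word_def using assms by (rule V.fold_eq)

lemma V_word_closed: "set w \<subseteq> {1..<N} \<Longrightarrow> t \<in> V_space \<Longrightarrow> vact_word w t \<in> V_space"
  unfolding vact_word_def using V.fold_closed by blast

lemma vact_perm_eq:
  assumes "set w \<subseteq> {1..<N}" "word_perm w = s" "t \<in> V_space"
  shows "vact_perm N s t = vact_word w t"
  unfolding vact_perm_def
proof (rule the_equality)
  show "\<exists>w'. set w' \<subseteq> {1..<N} \<and> word_perm w' = s \<and> vact_word w t = vact_word w' t"
    using assms by blast
  fix u assume "\<exists>w. set w \<subseteq> {1..<N} \<and> word_perm w = s \<and> u = vact_word w t"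
  then obtain w' where w': "set w' \<subseteq> {1..<N}" "word_perm w' = s" "u = vact_word w' t" by blast
  show "u = vact_word w t"
    unfolding w'(3) by (rule V_word_eq) (use assms w' in simp_all)
qed

end

context shape
begin

section \<open>The operators on \<open>M\<^sub>\<lambda>\<close>\<close>

abbreviation "M \<equiv> M_space N lam"

section \<open>Degree filtration of the module\<close>

definition MF :: "nat \<Rightarrow> mmod set" where
  "MF d = {P. \<forall>\<tau>. (\<tau> \<notin> RST lam \<longrightarrow> lookup P \<tau> = 0) \<and> lookup P \<tau> \<in> Fil {1..N} d}"

lemma MF_mono: "P \<in> MF d \<Longrightarrow> d \<le> e \<Longrightarrow> P \<in> MF e"
  unfolding MF_def using Fil_mono by blast

lemma MF_subset_M: "P \<in> MF d \<Longrightarrow> P \<in> M"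
  unfolding MF_def M_space_def Fil_def by (auto simp: in_keys_iff)

lemma M_iff_MF: "P \<in> M \<longleftrightarrow> (\<exists>d. P \<in> MF d)"
proof
  assume P: "P \<in> M"
  let ?S = "\<Union>\<tau>\<in>keys P. mon_degree ` keys (lookup P \<tau>)"
  have "finite ?S" by simp
  then obtain d where d: "\<forall>k\<in>?S. k < d" using finite_nat_set_iff_bounded by blast
  have "lookup P \<tau> \<in> Fil {1..N} d" for \<tau>
  proof (cases "\<tau> \<in> keys P")
    case True
    then show ?thesis using P d unfolding Fil_def M_space_def by blast
  next
    case False
    then have "lookup P \<tau> = 0" by (simp add: in_keys_iff)
    then show ?thesis by simp
  qed
  moreover have "lookup P \<tau> = 0" if "\<tau> \<notin> RST lam" for \<tau>
    using P that unfolding M_space_def by (auto simp: in_keys_iff)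
  ultimately show "\<exists>d. P \<in> MF d" unfolding MF_def by blast
qed (use MF_subset_M in blast)

lemma MF_add: "P \<in> MF d \<Longrightarrow> Q \<in> MF d \<Longrightarrow> P + Q \<in> MF d"
  unfolding MF_def by (simp add: lookup_add Fil_add)

lemma MF_mscale: "P \<in> MF d \<Longrightarrow> mscale c P \<in> MF d"
  unfolding MF_def by (simp add: lookup_mscale Fil_pconst_mult)

lemma MF_pvar: "P \<in> MF d \<Longrightarrow> j \<in> {1..N} \<Longrightarrow> mmult (pvar j) P \<in> MF (Suc d)"
  unfolding MF_def by (simp add: lookup_mmult Fil_pvar_mult)

lemma MF_memb: "t \<in> V_space \<Longrightarrow> memb t \<in> MF (Suc d)"
  unfolding MF_def by (simp add: lookup_memb V_spaceD Fil_pconst)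

lemma MF_varsigma:
  assumes "P \<in> MF d" "i \<in> {1..<N}"
  shows "varsigma i P \<in> MF d"
proof -
  have "lookup (varsigma i P) \<rho> = 0" if "\<rho> \<notin> RST lam" for \<rho>
    using swap_coeff_lookup_zero[OF assms(2), of "lookup P" \<rho>] assms that
    by (auto simp: lookup_varsigma MF_def)
  moreover have "lookup (varsigma i P) \<rho> \<in> Fil {1..N} d" for \<rho>
  proof -
    have f: "lookup P \<tau> \<in> Fil {1..N} d" for \<tau> using assms by (simp add: MF_def)
    have "divdiff i (lookup P \<rho>) \<in> Fil {1..N} d"
      by (rule divdiff_Fil) (use Fil_mono[OF f] assms(2) in auto)
    moreover have "pswap i (lookup P \<tau>) \<in> Fil {1..N} d" for \<tau>
      by (rule pswap_Fil) (use f assms(2) in auto)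
    ultimately show ?thesis
      unfolding lookup_varsigma by (intro Fil_add Fil_pconst_mult)
  qed
  ultimately show ?thesis by (simp add: MF_def)
qed

lemma MF_mact:
  assumes "P \<in> MF d" "i \<in> {1..<N}"
  shows "mact i P \<in> MF d"
proof -
  have "lookup (mact i P) \<rho> = 0" if "\<rho> \<notin> RST lam" for \<rho>
    using swap_coeff_lookup_zero[OF assms(2), of "lookup P" \<rho>] assms that
    by (auto simp: lookup_mact MF_def)
  then show ?thesis using assms(1) by (simp add: MF_def lookup_mact Fil_add Fil_pconst_mult)
qed

lemma Fil_shift_pvar:
  assumes "j \<in> {1..N}" "f \<in> Fil {1..N} d"
  shows "shift_subst N (pvar j) * f \<in> Fil {1..N} (Suc d)"
proof (cases "j = 1")
  case True
  have "pvar N * f \<in> Fil {1..N} (Suc d)" using assms N_pos by (auto intro: Fil_pvar_mult)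
  moreover have "pconst alpha * f \<in> Fil {1..N} (Suc d)"
    using assms by (auto intro: Fil_pconst_mult Fil_mono)
  ultimately show ?thesis using True by (simp add: shift_subst_simps left_diff_distrib Fil_diff)
next
  case False
  then have "j - 1 \<in> {1..N}" using assms by auto
  then show ?thesis using False Fil_pvar_mult[OF assms(2)] by (simp add: shift_subst_simps)
qed

lemma Fil_shift_subst: "f \<in> Fil {1..N} d \<Longrightarrow> shift_subst N f \<in> Fil {1..N} d"
  unfolding shift_subst_def
  by (erule psubst_Fil) (use Fil_shift_pvar in \<open>simp add: shift_subst_simps\<close>)

lemma MF_fold_mact: "P \<in> MF d \<Longrightarrow> set w \<subseteq> {1..<N} \<Longrightarrow> fold mact w P \<in> MF d"
  by (induction w arbitrary: P) (simp_all add: MF_mact)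

lemma MF_map_shift: "P \<in> MF d \<Longrightarrow> Poly_Mapping.map (shift_subst N) P \<in> MF d"
  unfolding MF_def mem_Collect_eq lookup_map_shift
  using Fil_shift_subst by (metis shift_subst_simps(4))

lemma MF_T_op: "P \<in> MF d \<Longrightarrow> T_op N P \<in> MF d"
  unfolding T_op_eq by (intro MF_fold_mact MF_map_shift) auto

lemma Psi_hat_eq: "Psi_hat N P = mmult (pvar N) (T_op N P) + mscale (of_nat (N - 1)) (T_op N P)"
  by (simp add: Psi_hat_def mscale_def mmult_add_left pconst_of_nat)

lemma MF_Psi_hat: "P \<in> MF d \<Longrightarrow> Psi_hat N P \<in> MF (Suc d)"
  unfolding Psi_hat_eq
  by (intro MF_add MF_pvar MF_mscale MF_T_op) (use N_pos in \<open>auto intro: MF_mono\<close>)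

lemma M_add: "P \<in> M \<Longrightarrow> Q \<in> M \<Longrightarrow> P + Q \<in> M"
  unfolding M_iff_MF by (metis MF_add MF_mono nat_le_linear)

lemma M_mscale: "P \<in> M \<Longrightarrow> mscale c P \<in> M"
  unfolding M_iff_MF using MF_mscale by blast

lemma M_pvar: "P \<in> M \<Longrightarrow> j \<in> {1..N} \<Longrightarrow> mmult (pvar j) P \<in> M"
  unfolding M_iff_MF using MF_pvar by blast

lemma M_memb: "t \<in> V_space \<Longrightarrow> memb t \<in> M"
  unfolding M_iff_MF using MF_memb by blast

lemma M_varsigma: "P \<in> M \<Longrightarrow> i \<in> {1..<N} \<Longrightarrow> varsigma i P \<in> M"
  unfolding M_iff_MF using MF_varsigma by blast

lemma M_Psi_hat: "P \<in> M \<Longrightarrow> Psi_hat N P \<in> M"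
  unfolding M_iff_MF using MF_Psi_hat by blast

lemma M_0: "0 \<in> M"
  by (simp add: M_space_def)

lemma M_induct [consumes 1, case_names memb add mult]:
  assumes "P \<in> M"
    and memb: "\<And>t. t \<in> V_space \<Longrightarrow> Q (memb t)"
    and add: "\<And>P P'. P \<in> M \<Longrightarrow> P' \<in> M \<Longrightarrow> Q P \<Longrightarrow> Q P' \<Longrightarrow> Q (P + P')"
    and mult: "\<And>j P. j \<in> {1..N} \<Longrightarrow> P \<in> M \<Longrightarrow> Q P \<Longrightarrow> Q (mmult (pvar j) P)"
  shows "Q P"
proof -
  obtain d where d: "P \<in> MF d" using assms(1) M_iff_MF by blast
  have "memb 0 = 0" by (rule poly_mapping_eqI) (simp add: lookup_memb)
  then have zero: "Q 0" using memb[of 0] by (simp add: V_space_def)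
  have one: "Q (single \<tau> f) \<and> single \<tau> f \<in> M" if "\<tau> \<in> RST lam" "f \<in> Fil {1..N} d" for \<tau> f d
    using that(2)
  proof (induction rule: Fil_induct)
    case (const d c)
    have "single \<tau> (pconst c) = memb (single \<tau> c)"
      by (rule poly_mapping_eqI) (auto simp: lookup_memb lookup_single when_def)
    then show ?case using memb M_memb V_space_single that(1) by simp
  next
    case (add d f g)
    then show ?case using assms(3) M_add by (simp add: single_add)
  next
    case (mult d j f)
    have "single \<tau> (pvar j * f) = mmult (pvar j) (single \<tau> f)"
      by (rule poly_mapping_eqI) (auto simp: lookup_mmult lookup_single when_def)
    then show ?case using mult assms(4) M_pvar by simp
  qed (use zero M_0 in simp)
  have "Q (\<Sum>k\<in>B. single k (lookup P k)) \<and> (\<Sum>k\<in>B. single k (lookup P k)) \<in> M"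
    if "finite B" "B \<subseteq> RST lam" for B
    using that
  proof (induction B)
    case empty
    then show ?case using zero M_0 by simp
  next
    case (insert x F)
    moreover have "lookup P x \<in> Fil {1..N} d" using d by (simp add: MF_def)
    ultimately show ?case using one[of x "lookup P x" d] add M_add by simp
  qed
  moreover have "keys P \<subseteq> RST lam" using assms(1) by (simp add: M_space_def)
  ultimately have "Q (\<Sum>k\<in>keys P. single k (lookup P k))" by simp
  then show ?thesis by (simp add: poly_mapping_eq_sum_single[symmetric])
qed

section \<open>Coxeter relations on the module\<close>

lemma varsigma_pvar:
  "varsigma i (mmult (pvar i) P) = mmult (pvar (Suc i)) (varsigma i P) + P"
  "varsigma i (mmult (pvar (Suc i)) P) = mmult (pvar i) (varsigma i P) - P"
  "j \<noteq> i \<Longrightarrow> j \<noteq> Suc i \<Longrightarrow> varsigma i (mmult (pvar j) P) = mmult (pvar j) (varsigma i P)"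
  by (simp_all add: varsigma_mmult divdiff_pvar mmult_uminus_left)

lemma varsigma_pconst: "varsigma i (mmult (pconst c) P) = mmult (pconst c) (varsigma i P)"
  by (simp add: varsigma_mmult)

lemmas varsigma_linear = varsigma_add varsigma_diff varsigma_mscale varsigma_pvar varsigma_pconst
  mmult_add mmult_diff mmult_diff_left

lemma varsigma_involution:
  assumes "P \<in> M"
  shows "varsigma i (varsigma i P) = P"
  using assms
proof (induction rule: M_induct)
  case (mult j P)
  consider "j = i" | "j = Suc i" | "j \<noteq> i" "j \<noteq> Suc i" by blast
  then show ?case using mult by cases (simp_all add: varsigma_linear)
qed (simp_all add: varsigma_memb vact_vact varsigma_add)

lemma varsigma_commute:
  assumes "P \<in> M" "Suc i < k"
  shows "varsigma i (varsigma k P) = varsigma k (varsigma i P)"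
  using assms(1)
proof (induction rule: M_induct)
  case (mult j P)
  consider "j = i" | "j = Suc i" | "j = k" | "j = Suc k"
    | "j \<noteq> i" "j \<noteq> Suc i" "j \<noteq> k" "j \<noteq> Suc k" by blast
  then show ?case using mult assms(2) by cases (simp_all add: varsigma_linear)
qed (simp_all add: varsigma_memb vact_commute[OF assms(2)] varsigma_add)

lemma varsigma_braid:
  assumes "P \<in> M" "i \<in> {1..<N}" "Suc i \<in> {1..<N}"
  shows "varsigma i (varsigma (Suc i) (varsigma i P))
    = varsigma (Suc i) (varsigma i (varsigma (Suc i) P))"
  using assms(1)
proof (induction rule: M_induct)
  case (memb t)
  then show ?case using V.braid[OF assms(2,3)] by (simp add: varsigma_memb)
next
  case (mult j P)
  consider "j = i" | "j = Suc i" | "j = Suc (Suc i)"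
    | "j \<noteq> i" "j \<noteq> Suc i" "j \<noteq> Suc (Suc i)" by blast
  then show ?case
    using mult by cases (simp_all add: varsigma_linear varsigma_involution)
qed (simp add: varsigma_add)

sublocale S: coxeter_action N M varsigma
  by unfold_locales (auto intro: M_varsigma varsigma_involution varsigma_commute varsigma_braid)

section \<open>Commutation of the affine generator with the reflections\<close>

lemma T_op_diff: "T_op N (P - Q) = T_op N P - T_op N Q"
  using T_op_add[of N "P - Q" Q] by (simp add: algebra_simps)

text \<open>On tableaux this is conjugation by the cycle. The shift by \<alpha> concerns only the
  first variable, which \<open>varsigma (Suc i)\<close> does not touch.\<close>

lemma varsigma_T_op:
  assumes "P \<in> M" "i \<in> {1..<N}" "Suc i \<in> {1..<N}"
  shows "varsigma i (T_op N P) = T_op N (varsigma (Suc i) P)"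
  using assms(1)
proof (induction rule: M_induct)
  case (memb t)
  have "vact_word ([1..<N] @ [i]) t = vact_word (Suc i # [1..<N]) t"
  proof (rule V_word_eq)
    show "word_perm ([1..<N] @ [i]) = word_perm (Suc i # [1..<N])"
      using assms by (auto simp: fun_eq_iff word_perm_append word_perm_Cons word_perm_upt transpose_def)
  qed (use assms memb in auto)
  then show ?case by (simp add: varsigma_memb T_op_memb vact_word_def)
next
  case (add P P')
  then show ?case by (simp add: varsigma_add T_op_add)
next
  case (mult j P)
  consider "j = 1" | "j = Suc i" | "j = Suc (Suc i)"
    | "j \<noteq> 1" "j \<noteq> Suc i" "j \<noteq> Suc (Suc i)" by blast
  then show ?case
  proof cases
    case 4
    then have "j - 1 \<noteq> i" "j - 1 \<noteq> Suc i" using mult by auto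
    then show ?thesis using 4 mult by (simp add: varsigma_linear T_op_mmult shift_subst_simps)
  qed (use mult assms in \<open>simp_all add: varsigma_linear T_op_mmult T_op_add T_op_diff shift_subst_simps\<close>)
qed

text \<open>A single rotation separates the first two variables cyclically and shifts only one of
  them. After two rotations both carry the same shift by \<alpha>, which cancels in the divided
  difference.\<close>

lemma varsigma_T_op_T_op:
  assumes "P \<in> M" "N \<ge> 2"
  shows "varsigma (N - 1) (T_op N (T_op N P)) = T_op N (T_op N (varsigma 1 P))"
  using assms(1)
proof (induction rule: M_induct)
  case (memb t)
  have "vact_word ([1..<N] @ [1..<N] @ [N - 1]) t = vact_word (1 # [1..<N] @ [1..<N]) t"
  proof (rule V_word_eq)
    show "word_perm ([1..<N] @ [1..<N] @ [N - 1]) = word_perm (1 # [1..<N] @ [1..<N])"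
      using assms by (auto simp: fun_eq_iff word_perm_append word_perm_Cons word_perm_upt transpose_def)
  qed (use assms memb in auto)
  then show ?case by (simp add: varsigma_memb T_op_memb vact_word_def)
next
  case (add P P')
  then show ?case by (simp add: varsigma_add T_op_add)
next
  case (mult j P)
  have pN: "varsigma (N - 1) (mmult (pvar N) Q) = mmult (pvar (N - 1)) (varsigma (N - 1) Q) - Q" for Q
    using varsigma_pvar(2)[of "N - 1" Q] assms by simp
  have pN1: "varsigma (N - 1) (mmult (pvar (N - 1)) Q) = mmult (pvar N) (varsigma (N - 1) Q) + Q" for Q
    using varsigma_pvar(1)[of "N - 1" Q] assms by simp
  have p1: "varsigma 1 (mmult (pvar 1) Q) = mmult (pvar 2) (varsigma 1 Q) + Q"
    "varsigma 1 (mmult (pvar 2) Q) = mmult (pvar 1) (varsigma 1 Q) - Q" for Q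
    using varsigma_pvar(1,2)[of 1 Q] by (simp_all add: numeral_2_eq_2)
  have T1: "T_op N (mmult (pvar 1) Q) = mmult (pvar N) (T_op N Q) - mmult (pconst alpha) (T_op N Q)" for Q
    by (simp add: T_op_mmult shift_subst_simps mmult_diff_left)
  have T: "k \<noteq> 1 \<Longrightarrow> T_op N (mmult (pvar k) Q) = mmult (pvar (k - 1)) (T_op N Q)" for k Q
    by (simp add: T_op_mmult shift_subst_simps)
  have Tc: "T_op N (mmult (pconst c) Q) = mmult (pconst c) (T_op N Q)" for c Q
    by (simp add: T_op_mmult shift_subst_simps)
  have TT1: "T_op N (T_op N (mmult (pvar 1) Q)) = mmult (pvar (N - 1)) (T_op N (T_op N Q))
      - mmult (pconst alpha) (T_op N (T_op N Q))" for Q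
    using assms by (simp add: T1[simplified] T T_op_diff Tc)
  have TT2: "T_op N (T_op N (mmult (pvar 2) Q)) = mmult (pvar N) (T_op N (T_op N Q))
      - mmult (pconst alpha) (T_op N (T_op N Q))" for Q
    using assms T[of 2 Q] T1[of "T_op N Q"] by simp
  consider "j = 1" | "j = 2" | "j \<noteq> 1" "j \<noteq> 2" by blast
  then show ?case
  proof cases
    case 1
    have "varsigma (N - 1) (T_op N (T_op N (mmult (pvar 1) P)))
      = mmult (pvar N) (varsigma (N - 1) (T_op N (T_op N P))) + T_op N (T_op N P)
        - mmult (pconst alpha) (varsigma (N - 1) (T_op N (T_op N P)))"
      unfolding TT1 varsigma_diff pN1 varsigma_pconst ..
    also have "\<dots> = T_op N (T_op N (varsigma 1 (mmult (pvar 1) P)))"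
      unfolding p1 T_op_add TT2 mult.IH by simp
    finally show ?thesis using 1 by simp
  next
    case 2
    have "varsigma (N - 1) (T_op N (T_op N (mmult (pvar 2) P)))
      = mmult (pvar (N - 1)) (varsigma (N - 1) (T_op N (T_op N P))) - T_op N (T_op N P)
        - mmult (pconst alpha) (varsigma (N - 1) (T_op N (T_op N P)))"
      unfolding TT2 varsigma_diff pN varsigma_pconst ..
    also have "\<dots> = T_op N (T_op N (varsigma 1 (mmult (pvar 2) P)))"
      unfolding p1 T_op_diff TT1 mult.IH by simp
    finally show ?thesis using 2 by simp
  next
    case 3
    then have j: "j \<noteq> 1" "j - 1 \<noteq> 1" "j \<noteq> Suc 1" "j - 1 - 1 \<noteq> N - 1" "j - 1 - 1 \<noteq> Suc (N - 1)"
      using mult.hyps by auto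
    show ?thesis
      unfolding T[OF j(1)] T[OF j(2)] varsigma_pvar(3)[OF j(4,5)] varsigma_pvar(3)[OF j(1,3)] mult.IH ..
  qed
qed

lemma varsigma_Psi_hat:
  assumes "P \<in> M" "i \<in> {1..<N}" "Suc i \<in> {1..<N}"
  shows "varsigma i (Psi_hat N P) = Psi_hat N (varsigma (Suc i) P)"
proof -
  have "N \<noteq> i" "N \<noteq> Suc i" using assms by auto
  then show ?thesis
    unfolding Psi_hat_eq varsigma_add varsigma_mscale
    by (simp add: varsigma_pvar(3) varsigma_T_op[OF assms])
qed

text \<open>The linear factors contributed by the two \<open>Psi_hat\<close> multiply to a
  polynomial symmetric in the last two variables, which commutes with the last reflection.\<close>

lemma varsigma_Psi_hat_Psi_hat:
  assumes "P \<in> M" "N \<ge> 2"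
  shows "varsigma (N - 1) (Psi_hat N (Psi_hat N P)) = Psi_hat N (Psi_hat N (varsigma 1 P))"
proof -
  define k :: mpoly where "k = pconst (of_nat (N - 1))"
  define f where "f = (pvar N + k) * (pvar (N - 1) + k)"
  have Psi2: "Psi_hat N (Psi_hat N Q) = mmult f (T_op N (T_op N Q))" for Q
    using assms(2) by (simp add: Psi_hat_def T_op_mmult mmult_mmult shift_subst_simps f_def k_def
        pconst_of_nat[symmetric])
  have "pswap (N - 1) f = f"
    using assms(2) by (simp add: f_def k_def pswap_mult pswap_add mult.commute)
  moreover from this have "divdiff (N - 1) f = 0" by (intro divdiff_eqI) simp
  ultimately show ?thesis
    unfolding Psi2 by (simp add: varsigma_mmult varsigma_T_op_T_op[OF assms, simplified])
qed

subsection \<open>The operators \<open>\<xi>\<^sub>i\<close>\<close>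

definition X_op :: "nat \<Rightarrow> mmod \<Rightarrow> mmod" where
  "X_op i P = fold varsigma (rev [i..<N]) (Psi_hat N (fold varsigma (rev [1..<i]) P))"

lemma xi_hat_eq: "xi_hat N i P = mmult (pvar i) P + mscale (of_nat (N - 1)) P - X_op i P"
  by (simp add: xi_hat_def X_op_def)

lemma fold_varsigma_add: "fold varsigma w (P + Q) = fold varsigma w P + fold varsigma w Q"
  by (induction w arbitrary: P Q) (simp_all add: varsigma_add)

lemma fold_varsigma_mscale: "fold varsigma w (mscale c P) = mscale c (fold varsigma w P)"
  by (induction w arbitrary: P) (simp_all add: varsigma_mscale)

lemma fold_varsigma_memb: "fold varsigma w (memb t) = memb (vact_word w t)"
  unfolding vact_word_def by (induction w arbitrary: t) (simp_all add: varsigma_memb)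

lemma X_op_add: "X_op i (P + Q) = X_op i P + X_op i Q"
  by (simp add: X_op_def fold_varsigma_add Psi_hat_add)

lemma X_op_mscale: "X_op i (mscale c P) = mscale c (X_op i P)"
  by (simp add: X_op_def fold_varsigma_mscale Psi_hat_mscale)

lemma xi_hat_add: "xi_hat N i (P + Q) = xi_hat N i P + xi_hat N i Q"
  by (simp add: xi_hat_eq X_op_add mmult_add mmod.scale_right_distrib)

lemma xi_hat_mscale: "xi_hat N i (mscale c P) = mscale c (xi_hat N i P)"
proof -
  have "mmult (pvar i) (mscale c P) = mscale c (mmult (pvar i) P)"
    by (simp add: mscale_def mmult_mmult mult.commute)
  then show ?thesis
    by (simp add: xi_hat_eq X_op_mscale mmod.scale_right_distrib mmod.scale_right_diff_distrib mult.commute)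
qed

lemma fold_varsigma_M: "set w \<subseteq> {1..<N} \<Longrightarrow> P \<in> M \<Longrightarrow> fold varsigma w P \<in> M"
  using S.fold_closed by blast

lemma X_op_M: "i \<in> {1..N} \<Longrightarrow> P \<in> M \<Longrightarrow> X_op i P \<in> M"
  unfolding X_op_def by (intro fold_varsigma_M M_Psi_hat) auto

text \<open>The words of \<open>X_op i\<close> and \<open>X_op (Suc i)\<close> differ by one letter
  \<open>i\<close> at each end, so these operators are conjugate under
  \<open>varsigma i\<close>.\<close>

lemma X_op_varsigma:
  assumes "P \<in> M" "i \<in> {1..<N}"
  shows "X_op (Suc i) (varsigma i P) = varsigma i (X_op i P)"
    and "X_op i (varsigma i P) = varsigma i (X_op (Suc i) P)"
proof -
  have *: "X_op (Suc i) Q = varsigma i (X_op i (varsigma i Q))" if Q: "Q \<in> M" for Q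
  proof -
    have "fold varsigma (rev [1..<Suc i]) Q = fold varsigma (rev [1..<i]) (varsigma i Q)"
      using assms(2) by simp
    moreover have "fold varsigma (rev [i..<N]) R = varsigma i (fold varsigma (rev [Suc i..<N]) R)" for R
      using assms(2) by (simp add: upt_conv_Cons)
    moreover have "fold varsigma (rev [Suc i..<N]) (Psi_hat N (fold varsigma (rev [1..<Suc i]) Q)) \<in> M"
      using Q assms(2) by (intro fold_varsigma_M M_Psi_hat) auto
    ultimately show ?thesis unfolding X_op_def by (simp add: varsigma_involution)
  qed
  have sP: "varsigma i P \<in> M" using M_varsigma assms by blast
  show "X_op (Suc i) (varsigma i P) = varsigma i (X_op i P)"
    using *[OF sP] assms by (simp add: varsigma_involution)
  have "X_op i (varsigma i P) \<in> M" using X_op_M sP assms(2) by simp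
  then show "X_op i (varsigma i P) = varsigma i (X_op (Suc i) P)"
    using *[OF assms(1)] by (simp add: varsigma_involution)
qed

lemma fold_varsigma_swap_words:
  assumes "P \<in> M" "set w \<subseteq> {1..<N}" "i \<in> {1..<N}" "k \<in> {1..<N}"
    and "word_perm (i # w) = word_perm (w @ [k])"
  shows "fold varsigma w (varsigma i P) = varsigma k (fold varsigma w P)"
  using S.fold_eq[OF _ _ assms(5,1)] assms(2-4) by simp

text \<open>The letter \<open>i\<close> is carried through \<open>X_op j\<close> and returns to
  itself. For \<open>i < j\<close> the first word raises it to \<open>Suc i\<close> and
  \<open>Psi_hat\<close> lowers it again; for \<open>j < i\<close> it is lowered by
  \<open>Psi_hat\<close> and raised by the last word.\<close>

lemma X_op_varsigma_commute:
  assumes P: "P \<in> M" and i: "i \<in> {1..<N}" and j: "j \<in> {1..N}" "j \<noteq> i" "j \<noteq> Suc i"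
  shows "X_op j (varsigma i P) = varsigma i (X_op j P)"
proof -
  define Q where "Q = fold varsigma (rev [1..<j]) P"
  have Q: "Q \<in> M" unfolding Q_def by (rule fold_varsigma_M) (use P j in auto)
  have PQ: "Psi_hat N Q \<in> M" using M_Psi_hat Q by blast
  show ?thesis
  proof (cases "i < j")
    case True
    then have ij: "Suc i < j" "Suc i \<in> {1..<N}" using j i by auto
    have "fold varsigma (rev [1..<j]) (varsigma i P) = varsigma (Suc i) Q"
      unfolding Q_def
    proof (rule fold_varsigma_swap_words)
      show "word_perm (i # rev [1..<j]) = word_perm (rev [1..<j] @ [Suc i])"
        using i j ij by (auto simp: fun_eq_iff word_perm_append word_perm_Cons word_perm_rev_upt transpose_def)
    qed (use P i j ij in auto)
    moreover have "Psi_hat N (varsigma (Suc i) Q) = varsigma i (Psi_hat N Q)"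
      using varsigma_Psi_hat[OF Q i ij(2)] by simp
    moreover have "fold varsigma (rev [j..<N]) (varsigma i (Psi_hat N Q))
        = varsigma i (fold varsigma (rev [j..<N]) (Psi_hat N Q))"
    proof (rule fold_varsigma_swap_words)
      show "word_perm (i # rev [j..<N]) = word_perm (rev [j..<N] @ [i])"
        using i j ij by (auto simp: fun_eq_iff word_perm_append word_perm_Cons word_perm_rev_upt transpose_def)
    qed (use PQ i j in auto)
    ultimately show ?thesis by (simp add: X_op_def Q_def)
  next
    case False
    then have ij: "j < i" "i - 1 \<in> {1..<N}" "Suc (i - 1) = i" using j i by auto
    have "fold varsigma (rev [1..<j]) (varsigma i P) = varsigma i Q"
      unfolding Q_def
    proof (rule fold_varsigma_swap_words)
      show "word_perm (i # rev [1..<j]) = word_perm (rev [1..<j] @ [i])"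
        using i j ij by (auto simp: fun_eq_iff word_perm_append word_perm_Cons word_perm_rev_upt transpose_def)
    qed (use P i j ij in auto)
    moreover have "Psi_hat N (varsigma i Q) = varsigma (i - 1) (Psi_hat N Q)"
      using varsigma_Psi_hat[OF Q ij(2)] ij(3) i by simp
    moreover have "fold varsigma (rev [j..<N]) (varsigma (i - 1) (Psi_hat N Q))
        = varsigma i (fold varsigma (rev [j..<N]) (Psi_hat N Q))"
    proof (rule fold_varsigma_swap_words)
      show "word_perm ((i - 1) # rev [j..<N]) = word_perm (rev [j..<N] @ [i])"
        using i j ij by (auto simp: fun_eq_iff word_perm_append word_perm_Cons word_perm_rev_upt transpose_def)
    qed (use PQ i j ij in auto)
    ultimately show ?thesis by (simp add: X_op_def Q_def)
  qed
qed

lemma fold_varsigma_Psi_hat: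
  assumes "P \<in> M" "1 \<le> a" "Suc b \<le> N"
  shows "fold varsigma (rev [a..<b]) (Psi_hat N P) = Psi_hat N (fold varsigma (rev [Suc a..<Suc b]) P)"
  using assms(1,3)
proof (induction b arbitrary: P)
  case (Suc b)
  show ?case
  proof (cases "a \<le> b")
    case True
    have "varsigma b (Psi_hat N P) = Psi_hat N (varsigma (Suc b) P)"
      using varsigma_Psi_hat Suc.prems True assms(2) by simp
    moreover have "varsigma (Suc b) P \<in> M" using M_varsigma Suc.prems by simp
    ultimately show ?thesis using Suc True by simp
  next
    case False
    then show ?thesis by simp
  qed
qed simp

text \<open>The first word passes through \<open>Psi_hat\<close> with its letters raised by one. The
  letter \<open>N - 1\<close> then meets two copies of \<open>Psi_hat\<close> and becomes the letter
  1 that was missing from the first word of \<open>X_op (Suc j)\<close>; the remaining letters pass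
  through the outer \<open>Psi_hat\<close>.\<close>

lemma X_op_Psi_hat:
  assumes "P \<in> M" "j \<in> {1..<N}"
  shows "X_op j (Psi_hat N P) = Psi_hat N (X_op (Suc j) P)"
proof -
  define Q where "Q = fold varsigma (rev [Suc 1..<Suc j]) P"
  have Q: "Q \<in> M" unfolding Q_def by (rule fold_varsigma_M) (use assms in auto)
  have N2: "N \<ge> 2" using assms by auto
  have sQ: "varsigma 1 Q \<in> M" using M_varsigma Q N2 by simp
  have Q1: "varsigma 1 Q = fold varsigma (rev [1..<Suc j]) P"
    using assms upt_conv_Cons[of 1 "Suc j"] by (simp add: Q_def del: upt_Suc)
  have top: "[j..<N] = [j..<N - 1] @ [N - 1]"
    using assms upt_Suc_append[of j "N - 1"] by (auto simp del: upt_Suc)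
  have "X_op j (Psi_hat N P) = fold varsigma (rev [j..<N]) (Psi_hat N (Psi_hat N Q))"
    unfolding X_op_def Q_def using fold_varsigma_Psi_hat[of P 1 j] assms by simp
  also have "\<dots> = fold varsigma (rev [j..<N - 1]) (Psi_hat N (Psi_hat N (varsigma 1 Q)))"
    unfolding top using varsigma_Psi_hat_Psi_hat[OF Q N2] by simp
  also have "\<dots> = Psi_hat N (fold varsigma (rev [Suc j..<Suc (N - 1)]) (Psi_hat N (varsigma 1 Q)))"
    using assms by (intro fold_varsigma_Psi_hat M_Psi_hat sQ) auto
  also have "\<dots> = Psi_hat N (X_op (Suc j) P)"
    unfolding X_op_def Q1 using N_pos by (simp del: upt_Suc)
  finally show ?thesis .
qed

lemma X_op_N_Psi_hat: "X_op N (Psi_hat N P) = Psi_hat N (X_op 1 P)"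
  by (simp add: X_op_def)

section \<open>Exchange relations and the transformation of spectral vectors\<close>

lemma xi_hat_varsigma:
  assumes "P \<in> M" "i \<in> {1..<N}"
  shows "xi_hat N (Suc i) (varsigma i P) = varsigma i (xi_hat N i P) - P"
    and "xi_hat N i (varsigma i P) = varsigma i (xi_hat N (Suc i) P) + P"
  by (simp_all add: xi_hat_eq varsigma_linear X_op_varsigma[OF assms])

lemma xi_hat_varsigma_commute:
  assumes "P \<in> M" "i \<in> {1..<N}" "j \<in> {1..N}" "j \<noteq> i" "j \<noteq> Suc i"
  shows "xi_hat N j (varsigma i P) = varsigma i (xi_hat N j P)"
  using assms(4,5) by (simp add: xi_hat_eq varsigma_linear X_op_varsigma_commute[OF assms])

lemma xi_hat_Psi_hat:
  assumes "P \<in> M" "j \<in> {1..<N}"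
  shows "xi_hat N j (Psi_hat N P) = Psi_hat N (xi_hat N (Suc j) P)"
  using assms(2) by (simp add: xi_hat_eq X_op_Psi_hat[OF assms] Psi_hat_add Psi_hat_diff
      Psi_hat_mscale Psi_hat_mmult shift_subst_simps)

text \<open>The term with \<alpha> comes from the multiplication by the last variable:
  \<open>Psi_hat\<close> substitutes \<open>pvar N - pconst alpha\<close> for
  \<open>pvar 1\<close>.\<close>

lemma xi_hat_N_Psi_hat:
  "xi_hat N N (Psi_hat N P) = Psi_hat N (xi_hat N 1 P) + mscale alpha (Psi_hat N P)"
  by (simp add: xi_hat_eq X_op_N_Psi_hat[simplified] Psi_hat_add Psi_hat_diff
      Psi_hat_mscale Psi_hat_mmult shift_subst_simps mmult_diff_left mscale_def)

text \<open>Admits \<open>P = 0\<close>, unlike \<open>simultaneous_eigenfunction\<close>, because a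
  step to the empty vertex is to be treated before it is known to vanish.\<close>

definition eigen :: "(nat \<Rightarrow> ratfun) \<Rightarrow> mmod \<Rightarrow> bool" where
  "eigen z P \<longleftrightarrow> (\<forall>j\<in>{1..N}. xi_hat N j P = mscale (z j) P)"

lemma eigen_Psi_hat:
  assumes "P \<in> M" "eigen z P"
  shows "eigen (\<lambda>j. if j = N then z 1 + alpha else z (Suc j)) (Psi_hat N P)"
proof -
  have "xi_hat N j (Psi_hat N P) = mscale (z (Suc j)) (Psi_hat N P)" if "j \<in> {1..N}" "j \<noteq> N" for j
    using that assms xi_hat_Psi_hat[OF assms(1), of j] by (simp add: eigen_def Psi_hat_mscale)
  moreover have "xi_hat N N (Psi_hat N P) = mscale (z 1 + alpha) (Psi_hat N P)"
    using assms N_pos xi_hat_N_Psi_hat[of P]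
    by (simp add: eigen_def Psi_hat_mscale mmod.scale_left_distrib)
  ultimately show ?thesis by (simp add: eigen_def)
qed

text \<open>The added multiple of \<open>P\<close> absorbs the inhomogeneous terms of the exchange
  relations, which turns \<open>varsigma i\<close> into an intertwiner of the two spectral
  vectors.\<close>

lemma eigen_step:
  assumes P: "P \<in> M" "eigen z P" and i: "i \<in> {1..<N}" and "z i \<noteq> z (Suc i)"
  shows "eigen (\<lambda>j. z (transpose i (Suc i) j)) (varsigma i P + mscale (1 / (z (Suc i) - z i)) P)"
  unfolding eigen_def
proof
  fix j assume j: "j \<in> {1..N}"
  define c where "c = 1 / (z (Suc i) - z i)"
  have c: "1 + c * z i = z (Suc i) * c" "c * z (Suc i) - 1 = z i * c"
    using assms(4) by (simp_all add: c_def field_simps)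
  have e: "xi_hat N i P = mscale (z i) P" "xi_hat N (Suc i) P = mscale (z (Suc i)) P"
    "xi_hat N j P = mscale (z j) P"
    using P(2) i j by (auto simp: eigen_def)
  consider "j = i" | "j = Suc i" | "j \<noteq> i" "j \<noteq> Suc i" by blast
  then show "xi_hat N j (varsigma i P + mscale (1 / (z (Suc i) - z i)) P)
      = mscale (z (transpose i (Suc i) j)) (varsigma i P + mscale (1 / (z (Suc i) - z i)) P)"
    unfolding c_def[symmetric]
  proof cases
    case 1
    have "xi_hat N i (varsigma i P + mscale c P)
        = mscale (z (Suc i)) (varsigma i P) + mscale (1 + c * z i) P"
      by (simp add: xi_hat_add xi_hat_mscale xi_hat_varsigma[OF P(1) i] e varsigma_mscale
          mmod.scale_left_distrib)
    then show "xi_hat N j (varsigma i P + mscale c P)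
      = mscale (z (transpose i (Suc i) j)) (varsigma i P + mscale c P)"
      unfolding c 1 by (simp add: mmod.scale_right_distrib)
  next
    case 2
    have "xi_hat N (Suc i) (varsigma i P + mscale c P)
        = mscale (z i) (varsigma i P) + mscale (c * z (Suc i) - 1) P"
      by (simp add: xi_hat_add xi_hat_mscale xi_hat_varsigma[OF P(1) i] e varsigma_mscale
          mmod.scale_left_diff_distrib)
    then show "xi_hat N j (varsigma i P + mscale c P)
      = mscale (z (transpose i (Suc i) j)) (varsigma i P + mscale c P)"
      unfolding c 2 by (simp add: mmod.scale_right_distrib)
  next
    case 3
    then show "xi_hat N j (varsigma i P + mscale c P)
      = mscale (z (transpose i (Suc i) j)) (varsigma i P + mscale c P)"
      by (simp add: xi_hat_add xi_hat_mscale xi_hat_varsigma_commute[OF P(1) i j] e varsigma_mscale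
          mmod.scale_right_distrib mult.commute)
  qed
qed

text \<open>The two words cancel on the tableau factor, and the linear factor of
  \<open>Psi_hat\<close> cancels the terms \<open>pvar N\<close> and \<open>N - 1\<close> of
  \<open>xi_hat\<close>. The constant \<open>N - 1\<close> is matched so that the eigenvalue on
  constants is 0, the content of the entry \<open>N\<close>.\<close>

lemma xi_hat_N_memb:
  assumes "t \<in> V_space"
  shows "xi_hat N N (memb t) = 0"
proof -
  have "vact_word (rev [1..<N] @ [1..<N]) t = vact_word [] t"
  proof (rule V_word_eq)
    show "word_perm (rev [1..<N] @ [1..<N]) = word_perm []"
      using N_pos by (auto simp: fun_eq_iff word_perm_append word_perm_rev_upt word_perm_upt)
  qed (use assms in auto)
  then have "vact_word [1..<N] (vact_word (rev [1..<N]) t) = t"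
    by (simp add: vact_word_def)
  then have "X_op N (memb t) = mmult (pvar N) (memb t) + mscale (of_nat (N - 1)) (memb t)"
    unfolding X_op_def fold_varsigma_memb Psi_hat_eq by (simp add: T_op_memb)
  then show ?thesis by (simp add: xi_hat_eq)
qed

text \<open>The recursion \<open>\<xi>\<^sub>i = \<varsigma>\<^sub>i \<xi>\<^bsub>i+1\<^esub> \<varsigma>\<^sub>i + \<varsigma>\<^sub>i\<close> is that of the Jucys-Murphy elements.\<close>

lemma eigen_memb:
  assumes "\<tau> \<in> RST lam"
  shows "eigen (\<lambda>i. of_int (CT \<tau> i)) (memb (single \<tau> 1))"
proof -
  have "\<forall>\<tau>\<in>RST lam. xi_hat N i (memb (single \<tau> 1)) = mscale (of_int (CT \<tau> i)) (memb (single \<tau> 1))"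
    if "1 \<le> i" "i \<le> N" for i
    using that(2,1)
  proof (induction rule: inc_induct)
    case base
    then show ?case using xi_hat_N_memb V_space_single CT_N by simp
  next
    case (step i)
    show ?case
    proof
      fix \<tau> assume \<tau>: "\<tau> \<in> RST lam"
      have i: "i \<in> {1..<N}" using step by simp
      let ?\<tau>' = "tableau_swap i \<tau>"
      define P where "P = memb (single \<tau> 1)"
      define P' where "P' = memb (single ?\<tau>' 1)"
      define b g where "b = diag_coeff i \<tau>" and "g = swap_coeff i \<tau>"
      have P: "P \<in> M" unfolding P_def using M_memb V_space_single \<tau> by blast
      have "CT \<tau> i \<noteq> CT \<tau> (Suc i)" using RST_CT_close[OF \<tau>, of i "Suc i"] i by simp
      then have b: "b * of_int (CT \<tau> (Suc i)) = of_int (CT \<tau> i) * b - 1"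
        by (simp add: b_def diag_coeff_def field_simps)
      have sP: "varsigma i P = mscale b P + mscale g P'"
      proof -
        have "tableau_act i \<tau> = vscale b (single \<tau> 1) + vscale g (single ?\<tau>' 1)"
          by (simp add: tableau_act_eq vscale_def b_def g_def)
        then show ?thesis
          by (simp add: P_def P'_def varsigma_memb vact_single memb_add memb_vscale)
      qed
      have xP: "xi_hat N (Suc i) P = mscale (of_int (CT \<tau> (Suc i))) P"
        using step \<tau> by (simp add: P_def)
      \<comment> \<open>Scaled by \<open>g\<close>, because \<open>?\<tau>'\<close> may fail to be
        an RST, and then \<open>g = 0\<close>.\<close>
      have xP': "mscale g (xi_hat N (Suc i) P') = mscale (of_int (CT \<tau> i)) (mscale g P')"
      proof (cases "g = 0")
        case False
        then have "?\<tau>' \<in> RST lam" using swap_coeff_RST \<tau> i by (simp add: g_def)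
        then show ?thesis using step by (simp add: P'_def CT_tableau_swap mult.commute)
      qed simp
      have "xi_hat N (Suc i) (varsigma i P)
          = mscale (b * of_int (CT \<tau> (Suc i))) P + mscale (of_int (CT \<tau> i)) (mscale g P')"
        by (simp add: sP xi_hat_add xi_hat_mscale xP xP')
      also have "\<dots> = mscale (of_int (CT \<tau> i)) (varsigma i P) - P"
        unfolding b by (simp add: sP mmod.scale_right_distrib mmod.scale_left_diff_distrib)
      finally have "varsigma i (xi_hat N (Suc i) (varsigma i P))
          = mscale (of_int (CT \<tau> i)) P - varsigma i P"
        by (simp add: varsigma_diff varsigma_mscale varsigma_involution[OF P])
      then show "xi_hat N i (memb (single \<tau> 1)) = mscale (of_int (CT \<tau> i)) (memb (single \<tau> 1))"
        using xi_hat_varsigma(2)[OF M_varsigma[OF P i] i] varsigma_involution[OF P, of i]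
        by (simp add: P_def)
    qed
  qed
  then show ?thesis using assms by (simp add: eigen_def)
qed

end

section \<open>Exponent vectors\<close>

definition vdeg :: "nat \<Rightarrow> expvec \<Rightarrow> nat" where
  "vdeg N v = (\<Sum>i=1..N. v i)"

text \<open>Extending \<open>v\<close> to the integers by \<open>v (i + N) = v i + 1\<close> turns \<open>\<Psi>\<close> into the shift \<open>v \<mapsto> v (\<cdot> + 1)\<close>.
  In this picture \<open>excess N v k r\<close> counts the positions \<open>i \<le> r - k N\<close> with \<open>v i \<ge> 0\<close>, and \<open>vle\<close> is
  the Bruhat order of the extended affine symmetric group on cosets. Unlike \<open>lhd\<close> it is preserved
  by \<open>\<Psi>\<close> and by the ascending exchanges, which is why it is the right order for the induction
  along paths.\<close>

definition excess :: "nat \<Rightarrow> expvec \<Rightarrow> nat \<Rightarrow> nat \<Rightarrow> nat" where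
  "excess N v k r = (\<Sum>i=1..N. v i + of_bool (i \<le> r) - k)"

definition vle :: "nat \<Rightarrow> expvec \<Rightarrow> expvec \<Rightarrow> bool" where
  "vle N u v \<longleftrightarrow> vdeg N u = vdeg N v \<and> (\<forall>k r. excess N u k r \<le> excess N v k r)"

lemma vle_refl: "vle N v v"
  by (simp add: vle_def)

lemma vle_trans: "vle N u v \<Longrightarrow> vle N v w \<Longrightarrow> vle N u w"
  unfolding vle_def by (metis le_trans)

lemma sum_vec_Psi:
  fixes h :: "nat \<Rightarrow> nat \<Rightarrow> nat"
  assumes "N \<ge> 1"
  shows "(\<Sum>i=1..N. h i (vec_Psi N v i)) = (\<Sum>i=2..N. h (i - 1) (v i)) + h N (v 1 + 1)"
proof -
  have "(\<Sum>i=1..N. h i (vec_Psi N v i)) = (\<Sum>i\<in>{1..<N}. h i (vec_Psi N v i)) + h N (vec_Psi N v N)"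
  proof -
    have "{1..N} = insert N {1..<N}" using assms by auto
    then show ?thesis by simp
  qed
  also have "(\<Sum>i\<in>{1..<N}. h i (vec_Psi N v i)) = (\<Sum>i=2..N. h (i - 1) (v i))"
    by (rule sum.reindex_bij_witness[of _ "\<lambda>i. i - 1" Suc]) (auto simp: vec_Psi_def)
  finally show ?thesis using assms by (simp add: vec_Psi_def)
qed

lemma sum_head2:
  fixes h :: "nat \<Rightarrow> nat"
  shows "N \<ge> 1 \<Longrightarrow> (\<Sum>i=1..N. h i) = h 1 + (\<Sum>i=2..N. h i)"
  using sum.atLeast_Suc_atMost[of 1 N h] by (simp add: numeral_2_eq_2)

lemma vdeg_Psi: "N \<ge> 1 \<Longrightarrow> vdeg N (vec_Psi N v) = Suc (vdeg N v)"
  unfolding vdeg_def using sum_vec_Psi[of N "\<lambda>i x. x" v] sum_head2[of N v] by simp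

text \<open>The shift by \<Psi> moves the threshold by one. From \<open>N\<close> on all indicators
  are 1 and the threshold wraps into the next period, which costs one unit of
  \<open>k\<close>.\<close>

lemma excess_Psi_less: 
  assumes "N \<ge> 1" "r < N"
  shows "excess N (vec_Psi N v) k r = excess N v k (Suc r)"
proof -
  have "(\<Sum>i=2..N. v i + of_bool (i - 1 \<le> r) - k) = (\<Sum>i=2..N. v i + of_bool (i \<le> Suc r) - k)"
    by (rule sum.cong) auto
  then show ?thesis
    unfolding excess_def sum_vec_Psi[OF assms(1), of "\<lambda>i x. x + of_bool (i \<le> r) - k"]
    using assms sum_head2[OF assms(1), of "\<lambda>i. v i + of_bool (i \<le> Suc r) - k"] by simp
qed

lemma excess_Psi_ge:
  assumes "N \<ge> 1" "r \<ge> N"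
  shows "excess N (vec_Psi N v) (Suc k) r = excess N v k 1"
proof -
  have "(\<Sum>i=2..N. v i + of_bool (i - 1 \<le> r) - Suc k) = (\<Sum>i=2..N. v i + of_bool (i \<le> 1) - k)"
    using assms(2) by (intro sum.cong) auto
  then show ?thesis
    unfolding excess_def sum_vec_Psi[OF assms(1), of "\<lambda>i x. x + of_bool (i \<le> r) - Suc k"]
    using assms sum_head2[OF assms(1), of "\<lambda>i. v i + of_bool (i \<le> 1) - k"] by simp
qed

lemma excess_0: "excess N v 0 r = vdeg N v + (\<Sum>i=1..N. of_bool (i \<le> r))"
  by (simp add: excess_def vdeg_def sum.distrib)

lemma vle_Psi:
  assumes "vle N u v" "N \<ge> 1"
  shows "vle N (vec_Psi N u) (vec_Psi N v)"
proof -
  have d: "vdeg N (vec_Psi N u) = vdeg N (vec_Psi N v)"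
    using assms by (simp add: vdeg_Psi vle_def)
  moreover have "excess N (vec_Psi N u) k r \<le> excess N (vec_Psi N v) k r" for k r
  proof (cases "r < N")
    case True
    then show ?thesis using assms by (simp add: excess_Psi_less vle_def)
  next
    case False
    \<comment> \<open>At \<open>k = 0\<close> no unit is left for the wrap-around, but there the
      excess depends only on the degree and \<open>r\<close>.\<close>
    then show ?thesis using assms d by (cases k) (simp_all add: excess_Psi_ge vle_def excess_0)
  qed
  ultimately show ?thesis by (simp add: vle_def)
qed

lemma sum_split2:
  fixes h :: "nat \<Rightarrow> nat"
  assumes "i \<in> {1..<N}"
  shows "(\<Sum>j=1..N. h j) = (\<Sum>j\<in>{1..N} - {i, Suc i}. h j) + (h i + h (Suc i))"
proof -
  have "{i, Suc i} \<subseteq> {1..N}" using assms by auto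
  then show ?thesis using sum.subset_diff[of "{i, Suc i}" "{1..N}" h] by simp
qed

lemma vdeg_swap:
  assumes "i \<in> {1..<N}"
  shows "vdeg N (vec_swap i v) = vdeg N v"
proof -
  have "(\<Sum>j\<in>{1..N} - {i, Suc i}. vec_swap i v j) = (\<Sum>j\<in>{1..N} - {i, Suc i}. v j)"
    by (rule sum.cong) (auto simp: vec_swap_def)
  then show ?thesis
    unfolding vdeg_def sum_split2[OF assms] by (simp add: vec_swap_def)
qed

text \<open>Moving the threshold among \<open>i - 1\<close>, \<open>i\<close> and
  \<open>Suc i\<close> affects no other position, so one remainder \<open>R\<close> serves all four
  values.\<close>

lemma excess_split:
  assumes "i \<in> {1..<N}"
  obtains R where
    "\<And>r. r = i - 1 \<or> r = i \<or> r = Suc i \<Longrightarrow>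
      excess N v k r = R + ((v i + of_bool (i \<le> r) - k) + (v (Suc i) + of_bool (Suc i \<le> r) - k))"
    "excess N (vec_swap i v) k i = R + ((v (Suc i) + 1 - k) + (v i - k))"
proof
  let ?R = "(\<Sum>j\<in>{1..N} - {i, Suc i}. v j + of_bool (j \<le> i) - k)"
  fix r assume r: "r = i - 1 \<or> r = i \<or> r = Suc i"
  have "(\<Sum>j\<in>{1..N} - {i, Suc i}. v j + of_bool (j \<le> r) - k) = ?R"
    by (rule sum.cong) (use r in auto)
  then show "excess N v k r = ?R + ((v i + of_bool (i \<le> r) - k) + (v (Suc i) + of_bool (Suc i \<le> r) - k))"
    unfolding excess_def sum_split2[OF assms] by simp
next
  let ?R = "(\<Sum>j\<in>{1..N} - {i, Suc i}. v j + of_bool (j \<le> i) - k)"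
  have "(\<Sum>j\<in>{1..N} - {i, Suc i}. vec_swap i v j + of_bool (j \<le> i) - k) = ?R"
    by (rule sum.cong) (auto simp: vec_swap_def)
  then show "excess N (vec_swap i v) k i = ?R + ((v (Suc i) + 1 - k) + (v i - k))"
    unfolding excess_def sum_split2[OF assms] by (simp add: vec_swap_def)
qed

lemma excess_swap_other:
  assumes "i \<in> {1..<N}" "r \<noteq> i"
  shows "excess N (vec_swap i v) k r = excess N v k r"
proof -
  have "(\<Sum>j\<in>{1..N} - {i, Suc i}. vec_swap i v j + of_bool (j \<le> r) - k)
      = (\<Sum>j\<in>{1..N} - {i, Suc i}. v j + of_bool (j \<le> r) - k)"
    by (rule sum.cong) (auto simp: vec_swap_def)
  moreover have "of_bool (i \<le> r) = (of_bool (Suc i \<le> r) :: nat)" using assms(2) by auto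
  ultimately show ?thesis
    unfolding excess_def sum_split2[OF assms(1)] by (simp add: vec_swap_def)
qed

text \<open>This is the lifting property of the Bruhat order. Only the threshold \<open>i\<close> is
  new, and its bound follows from those at \<open>i - 1\<close> and \<open>Suc i\<close>: if
  \<open>v (Suc i)\<close> reaches \<open>k\<close>, the right side gains one over the bound at
  \<open>i - 1\<close>; otherwise neither \<open>v i\<close> nor \<open>v (Suc i)\<close> reaches
  \<open>k\<close>, and the bound at \<open>Suc i\<close> suffices.\<close>

lemma vle_swap:
  assumes "vle N u v" "i \<in> {1..<N}" "v i \<le> v (Suc i)"
  shows "vle N (vec_swap i u) (vec_swap i v)"
proof -
  have "excess N (vec_swap i u) k r \<le> excess N (vec_swap i v) k r" for k r
  proof (cases "r = i")
    case False
    then show ?thesis using assms by (simp add: excess_swap_other vle_def)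
  next
    case True
    obtain R where R: "\<And>r. r = i - 1 \<or> r = i \<or> r = Suc i \<Longrightarrow>
      excess N v k r = R + ((v i + of_bool (i \<le> r) - k) + (v (Suc i) + of_bool (Suc i \<le> r) - k))"
      "excess N (vec_swap i v) k i = R + ((v (Suc i) + 1 - k) + (v i - k))"
      using excess_split[OF assms(2)] by metis
    obtain S where S: "\<And>r. r = i - 1 \<or> r = i \<or> r = Suc i \<Longrightarrow>
      excess N u k r = S + ((u i + of_bool (i \<le> r) - k) + (u (Suc i) + of_bool (Suc i \<le> r) - k))"
      "excess N (vec_swap i u) k i = S + ((u (Suc i) + 1 - k) + (u i - k))"
      using excess_split[OF assms(2)] by metis
    have le: "excess N u k r \<le> excess N v k r" for r using assms by (simp add: vle_def)
    have b: "of_bool (i \<le> i - 1) = (0::nat)" "of_bool (Suc i \<le> i - 1) = (0::nat)"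
      using assms(2) by auto
    have "S + ((u i - k) + (u (Suc i) - k)) \<le> R + ((v i - k) + (v (Suc i) - k))"
      using le[of "i - 1"] R(1)[of "i - 1"] S(1)[of "i - 1"] b by simp
    moreover have "S + ((u i + 1 - k) + (u (Suc i) + 1 - k)) \<le> R + ((v i + 1 - k) + (v (Suc i) + 1 - k))"
      using le[of "Suc i"] R(1)[of "Suc i"] S(1)[of "Suc i"] by simp
    ultimately have "S + ((u (Suc i) + 1 - k) + (u i - k)) \<le> R + ((v (Suc i) + 1 - k) + (v i - k))"
      using assms(3) by linarith
    then show ?thesis using R(2) S(2) True by simp
  qed
  then show ?thesis using assms by (simp add: vle_def vdeg_swap)
qed

lemma vle_swap_self:
  assumes "i \<in> {1..<N}" "v i \<le> v (Suc i)"
  shows "vle N v (vec_swap i v)"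
proof -
  have "excess N v k r \<le> excess N (vec_swap i v) k r" for k r
  proof (cases "r = i")
    case False
    then show ?thesis using assms by (simp add: excess_swap_other)
  next
    case True
    obtain R where R: "\<And>r. r = i - 1 \<or> r = i \<or> r = Suc i \<Longrightarrow>
      excess N v k r = R + ((v i + of_bool (i \<le> r) - k) + (v (Suc i) + of_bool (Suc i \<le> r) - k))"
      "excess N (vec_swap i v) k i = R + ((v (Suc i) + 1 - k) + (v i - k))"
      using excess_split[OF assms(1)] by metis
    have "(v i + 1 - k) + (v (Suc i) - k) \<le> (v (Suc i) + 1 - k) + (v i - k)"
      using assms(2) by linarith
    then show ?thesis using R(1)[of i] R(2) True by simp
  qed
  then show ?thesis using assms by (simp add: vle_def vdeg_swap)
qed

lemma not_vle_swap:
  assumes "i \<in> {1..<N}" "v i < v (Suc i)"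
  shows "\<not> vle N (vec_swap i v) v"
proof
  assume "vle N (vec_swap i v) v"
  \<comment> \<open>At the level of the larger entry and threshold \<open>i\<close>, the exchange
    gains exactly one.\<close>
  then have le: "excess N (vec_swap i v) (v (Suc i)) i \<le> excess N v (v (Suc i)) i"
    by (simp add: vle_def)
  obtain R where R: "\<And>r. r = i - 1 \<or> r = i \<or> r = Suc i \<Longrightarrow>
    excess N v (v (Suc i)) r = R + ((v i + of_bool (i \<le> r) - v (Suc i)) + (v (Suc i) + of_bool (Suc i \<le> r) - v (Suc i)))"
    "excess N (vec_swap i v) (v (Suc i)) i = R + ((v (Suc i) + 1 - v (Suc i)) + (v i - v (Suc i)))"
    using excess_split[OF assms(1)] by metis
  then show False using le R(1)[of i] assms(2) by simp
qed

subsection \<open>Comparison with the dominance order\<close>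

lemma sum_vec_sort:
  fixes h :: "nat \<Rightarrow> nat"
  shows "(\<Sum>i=1..N. h (vec_sort N v i)) = (\<Sum>i=1..N. h (v i))"
proof -
  let ?ys = "map v [1..<Suc N]"
  let ?xs = "rev (sort ?ys)"
  have "(\<Sum>i=1..N. h (vec_sort N v i)) = (\<Sum>i=0..<length ?xs. map h ?xs ! i)"
    by (rule sum.reindex_bij_witness[of _ Suc "\<lambda>i. i - 1"]) (auto simp: vec_sort_def simp del: upt_Suc)
  also have "\<dots> = sum_list (map h ?xs)" by (simp add: sum_list_sum_nth)
  also have "\<dots> = sum_mset (mset (map h ?xs))" by (simp only: sum_mset_sum_list)
  also have "mset (map h ?xs) = mset (map h ?ys)" by (simp only: mset_map mset_rev mset_sort)
  also have "sum_mset (mset (map h ?ys)) = sum_list (map h ?ys)" by (simp only: sum_mset_sum_list)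
  also have "\<dots> = (\<Sum>i=1..N. h (v i))"
    by (simp only: map_map interv_sum_list_conv_sum_set_nat) (simp add: atLeastLessThanSuc_atLeastAtMost del: upt_Suc)
  finally show ?thesis .
qed

lemma vec_sort_decreasing:
  assumes "1 \<le> i" "i \<le> j" "j \<le> N"
  shows "vec_sort N v j \<le> vec_sort N v i"
proof -
  let ?xs = "sort (map v [1..<Suc N])"
  have "length ?xs = N" by simp
  then have "rev ?xs ! (j - 1) = ?xs ! (N - j)" "rev ?xs ! (i - 1) = ?xs ! (N - i)"
    using assms by (simp_all add: rev_nth del: upt_Suc)
  moreover have "?xs ! (N - j) \<le> ?xs ! (N - i)"
    by (rule sorted_nth_mono) (use assms in \<open>auto simp del: upt_Suc\<close>)
  ultimately show ?thesis using assms by (simp add: vec_sort_def del: upt_Suc)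
qed

text \<open>For every level \<open>k\<close>, a sum of \<open>m\<close> entries is at most
  \<open>m * k\<close> plus the total excess over \<open>k\<close>. For a decreasing vector equality
  holds at \<open>k = w m\<close>.\<close>

lemma partial_sum_le_if_excess_le:
  fixes u w :: "nat \<Rightarrow> nat"
  assumes dec: "\<And>i j. 1 \<le> i \<Longrightarrow> i \<le> j \<Longrightarrow> j \<le> N \<Longrightarrow> w j \<le> w i"
    and le: "\<And>k. (\<Sum>i=1..N. u i - k) \<le> (\<Sum>i=1..N. w i - k)"
    and m: "m \<in> {1..N}"
  shows "(\<Sum>i=1..m. u i) \<le> (\<Sum>i=1..m. w i)"
proof -
  define k where "k = w m"
  have "(\<Sum>i=1..m. u i) \<le> (\<Sum>i=1..m. (u i - k) + k)" by (rule sum_mono) simp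
  also have "\<dots> = (\<Sum>i=1..m. u i - k) + m * k" by (simp add: sum.distrib)
  also have "(\<Sum>i=1..m. u i - k) \<le> (\<Sum>i=1..N. u i - k)"
    by (rule sum_mono2) (use m in auto)
  also have "\<dots> \<le> (\<Sum>i=1..N. w i - k)" by (rule le)
  also have "\<dots> = (\<Sum>i=1..m. w i - k)"
  proof (rule sum.mono_neutral_right)
    show "\<forall>i\<in>{1..N} - {1..m}. w i - k = 0" using dec m unfolding k_def by auto
  qed (use m in auto)
  also have "(\<Sum>i=1..m. w i - k) + m * k = (\<Sum>i=1..m. (w i - k) + k)" by (simp add: sum.distrib)
  also have "\<dots> = (\<Sum>i=1..m. w i)"
    by (rule sum.cong) (use dec m in \<open>auto simp: k_def\<close>)
  finally show ?thesis by simp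
qed

text \<open>Splits the excess into a part that depends only on the multiset of entries and a count
  that sees their positions, matching the two alternatives in \<open>lhd\<close>.\<close>

lemma excess_count:
  assumes "r \<le> N"
  shows "excess N v k r = (\<Sum>i=1..N. v i - k) + (\<Sum>i=1..r. of_bool (k \<le> v i))"
proof -
  have "excess N v k r = (\<Sum>i=1..N. (v i - k) + (if i \<in> {1..r} then of_bool (k \<le> v i) else 0))"
    unfolding excess_def by (rule sum.cong) auto
  also have "\<dots> = (\<Sum>i=1..N. v i - k) + (\<Sum>i\<in>{1..N} \<inter> {1..r}. of_bool (k \<le> v i))"
    by (simp only: sum.distrib sum.inter_restrict finite_atLeastAtMost)
  also have "{1..N} \<inter> {1..r} = {1..r}" using assms by auto
  finally show ?thesis .
qed

lemma sum_of_bool_le: "x \<le> K \<Longrightarrow> (\<Sum>k=1..K. of_bool (k \<le> x)) = (x::nat)"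
proof -
  assume "x \<le> K"
  then have "{1..K} \<inter> {k. k \<le> x} = {1..x}" by auto
  then show ?thesis by (simp add: sum_of_bool_eq)
qed

text \<open>Threshold 0 compares the sorted vectors. If these agree, the symmetric parts cancel, and
  summing the remaining counts over all levels gives the partial sums of the vectors
  themselves.\<close>

lemma vle_imp_lhd:
  assumes "vle N u v" "u \<noteq> v"
  shows "lhd N u v"
proof (cases "vec_sort N u = vec_sort N v")
  case False
  have e: "(\<Sum>i=1..N. u i - k) \<le> (\<Sum>i=1..N. v i - k)" for k
    using assms(1) excess_count[of 0 N u k] excess_count[of 0 N v k] by (simp add: vle_def) (metis)
  have "(\<Sum>i=1..m. vec_sort N u i) \<le> (\<Sum>i=1..m. vec_sort N v i)" if "m \<in> {1..N}" for m
  proof (rule partial_sum_le_if_excess_le[OF _ _ that])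
    show "(\<Sum>i=1..N. vec_sort N u i - k) \<le> (\<Sum>i=1..N. vec_sort N v i - k)" for k
      using sum_vec_sort[of "\<lambda>x. x - k" N u] sum_vec_sort[of "\<lambda>x. x - k" N v] e[of k] by simp
  qed (rule vec_sort_decreasing)
  moreover have "(\<Sum>i=1..N. vec_sort N u i) = (\<Sum>i=1..N. vec_sort N v i)"
    using assms(1) sum_vec_sort[of "\<lambda>x. x"] by (simp add: vle_def vdeg_def)
  ultimately show ?thesis using False by (simp add: lhd_def strictly_dominated_def dominated_def)
next
  case True
  have e: "(\<Sum>i=1..N. u i - k) = (\<Sum>i=1..N. v i - k)" for k
    using sum_vec_sort[of "\<lambda>x. x - k" N u] sum_vec_sort[of "\<lambda>x. x - k" N v] True by simp
  have "(\<Sum>i=1..r. u i) \<le> (\<Sum>i=1..r. v i)" if r: "r \<in> {1..N}" for r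
  proof -
    \<comment> \<open>A bound for all entries, so that each entry equals the number of levels up to
      \<open>K\<close> that it reaches.\<close>
    define K where "K = vdeg N u"
    have K: "u i \<le> K" "v i \<le> K" if "i \<in> {1..N}" for i
      using that assms(1) member_le_sum[of i "{1..N}" u] member_le_sum[of i "{1..N}" v]
      by (auto simp: K_def vle_def vdeg_def)
    have c: "(\<Sum>i=1..r. of_bool (k \<le> u i)) \<le> (\<Sum>i=1..r. (of_bool (k \<le> v i) :: nat))" for k
    proof -
      have "excess N u k r \<le> excess N v k r" using assms(1) by (simp add: vle_def)
      then show ?thesis using excess_count[of r N _ k] r e[of k] by simp
    qed
    have "(\<Sum>i=1..r. u i) = (\<Sum>i=1..r. \<Sum>k=1..K. of_bool (k \<le> u i))"
      by (rule sum.cong[OF refl], rule sum_of_bool_le[symmetric]) (use K r in auto)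
    also have "\<dots> = (\<Sum>k=1..K. \<Sum>i=1..r. of_bool (k \<le> u i))" by (rule sum.swap)
    also have "\<dots> \<le> (\<Sum>k=1..K. \<Sum>i=1..r. of_bool (k \<le> v i))" by (rule sum_mono) (rule c)
    also have "\<dots> = (\<Sum>i=1..r. \<Sum>k=1..K. of_bool (k \<le> v i))" by (rule sum.swap)
    also have "\<dots> = (\<Sum>i=1..r. v i)"
      by (rule sum.cong[OF refl], rule sum_of_bool_le) (use K r in auto)
    finally show ?thesis .
  qed
  then show ?thesis
    using True assms by (simp add: lhd_def strictly_dominated_def dominated_def vle_def vdeg_def)
qed

definition vrank :: "nat \<Rightarrow> expvec \<Rightarrow> nat" where
  "vrank N v = (\<Sum>(k, r)\<in>{1..vdeg N v} \<times> {0..N}. excess N v k r)"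

text \<open>Provides the measure for induction along \<open>vle\<close>. Where \<open>u\<close> and
  \<open>v\<close> differ, at position \<open>r\<close>, exactly one of them reaches the larger
  value as a level; hence the excesses at this level differ at threshold \<open>r\<close> or
  \<open>r - 1\<close>.\<close>

lemma vrank_less:
  assumes "vle N u v" "u \<noteq> v" "u \<in> expvecs N" "v \<in> expvecs N"
  shows "vrank N u < vrank N v"
proof -
  have d: "vdeg N u = vdeg N v" using assms by (simp add: vle_def)
  obtain r where r: "u r \<noteq> v r" using assms(2) by blast
  then have rN: "r \<in> {1..N}" using assms(3,4) unfolding expvecs_def by force
  define k where "k = max (u r) (v r)"
  have "u r \<le> vdeg N u" "v r \<le> vdeg N v"
    using rN member_le_sum[of r "{1..N}" u] member_le_sum[of r "{1..N}" v] by (auto simp: vdeg_def)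
  then have k: "k \<in> {1..vdeg N v}" using r d by (auto simp: k_def)
  have diff: "excess N w k r = excess N w k (r - 1) + of_bool (k \<le> w r)" for w
  proof -
    have "{1..r} = insert r {1..r - 1}" using rN by auto
    then have "(\<Sum>i=1..r. of_bool (k \<le> w i)) = of_bool (k \<le> w r) + (\<Sum>i=1..r - 1. (of_bool (k \<le> w i) :: nat))"
    proof -
      have "r \<notin> {1..r - 1}" using rN by auto
      then show ?thesis
        unfolding \<open>{1..r} = insert r {1..r - 1}\<close> by (subst sum.insert) simp_all
    qed
    moreover have "r \<le> N" "r - 1 \<le> N" using rN by auto
    ultimately show ?thesis
      using excess_count[of r N w k] excess_count[of "r - 1" N w k] by linarith
  qed
  have "of_bool (k \<le> u r) \<noteq> (of_bool (k \<le> v r) :: nat)" using r by (auto simp: k_def max_def)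
  then have "excess N u k r \<noteq> excess N v k r \<or> excess N u k (r - 1) \<noteq> excess N v k (r - 1)"
    using diff[of u] diff[of v] by linarith
  then obtain s where "s \<in> {0..N}" "excess N u k s \<noteq> excess N v k s"
    using rN by (meson atLeastAtMost_iff diff_le_self le_trans zero_le)
  moreover have le: "excess N u k r \<le> excess N v k r" for k r using assms(1) by (simp add: vle_def)
  ultimately have "\<exists>a\<in>{1..vdeg N v} \<times> {0..N}. (\<lambda>(k, r). excess N u k r) a < (\<lambda>(k, r). excess N v k r) a"
    using k by (intro bexI[of _ "(k, s)"]) (auto simp: le_neq_implies_less)
  then show ?thesis
    unfolding vrank_def d by (intro sum_strict_mono_ex1) (auto intro: le)
qed

subsection \<open>Generation of all exponent vectors\<close>

lemma expvecs_zero: "(\<lambda>_. 0) \<in> expvecs N"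
  by (simp add: expvecs_def)

lemma expvecs_Psi: "N \<ge> 1 \<Longrightarrow> vec_Psi N v \<in> expvecs N"
  by (auto simp: expvecs_def vec_Psi_def)

lemma expvecs_swap: "v \<in> expvecs N \<Longrightarrow> i \<in> {1..<N} \<Longrightarrow> vec_swap i v \<in> expvecs N"
  by (auto simp: expvecs_def vec_swap_def transpose_def)

lemma vec_swap_swap [simp]: "vec_swap i (vec_swap i v) = v"
  by (simp add: vec_swap_def)

lemma expvecs_Psi_preimage:
  assumes "v \<in> expvecs N" "N \<ge> 1" "v N > 0"
  obtains u where "u \<in> expvecs N" "v = vec_Psi N u"
proof
  let ?u = "\<lambda>j. if j = 1 then v N - 1 else if j \<in> {1..N} then v (j - 1) else 0"
  show "?u \<in> expvecs N" using assms(2) by (auto simp: expvecs_def)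
  show "v = vec_Psi N ?u"
    using assms by (auto simp: fun_eq_iff vec_Psi_def expvecs_def)
qed

text \<open>Backwards, a positive last entry allows \<Psi> to be undone; otherwise a descent is
  undone, which moves a larger entry to the right and lowers \<open>W\<close>. With no descent and
  last entry 0 the vector vanishes.\<close>

lemma expvecs_induct [consumes 2, case_names zero Psi swap]:
  assumes "v \<in> expvecs N" "N \<ge> 1"
    and zero: "Q (\<lambda>_. 0)"
    and Psi: "\<And>v. v \<in> expvecs N \<Longrightarrow> Q v \<Longrightarrow> Q (vec_Psi N v)"
    and swap: "\<And>v i. v \<in> expvecs N \<Longrightarrow> i \<in> {1..<N} \<Longrightarrow> v i < v (Suc i) \<Longrightarrow> Q v \<Longrightarrow> Q (vec_swap i v)"
  shows "Q v"
proof -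
  define W where "W v = (\<Sum>i=1..N. (N - i) * v i)" for v :: expvec
  show ?thesis using assms(1)
  proof (induction v rule: wf_induct_rule[OF wf_measures[of "[vdeg N, W]"]])
    case (1 v)
    show ?case
    proof (cases "v N > 0")
      case True
      then obtain u where u: "u \<in> expvecs N" "v = vec_Psi N u"
        using expvecs_Psi_preimage 1 assms(2) by metis
      then have "Q u" using 1 vdeg_Psi[OF assms(2), of u] by simp
      then show ?thesis using Psi u by simp
    next
      case False
      show ?thesis
      proof (cases "\<exists>i\<in>{1..<N}. v (Suc i) < v i")
        case True
        then obtain i where i: "i \<in> {1..<N}" "v (Suc i) < v i" by blast
        let ?u = "vec_swap i v"
        have "W ?u < W v"
        proof -
          have "(\<Sum>j\<in>{1..N} - {i, Suc i}. (N - j) * ?u j) = (\<Sum>j\<in>{1..N} - {i, Suc i}. (N - j) * v j)"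
            by (rule sum.cong) (auto simp: vec_swap_def)
          moreover have "(N - i) * v (Suc i) + (N - Suc i) * v i < (N - i) * v i + (N - Suc i) * v (Suc i)"
          proof -
            have "N - i = Suc (N - Suc i)" using i by auto
            then show ?thesis using i by simp
          qed
          ultimately show ?thesis
            unfolding W_def sum_split2[OF i(1)] by (simp add: vec_swap_def)
        qed
        then have "Q ?u" using 1 i by (simp add: vdeg_swap expvecs_swap)
        then have "Q (vec_swap i ?u)"
          using swap[of ?u i] i expvecs_swap[OF 1(2) i(1)] by (simp add: vec_swap_def)
        then show ?thesis by simp
      next
        case False': False
        have "v i = 0" if "i \<in> {1..N}" for i
        proof -
          from that have "i \<le> N" by simp
          then show ?thesis using that
          proof (induction rule: inc_induct)
            case base
            then show ?case using False by simp
          next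
            case (step n)
            then show ?case using False' by force
          qed
        qed
        then have "v = (\<lambda>_. 0)" using 1(2) by (auto simp: expvecs_def)
        then show ?thesis using zero by simp
      qed
    qed
  qed
qed

subsection \<open>The permutation \<open>\<sigma>\<^sub>v\<close>\<close>

lemma card_filter_bij:
  assumes "bij_betw c S S"
  shows "card {j \<in> S. P (c j)} = card {j \<in> S. P j}"
proof (rule bij_betw_same_card[of c])
  show "bij_betw c {j \<in> S. P (c j)} {j \<in> S. P j}"
    using assms unfolding bij_betw_def by (auto intro: inj_on_subset)
qed

lemma sigma_zero: "sigma N (\<lambda>_. 0) = id"
proof
  fix i
  have "{j \<in> {1..N}. j \<le> i} = {1..i}" if "i \<in> {1..N}" using that by auto
  then show "sigma N (\<lambda>_. 0) i = id i" by (simp add: sigma_def)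
qed

lemma bij_betw_word_perm:
  assumes "set w \<subseteq> {1..<N}"
  shows "bij_betw (word_perm w) {1..N} {1..N}"
proof -
  have inj: "inj (word_perm w)" using bij_is_inj[OF bij_word_perm] .
  have "word_perm w k \<in> {1..N}" if "k \<in> {1..N}" for k
  proof (rule ccontr)
    assume "word_perm w k \<notin> {1..N}"
    then have "word_perm w (word_perm w k) = word_perm w k" using word_perm_fixes[OF assms] by blast
    then have "word_perm w k = k" using inj by (simp add: inj_eq)
    then show False using \<open>word_perm w k \<notin> {1..N}\<close> that by simp
  qed
  then have "word_perm w ` {1..N} \<subseteq> {1..N}" by blast
  moreover have "inj_on (word_perm w) {1..N}" using inj by (rule inj_on_subset) simp
  ultimately show ?thesis unfolding bij_betw_def using endo_inj_surj by blast
qed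

text \<open>The moved entry used to precede the entries equal to it and to follow those larger by
  one. Raised by one and placed last it does so again, because ties are broken from left to
  right.\<close>

lemma sigma_Psi:
  assumes "N \<ge> 1"
  shows "sigma N (vec_Psi N v) = sigma N v \<circ> word_perm [1..<N]"
proof
  fix i
  let ?c = "word_perm [1..<N]"
  have bij: "bij_betw ?c {1..N} {1..N}" by (rule bij_betw_word_perm) auto
  show "sigma N (vec_Psi N v) i = (sigma N v \<circ> ?c) i"
  proof (cases "i \<in> {1..N}")
    case False
    then show ?thesis using assms by (auto simp: sigma_def word_perm_upt)
  next
    case True
    have c: "?c j \<in> {1..N} \<and> vec_Psi N v j = v (?c j) + of_bool (j = N)" if "j \<in> {1..N}" for j
      using that assms by (auto simp: word_perm_upt vec_Psi_def)
    have "(vec_Psi N v i < vec_Psi N v j \<or> vec_Psi N v j = vec_Psi N v i \<and> j \<le> i)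
        \<longleftrightarrow> (v (?c i) < v (?c j) \<or> v (?c j) = v (?c i) \<and> ?c j \<le> ?c i)" if j: "j \<in> {1..N}" for j
      using c[OF True] c[OF j] True j assms by (auto simp: word_perm_upt)
    then have "{j \<in> {1..N}. vec_Psi N v i < vec_Psi N v j \<or> vec_Psi N v j = vec_Psi N v i \<and> j \<le> i}
        = {j \<in> {1..N}. v (?c i) < v (?c j) \<or> v (?c j) = v (?c i) \<and> ?c j \<le> ?c i}" by blast
    then show ?thesis
      using card_filter_bij[OF bij, of "\<lambda>j. v (?c i) < v j \<or> v j = v (?c i) \<and> j \<le> ?c i"] c[OF True] True
      by (simp add: sigma_def)
  qed
qed

lemma sigma_swap:
  assumes "i \<in> {1..<N}" "v i \<noteq> v (Suc i)"
  shows "sigma N (vec_swap i v) = sigma N v \<circ> transpose i (Suc i)"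
proof
  fix l
  let ?c = "transpose i (Suc i)"
  have bij: "bij_betw ?c {1..N} {1..N}"
    using bij_betw_word_perm[of "[i]" N] assms(1) by (simp add: word_perm_Cons)
  show "sigma N (vec_swap i v) l = (sigma N v \<circ> ?c) l"
  proof (cases "l \<in> {1..N}")
    case False
    then have "?c l = l" using assms(1) by (auto simp: transpose_def)
    then show ?thesis using False by (auto simp: sigma_def)
  next
    case True
    then have cl: "?c l \<in> {1..N}" using bij by (auto simp: bij_betw_def)
    have "v (?c j) = v (?c l) \<and> j \<le> l \<longleftrightarrow> v (?c j) = v (?c l) \<and> ?c j \<le> ?c l" for j
      using assms(2) by (auto simp: transpose_def split: if_splits)
    then have "{j \<in> {1..N}. vec_swap i v l < vec_swap i v j \<or> vec_swap i v j = vec_swap i v l \<and> j \<le> l}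
        = {j \<in> {1..N}. v (?c l) < v (?c j) \<or> v (?c j) = v (?c l) \<and> ?c j \<le> ?c l}"
      unfolding vec_swap_def by blast
    then show ?thesis
      using card_filter_bij[OF bij, of "\<lambda>j. v (?c l) < v j \<or> v j = v (?c l) \<and> j \<le> ?c l"] cl True
      by (simp add: sigma_def)
  qed
qed

lemma sigma_word:
  assumes "v \<in> expvecs N" "N \<ge> 1"
  shows "\<exists>w. set w \<subseteq> {1..<N} \<and> word_perm w = sigma N v"
  using assms
proof (induction rule: expvecs_induct)
  case zero
  show ?case by (rule exI[of _ "[]"]) (simp add: sigma_zero)
next
  case (Psi v)
  then obtain w where "set w \<subseteq> {1..<N}" "word_perm w = sigma N v" by blast
  then show ?case
    using assms(2) by (intro exI[of _ "w @ [1..<N]"]) (auto simp: word_perm_append sigma_Psi)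
next
  case (swap v i)
  then obtain w where "set w \<subseteq> {1..<N}" "word_perm w = sigma N v" by blast
  then show ?case
    using swap by (intro exI[of _ "w @ [i]"]) (auto simp: word_perm_append word_perm_Cons sigma_swap)
qed

lemma sigma_bij: "v \<in> expvecs N \<Longrightarrow> N \<ge> 1 \<Longrightarrow> bij_betw (sigma N v) {1..N} {1..N}"
  using sigma_word bij_betw_word_perm by metis

lemma sigma_Suc:
  assumes "i \<in> {1..<N}" "v i = v (Suc i)"
  shows "sigma N v (Suc i) = Suc (sigma N v i)"
proof -
  let ?A = "{j \<in> {1..N}. v i < v j \<or> v j = v i \<and> j \<le> i}"
  have "{j \<in> {1..N}. v (Suc i) < v j \<or> v j = v (Suc i) \<and> j \<le> Suc i} = insert (Suc i) ?A"
    using assms by (auto simp: le_Suc_eq)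
  then show ?thesis using assms by (simp add: sigma_def)
qed

text \<open>Tied neighbours carry consecutive labels, so exchanging the positions amounts to
  exchanging the labels. This translates an edge at \<open>i\<close> into an interchange of tableau
  entries.\<close>

lemma sigma_transpose:
  assumes "v \<in> expvecs N" "i \<in> {1..<N}" "v i = v (Suc i)"
  shows "sigma N v \<circ> transpose i (Suc i) = transpose (sigma N v i) (Suc (sigma N v i)) \<circ> sigma N v"
proof -
  obtain w where "set w \<subseteq> {1..<N}" "word_perm w = sigma N v" using sigma_word assms by force
  then have "inj (sigma N v)" using bij_is_inj[OF bij_word_perm] by metis
  then have "sigma N v x = sigma N v i \<longleftrightarrow> x = i" "sigma N v x = Suc (sigma N v i) \<longleftrightarrow> x = Suc i" for x
    unfolding sigma_Suc[OF assms(2,3), symmetric] by (simp_all add: inj_eq)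
  then show ?thesis
    using sigma_Suc[OF assms(2,3)] by (auto simp: fun_eq_iff transpose_def)
qed

lemma of_int_fract: "of_int e = Fract (of_int e) 1"
  by (cases e rule: int_cases2) (simp_all add: of_nat_fract)

text \<open>\<alpha> is transcendental over the rationals, so a spectral vector separates into its
  exponents and its contents.\<close>

lemma alpha_independent:
  assumes "alpha * of_nat a + of_int b = alpha * of_nat a' + of_int b'"
  shows "a = a'" "b = b'"
proof -
  have "alpha * of_int (int a - int a') = of_int (b' - b)"
    using assms by (simp add: algebra_simps)
  then have "[:0, 1:] * of_int (int a - int a') = (of_int (b' - b) :: rat poly)"
    unfolding of_int_fract alpha_def by (simp add: eq_fract del: of_int_diff)
  then have "[:0, of_int (int a - int a') :: rat:] = [:of_int (b' - b):]"
    by (simp add: of_int_poly del: of_int_diff)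
  then show "a = a'" "b = b'"
    by (auto simp del: of_int_diff)
qed

section \<open>Coefficients of vector-valued polynomials\<close>

lemma lookup_pvar_mult:
  "lookup (pvar j * f) (single j 1 + m) = lookup f m"
  "lookup n j = 0 \<Longrightarrow> lookup (pvar j * f) n = 0"
proof (induction f rule: poly_mapping_single_induct)
  case (single k c)
  {
    case 1
    show ?case by (simp add: pvar_mult_single lookup_single when_def)
  next
    case 2
    then have "single j 1 + k \<noteq> n" by (auto simp: lookup_add)
    then show ?case by (simp add: pvar_mult_single lookup_single when_def)
  }
qed (simp_all add: distrib_left lookup_add)

lemma Fil_lookup_zero: "f \<in> Fil A d \<Longrightarrow> d \<le> mon_degree m \<Longrightarrow> lookup f m = 0"
proof (rule ccontr)
  assume f: "f \<in> Fil A d" and m: "d \<le> mon_degree m" and "lookup f m \<noteq> 0"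
  then have "m \<in> keys f" by (simp add: in_keys_iff)
  then have "mon_degree m < d" using f unfolding Fil_def by blast
  then show False using m by simp
qed

text \<open>Reads the tensor product by monomials instead of by tableaux: the coefficient of a
  monomial is a vector of tableaux.\<close>

definition mcoef :: "(nat \<Rightarrow>\<^sub>0 nat) \<Rightarrow> mmod \<Rightarrow> vmod" where
  "mcoef m P = Poly_Mapping.map (\<lambda>f. lookup f m) P"

lemma lookup_mcoef: "lookup (mcoef m P) \<tau> = lookup (lookup P \<tau>) m"
  by (simp add: mcoef_def Poly_Mapping.map.rep_eq when_def)

lemma mcoef_add: "mcoef m (P + Q) = mcoef m P + mcoef m Q"
  by (rule poly_mapping_eqI) (simp add: lookup_mcoef lookup_add)

lemma mcoef_mscale: "mcoef m (mscale c P) = vscale c (mcoef m P)"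
  by (rule poly_mapping_eqI) (simp add: lookup_mcoef lookup_mscale lookup_vscale lookup_pconst_mult)

lemma mcoef_0 [simp]: "mcoef m 0 = 0"
  by (rule poly_mapping_eqI) (simp add: lookup_mcoef)

lemma mcoef_fold_mact: "mcoef m (fold mact w P) = vact_word w (mcoef m P)"
proof -
  have "mcoef m (mact i Q) = vact i (mcoef m Q)" for i Q
    by (rule poly_mapping_eqI) (simp add: lookup_mcoef lookup_mact lookup_vact lookup_add lookup_pconst_mult)
  then show ?thesis
    unfolding vact_word_def by (induction w arbitrary: P) simp_all
qed

lemma vscale_zero [simp]: "vscale c 0 = 0"
  by (rule poly_mapping_eqI) (simp add: lookup_vscale)

lemma vact_word_add: "vact_word w (t + u) = vact_word w t + vact_word w u"
  unfolding vact_word_def by (induction w arbitrary: t u) (simp_all add: vact_add)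

lemma vact_word_vscale: "vact_word w (vscale c t) = vscale c (vact_word w t)"
  unfolding vact_word_def by (induction w arbitrary: t) (simp_all add: vact_vscale)

lemma vact_word_0 [simp]: "vact_word w 0 = 0"
  unfolding vact_word_def by (induction w) simp_all

lemma vact_word_append: "vact_word (u @ w) t = vact_word w (vact_word u t)"
  by (simp add: vact_word_def)

lemma vact_word_rev: "vact_word (rev w) (vact_word w t) = t"
  unfolding vact_word_def by (induction w arbitrary: t) (simp_all add: vact_vact)

lemma vact_word_rev': "vact_word w (vact_word (rev w) t) = t"
  using vact_word_rev[of "rev w"] by simp

lemma tensor_add: "tensor f (t + u) = tensor f t + tensor f u"
  by (simp add: tensor_eq_mmult memb_add mmult_add)

lemma tensor_vscale: "tensor f (vscale c t) = mscale c (tensor f t)"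
  by (simp add: tensor_eq_mmult memb_vscale mscale_def mmult_mmult mult.commute)

lemma tensor_zero [simp]: "tensor f 0 = 0"
  by (rule poly_mapping_eqI) (simp add: lookup_tensor)

definition mons :: "mmod \<Rightarrow> (nat \<Rightarrow>\<^sub>0 nat) set" where
  "mons P = (\<Union>\<tau>\<in>keys P. keys (lookup P \<tau>))"

lemma finite_mons: "finite (mons P)"
  by (simp add: mons_def)

lemma mons_iff: "m \<in> mons P \<longleftrightarrow> mcoef m P \<noteq> 0"
  by (auto simp: mons_def poly_mapping_eq_iff fun_eq_iff lookup_mcoef in_keys_iff) (metis in_keys_iff lookup_zero)

lemma lookup_sum_tensor_mons:
  assumes "finite S"
  shows "lookup (lookup (\<Sum>m\<in>S. tensor (single m 1) (mcoef m P)) \<tau>) n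
    = (if n \<in> S then lookup (lookup P \<tau>) n else 0)"
proof -
  have "lookup (lookup (\<Sum>m\<in>S. tensor (single m 1) (mcoef m P)) \<tau>) n
      = (\<Sum>m\<in>S. if m = n then lookup (lookup P \<tau>) n else 0)"
    unfolding lookup_sum by (rule sum.cong)
      (auto simp: lookup_tensor lookup_pconst_mult lookup_mcoef lookup_single when_def)
  then show ?thesis using assms by simp
qed

lemma mmod_eqI: "(\<And>\<tau> m. lookup (lookup P \<tau>) m = lookup (lookup Q \<tau>) m) \<Longrightarrow> P = Q" for P Q :: mmod
  by (intro poly_mapping_eqI) simp

lemma not_mons_lookup: "m \<notin> mons P \<Longrightarrow> lookup (lookup P \<tau>) m = 0"
  unfolding mons_iff by (metis lookup_mcoef lookup_zero)

lemma mons_decomposition: "P = (\<Sum>m\<in>mons P. tensor (single m 1) (mcoef m P))"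
  by (rule mmod_eqI) (simp add: lookup_sum_tensor_mons[OF finite_mons] not_mons_lookup)

lemma homogeneous_component_eq:
  "homogeneous_component d P = (\<Sum>m\<in>{m \<in> mons P. mon_degree m = d}. tensor (single m 1) (mcoef m P))"
proof (rule mmod_eqI)
  fix \<tau> n
  have "lookup (lookup (homogeneous_component d P) \<tau>) n
      = (\<Sum>\<rho>\<in>keys P. if \<rho> = \<tau> then (if mon_degree n = d then lookup (lookup P \<tau>) n else 0) else 0)"
    unfolding homogeneous_component_def lookup_sum
  proof (rule sum.cong[OF refl])
    fix \<rho> assume "\<rho> \<in> keys P"
    have "(\<Sum>m\<in>{m \<in> keys (lookup P \<rho>). mon_degree m = d}.
        lookup (lookup (single \<rho> (single m (lookup (lookup P \<rho>) m))) \<tau>) n)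
      = (\<Sum>m\<in>{m \<in> keys (lookup P \<rho>). mon_degree m = d}. if m = n then
          (if \<rho> = \<tau> then lookup (lookup P \<tau>) n else 0) else 0)"
      by (rule sum.cong) (auto simp: lookup_single when_def)
    then show "(\<Sum>m\<in>{m \<in> keys (lookup P \<rho>). mon_degree m = d}.
        lookup (lookup (single \<rho> (single m (lookup (lookup P \<rho>) m))) \<tau>) n)
      = (if \<rho> = \<tau> then (if mon_degree n = d then lookup (lookup P \<tau>) n else 0) else 0)"
      by (auto simp: in_keys_iff)
  qed
  also have "\<dots> = (if mon_degree n = d then lookup (lookup P \<tau>) n else 0)"
    by (auto simp: in_keys_iff)
  finally show "lookup (lookup (homogeneous_component d P) \<tau>) n
      = lookup (lookup (\<Sum>m\<in>{m \<in> mons P. mon_degree m = d}. tensor (single m 1) (mcoef m P)) \<tau>) n"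
    by (simp add: lookup_sum_tensor_mons finite_mons not_mons_lookup)
qed

lemma mdegree_eq:
  assumes "\<And>m. m \<in> mons P \<Longrightarrow> mon_degree m \<le> d" "n \<in> mons P" "mon_degree n = d"
  shows "mdegree P = d"
proof -
  have "(\<Union>\<tau>\<in>keys P. mon_degree ` keys (lookup P \<tau>)) = mon_degree ` mons P"
    by (auto simp: mons_def)
  then show ?thesis
    unfolding mdegree_def using assms finite_mons by (intro Max_eqI) auto
qed

context shape
begin

section \<open>Top coefficients\<close>

definition emon :: "expvec \<Rightarrow> (nat \<Rightarrow>\<^sub>0 nat)" where
  "emon v = (\<Sum>i=1..N. single i (v i))"

lemma lookup_emon:
  assumes "v \<in> expvecs N"
  shows "lookup (emon v) = v"
proof
  fix k
  have "lookup (emon v) k = (\<Sum>i=1..N. if i = k then v k else 0)"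
    unfolding emon_def lookup_sum by (rule sum.cong) (auto simp: lookup_single when_def)
  then show "lookup (emon v) k = v k" using assms by (auto simp: expvecs_def)
qed

lemma keys_emon: "v \<in> expvecs N \<Longrightarrow> keys (emon v) \<subseteq> {1..N}"
  unfolding expvecs_def by (fastforce simp: in_keys_iff lookup_emon expvecs_def)

lemma mon_degree_emon: "v \<in> expvecs N \<Longrightarrow> mon_degree (emon v) = vdeg N v"
  by (simp add: mon_degree_superset[OF _ keys_emon] lookup_emon vdeg_def)

lemma emon_exists:
  assumes "keys m \<subseteq> {1..N}"
  obtains v where "v \<in> expvecs N" "m = emon v"
proof
  show v: "lookup m \<in> expvecs N" using assms by (auto simp: expvecs_def in_keys_iff)
  show "m = emon (lookup m)" by (rule poly_mapping_eqI) (simp add: lookup_emon[OF v])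
qed

lemma mons_MF:
  assumes "P \<in> MF (Suc d)" "m \<in> mons P"
  obtains v where "v \<in> expvecs N" "m = emon v" "vdeg N v \<le> d"
proof -
  have "keys m \<subseteq> {1..N} \<and> mon_degree m < Suc d"
    using assms unfolding mons_def MF_def Fil_def by blast
  then obtain v where "v \<in> expvecs N" "m = emon v" using emon_exists by blast
  then show ?thesis using that mon_degree_emon \<open>keys m \<subseteq> {1..N} \<and> mon_degree m < Suc d\<close> by force
qed

lemma mcoef_V_space: "P \<in> M \<Longrightarrow> mcoef m P \<in> V_space"
proof (rule V_spaceI)
  fix \<rho> assume "P \<in> M" "\<rho> \<notin> RST lam"
  then have "lookup P \<rho> = 0" by (auto simp: M_space_def in_keys_iff)
  then show "lookup (mcoef m P) \<rho> = 0" by (simp add: lookup_mcoef)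
qed

lemma map_key_emon:
  assumes "inj p" "v \<in> expvecs N" "v \<circ> p \<in> expvecs N"
  shows "Poly_Mapping.map_key p (emon v) = emon (v \<circ> p)"
  by (rule poly_mapping_eqI) (simp add: lookup_map_key[OF assms(1)] lookup_emon assms(2,3))

lemma mcoef_high:
  assumes "P \<in> MF d" "d \<le> mon_degree m"
  shows "mcoef m P = 0"
  by (rule poly_mapping_eqI) (use assms in \<open>auto simp: lookup_mcoef MF_def intro: Fil_lookup_zero\<close>)

lemma mcoef_varsigma:
  assumes "P \<in> MF (Suc d)" "i \<in> {1..<N}" "v \<in> expvecs N" "vdeg N v = d"
  shows "mcoef (emon v) (varsigma i P) = vact i (mcoef (emon (vec_swap i v)) P)"
proof (rule poly_mapping_eqI)
  fix \<rho>
  have s: "v \<circ> transpose i (Suc i) = vec_swap i v" by (auto simp: vec_swap_def)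
  have mk: "Poly_Mapping.map_key (transpose i (Suc i)) (emon v) = emon (vec_swap i v)"
    unfolding s[symmetric]
    by (rule map_key_emon[OF bij_is_inj]) (simp_all add: s assms(3) expvecs_swap[OF assms(3,2)])
  have "divdiff i (lookup P \<rho>) \<in> Fil {1..N} d"
    by (rule divdiff_Fil) (use assms in \<open>auto simp: MF_def\<close>)
  then have "lookup (divdiff i (lookup P \<rho>)) (emon v) = 0"
    using assms by (intro Fil_lookup_zero) (auto simp: mon_degree_emon)
  then show "lookup (mcoef (emon v) (varsigma i P)) \<rho> = lookup (vact i (mcoef (emon (vec_swap i v)) P)) \<rho>"
    by (simp add: lookup_mcoef lookup_varsigma lookup_vact lookup_add lookup_pconst_mult lookup_pswap mk)
qed

text \<open>Each replacement of a variable by \<alpha> loses one degree, so the substitution is a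
  plain rotation of the variables up to lower terms.\<close>

lemma shift_subst_top:
  assumes "f \<in> Fil {1..N} d"
  shows "shift_subst N f - psubst (\<lambda>j. pvar (word_perm (rev [1..<N]) j)) f \<in> Fil {1..N} (d - 1)"
  using assms
proof (induction rule: Fil_induct)
  case (add d f g)
  then show ?case
    using Fil_add[OF add.IH] by (simp add: shift_subst_simps psubst_add algebra_simps)
next
  case (mult d j f)
  let ?r = "psubst (\<lambda>j. pvar (word_perm (rev [1..<N]) j))"
  define e where "e = shift_subst N f - ?r f"
  \<comment> \<open>For \<open>d = 0\<close> the index \<open>d - 1\<close> does not drop, but then
    \<open>f = 0\<close>.\<close>
  have e: "pvar k * e \<in> Fil {1..N} d" if "k \<in> {1..N}" for k
  proof (cases d)
    case 0
    then have "f = 0" using mult by (auto simp: Fil_def)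
    then show ?thesis by (simp add: e_def shift_subst_simps)
  next
    case (Suc d')
    then show ?thesis using Fil_pvar_mult[OF mult.IH that] by (simp add: e_def)
  qed
  have sf: "shift_subst N f \<in> Fil {1..N} d" using Fil_shift_subst mult by blast
  show ?case
  proof (cases "j = 1")
    case True
    have "shift_subst N (pvar j * f) - ?r (pvar j * f) = pvar N * e - pconst alpha * shift_subst N f"
      using True N_pos by (simp add: shift_subst_simps psubst_mult word_perm_rev_upt e_def algebra_simps)
    then show ?thesis using e[of N] sf N_pos by (simp add: Fil_diff Fil_pconst_mult)
  next
    case False
    then have "shift_subst N (pvar j * f) - ?r (pvar j * f) = pvar (j - 1) * e"
      using mult N_pos by (simp add: shift_subst_simps psubst_mult word_perm_rev_upt e_def algebra_simps)
    moreover have "j - 1 \<in> {1..N}" using False mult by auto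
    ultimately show ?thesis using e by simp
  qed
qed (simp_all add: shift_subst_simps)

lemma expvecs_word_perm: "u \<in> expvecs N \<Longrightarrow> set w \<subseteq> {1..<N} \<Longrightarrow> u \<circ> word_perm w \<in> expvecs N"
  by (simp add: expvecs_def word_perm_fixes)

lemma mcoef_T_op:
  assumes "P \<in> MF (Suc d)" "u \<in> expvecs N" "vdeg N u = d"
  shows "mcoef (emon u) (T_op N P) = vact_word [1..<N] (mcoef (emon (u \<circ> word_perm (rev [1..<N]))) P)"
proof -
  let ?p = "word_perm (rev [1..<N])"
  have mk: "Poly_Mapping.map_key ?p (emon u) = emon (u \<circ> ?p)"
    by (rule map_key_emon) (use assms expvecs_word_perm[of u "rev [1..<N]"] bij_is_inj[OF bij_word_perm] in auto)
  have "mcoef (emon u) (Poly_Mapping.map (shift_subst N) P) = mcoef (emon (u \<circ> ?p)) P"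
  proof (rule poly_mapping_eqI)
    fix \<rho>
    have "lookup P \<rho> \<in> Fil {1..N} (Suc d)" using assms by (simp add: MF_def)
    from shift_subst_top[OF this]
    have "lookup (shift_subst N (lookup P \<rho>) - psubst (\<lambda>j. pvar (?p j)) (lookup P \<rho>)) (emon u) = 0"
      using assms by (intro Fil_lookup_zero) (auto simp: mon_degree_emon)
    then show "lookup (mcoef (emon u) (Poly_Mapping.map (shift_subst N) P)) \<rho>
        = lookup (mcoef (emon (u \<circ> ?p)) P) \<rho>"
      by (simp add: lookup_mcoef lookup_map_shift lookup_minus lookup_psubst_bij[OF bij_word_perm] mk[simplified])
  qed
  then show ?thesis by (simp add: T_op_eq mcoef_fold_mact)
qed

lemma mcoef_Psi_hat_eq:
  assumes "P \<in> MF (Suc d)" "mon_degree m = Suc d"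
  shows "mcoef m (Psi_hat N P) = mcoef m (mmult (pvar N) (T_op N P))"
  using mcoef_high[OF MF_T_op[OF assms(1)], of m] assms
  by (simp add: Psi_hat_eq mcoef_add mcoef_mscale)

lemma mcoef_Psi_hat:
  assumes "P \<in> MF (Suc d)" "u \<in> expvecs N" "vdeg N u = d"
  shows "mcoef (emon (vec_Psi N u)) (Psi_hat N P) = vact_word [1..<N] (mcoef (emon u) P)"
proof -
  let ?c = "word_perm [1..<N]"
  let ?u = "u \<circ> ?c"
  have U: "?u \<in> expvecs N" by (rule expvecs_word_perm) (use assms in auto)
  have E: "vec_Psi N u \<in> expvecs N" using expvecs_Psi N_pos .
  have em: "emon (vec_Psi N u) = single N 1 + emon ?u"
  proof (rule poly_mapping_eqI)
    fix k show "lookup (emon (vec_Psi N u)) k = lookup (single N 1 + emon ?u) k"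
      unfolding lookup_add lookup_emon[OF E] lookup_emon[OF U]
      using assms N_pos by (auto simp: lookup_single when_def vec_Psi_def word_perm_upt expvecs_def)
  qed
  have md: "mon_degree (emon (vec_Psi N u)) = Suc d"
    using assms by (simp add: mon_degree_emon[OF E] vdeg_Psi[OF N_pos])
  have "vdeg N ?u = d"
    using md mon_degree_emon[OF U] by (simp add: em mon_degree_add)
  moreover have "?u \<circ> word_perm (rev [1..<N]) = u"
    using N_pos by (auto simp: fun_eq_iff word_perm_upt word_perm_rev_upt)
  ultimately have "mcoef (emon ?u) (T_op N P) = vact_word [1..<N] (mcoef (emon u) P)"
    using mcoef_T_op[OF assms(1) U] by simp
  moreover have "mcoef (emon (vec_Psi N u)) (mmult (pvar N) Q) = mcoef (emon ?u) Q" for Q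
    unfolding em by (rule poly_mapping_eqI) (simp add: lookup_mcoef lookup_mmult lookup_pvar_mult(1)[simplified])
  ultimately show ?thesis using mcoef_Psi_hat_eq[OF assms(1) md] by simp
qed

text \<open>In top degree the image of \<open>Psi_hat\<close> is divisible by the last variable, so
  the exponents occurring there are images under \<open>vec_Psi\<close>.\<close>

lemma mcoef_Psi_hat_0:
  assumes "P \<in> MF (Suc d)" "u \<in> expvecs N" "vdeg N u = Suc d" "u N = 0"
  shows "mcoef (emon u) (Psi_hat N P) = 0"
proof -
  have "mcoef (emon u) (mmult (pvar N) Q) = 0" for Q
    by (rule poly_mapping_eqI) (simp add: lookup_mcoef lookup_mmult lookup_pvar_mult(2) lookup_emon assms)
  then show ?thesis using mcoef_Psi_hat_eq[OF assms(1), of "emon u"] assms by (simp add: mon_degree_emon)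
qed

section \<open>Paths\<close>

lemma zeta_Psi:
  assumes "j \<in> {1..N}"
  shows "zeta N (vec_Psi N v) \<tau> j = (if j = N then zeta N v \<tau> 1 + alpha else zeta N v \<tau> (Suc j))"
  unfolding zeta_def sigma_Psi[OF N_pos] o_apply
  using assms N_pos by (auto simp: word_perm_upt vec_Psi_def algebra_simps)

lemma zeta_swap:
  assumes "i \<in> {1..<N}" "v i \<noteq> v (Suc i)"
  shows "zeta N (vec_swap i v) \<tau> j = zeta N v \<tau> (transpose i (Suc i) j)"
  unfolding zeta_def sigma_swap[OF assms] by (simp add: vec_swap_def)

lemma zeta_tableau_swap:
  assumes "v \<in> expvecs N" "i \<in> {1..<N}" "v i = v (Suc i)"
  shows "zeta N v (tableau_swap (sigma N v i) \<tau>) j = zeta N v \<tau> (transpose i (Suc i) j)"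
proof -
  have "v (transpose i (Suc i) j) = v j" using assms(3) by (auto simp: transpose_def)
  then show ?thesis
    using fun_cong[OF sigma_transpose[OF assms], of j] by (simp add: zeta_def CT_tableau_swap)
qed

text \<open>Keeps the denominators in \<open>J_step\<close> away from 0. For a tie the two labels
  are consecutive entries of an RST and have distinct contents.\<close>

lemma zeta_neq:
  assumes "\<tau> \<in> RST lam" "v \<in> expvecs N" "i \<in> {1..<N}"
  shows "zeta N v \<tau> i \<noteq> zeta N v \<tau> (Suc i)"
proof
  assume "zeta N v \<tau> i = zeta N v \<tau> (Suc i)"
  then have v: "v i = v (Suc i)" and CT: "CT \<tau> (sigma N v i) = CT \<tau> (sigma N v (Suc i))"
    unfolding zeta_def by (blast dest: alpha_independent)+
  have "sigma N v i \<in> {1..N}" "sigma N v (Suc i) \<in> {1..N}"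
    using sigma_bij[OF assms(2) N_pos] assms(3) by (auto simp: bij_betw_def)
  then show False
    using CT RST_CT_close[OF assms(1), of "sigma N v i" "Suc (sigma N v i)"] sigma_Suc[OF assms(3) v] by simp
qed

text \<open>Yields contents rather than tableaux, so that it also applies to an interchange that is
  not an RST.\<close>

lemma zeta_inj:
  assumes "v \<in> expvecs N" "v' \<in> expvecs N" "\<And>j. j \<in> {1..N} \<Longrightarrow> zeta N v \<tau> j = zeta N v' \<tau>' j"
  shows "v = v' \<and> (\<forall>i\<in>{1..N}. CT \<tau> i = CT \<tau>' i)"
proof -
  have eq: "v j = v' j" "CT \<tau> (sigma N v j) = CT \<tau>' (sigma N v' j)" if "j \<in> {1..N}" for j
    using assms(3)[OF that] unfolding zeta_def by (blast dest: alpha_independent)+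
  have v: "v = v'"
  proof
    fix j show "v j = v' j" using eq(1) assms(1,2) by (cases "j \<in> {1..N}") (auto simp: expvecs_def)
  qed
  moreover have "CT \<tau> i = CT \<tau>' i" if "i \<in> {1..N}" for i
  proof -
    have "i \<in> sigma N v ` {1..N}" using that sigma_bij[OF assms(1) N_pos] by (simp add: bij_betw_def)
    then show ?thesis using eq(2) v by blast
  qed
  ultimately show ?thesis by blast
qed

lemma RST_eq_if_contents:
  "\<tau> \<in> RST lam \<Longrightarrow> \<tau>' \<in> RST lam \<Longrightarrow> (\<forall>i\<in>{1..N}. CT \<tau> i = CT \<tau>' i) \<Longrightarrow> \<tau> = \<tau>'"
  by (intro filling_eq_if_contents RST_filling RST_diagonal_decreasing) auto

lemma eigen_cong: "eigen z P \<Longrightarrow> (\<And>j. j \<in> {1..N} \<Longrightarrow> z' j = z j) \<Longrightarrow> eigen z' P"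
  by (simp add: eigen_def)

section \<open>Leading coefficients and the invariant along a path\<close>

definition lead :: "tableau \<Rightarrow> expvec \<Rightarrow> vmod" where
  "lead \<tau> v = vact_perm N (sigma N v) (single \<tau> 1)"

lemma lead_word:
  assumes "v \<in> expvecs N"
  obtains w where "set w \<subseteq> {1..<N}" "word_perm w = sigma N v"
    "\<And>\<tau>. \<tau> \<in> RST lam \<Longrightarrow> lead \<tau> v = vact_word w (single \<tau> 1)"
proof -
  obtain w where w: "set w \<subseteq> {1..<N}" "word_perm w = sigma N v"
    using sigma_word[OF assms N_pos] by blast
  then show ?thesis
    using that[OF w] vact_perm_eq[OF w] V_space_single by (simp add: lead_def)
qed

lemma lead_eq:
  "set w \<subseteq> {1..<N} \<Longrightarrow> word_perm w = sigma N v \<Longrightarrow> \<tau> \<in> RST lam \<Longrightarrow> lead \<tau> v = vact_word w (single \<tau> 1)"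
  unfolding lead_def by (rule vact_perm_eq) (simp_all add: V_space_single)

lemma lead_nonzero:
  assumes "\<tau> \<in> RST lam" "v \<in> expvecs N"
  shows "lead \<tau> v \<noteq> 0"
proof
  assume "lead \<tau> v = 0"
  moreover obtain w where "lead \<tau> v = vact_word w (single \<tau> 1)" using lead_word assms by metis
  ultimately have "single \<tau> (1::ratfun) = 0" using vact_word_rev[of w "single \<tau> 1"] by simp
  then show False using lookup_single_eq[of \<tau> "1::ratfun"] by simp
qed

text \<open>Two clauses are sharper than the final statement: the top support is bounded in
  \<open>vle\<close>, which the edges preserve, and the coefficient at \<open>emon v\<close> is
  \<open>lead \<tau> v\<close> itself. Lower degrees are restricted only by the eigenvalue
  equations.\<close>

definition J_inv :: "tableau \<Rightarrow> expvec \<Rightarrow> mmod \<Rightarrow> bool" where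
  "J_inv \<tau> v P \<longleftrightarrow> \<tau> \<in> RST lam \<and> v \<in> expvecs N \<and> P \<in> MF (Suc (vdeg N v)) \<and> eigen (zeta N v \<tau>) P
    \<and> (\<forall>u\<in>expvecs N. vdeg N u = vdeg N v \<longrightarrow> mcoef (emon u) P \<noteq> 0 \<longrightarrow> vle N u v)
    \<and> mcoef (emon v) P = lead \<tau> v"

lemma J_invD:
  assumes "J_inv \<tau> v P"
  shows "\<tau> \<in> RST lam" "v \<in> expvecs N" "P \<in> MF (Suc (vdeg N v))" "eigen (zeta N v \<tau>) P"
    "\<And>u. u \<in> expvecs N \<Longrightarrow> vdeg N u = vdeg N v \<Longrightarrow> mcoef (emon u) P \<noteq> 0 \<Longrightarrow> vle N u v"
    "mcoef (emon v) P = lead \<tau> v"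
  using assms unfolding J_inv_def by blast+

lemma J_inv_root: "J_inv (root_tableau lam) (\<lambda>_. 0) (memb (single (root_tableau lam) 1))"
proof -
  let ?\<tau> = "root_tableau lam"
  have R: "?\<tau> \<in> RST lam" by (rule root_RST)
  have "eigen (zeta N (\<lambda>_. 0) ?\<tau>) (memb (single ?\<tau> 1))"
    by (rule eigen_cong[OF eigen_memb[OF R]]) (simp add: zeta_def sigma_zero)
  moreover have "vle N u (\<lambda>_. 0)" if "u \<in> expvecs N" "vdeg N u = vdeg N (\<lambda>_. 0)" for u
  proof -
    have "u = (\<lambda>_. 0)" using that by (auto simp: vdeg_def expvecs_def fun_eq_iff)
    then show ?thesis using vle_refl by simp
  qed
  moreover have "mcoef (emon (\<lambda>_. 0)) (memb (single ?\<tau> 1)) = lead ?\<tau> (\<lambda>_. 0)"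
  proof -
    have "emon (\<lambda>_. 0) = 0" by (simp add: emon_def)
    then have "mcoef (emon (\<lambda>_. 0)) (memb t) = t" for t
      by (intro poly_mapping_eqI) (simp add: lookup_mcoef lookup_memb pconst_def)
    moreover have "lead ?\<tau> (\<lambda>_. 0) = vact_word [] (single ?\<tau> 1)"
      by (rule lead_eq) (simp_all add: sigma_zero R)
    ultimately show ?thesis by (simp add: vact_word_def)
  qed
  ultimately show ?thesis
    using R by (simp add: J_inv_def expvecs_zero MF_memb V_space_single)
qed

lemma J_inv_Psi:
  assumes "J_inv \<tau> v P"
  shows "J_inv \<tau> (vec_Psi N v) (Psi_hat N P)"
proof -
  note inv = J_invD[OF assms(1)]
  note \<tau> = inv(1) and v = inv(2) and P = inv(3) and eig = inv(4) and supp = inv(5) and top = inv(6)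
  have d: "vdeg N (vec_Psi N v) = Suc (vdeg N v)" using vdeg_Psi N_pos by simp
  have "eigen (zeta N (vec_Psi N v) \<tau>) (Psi_hat N P)"
    by (rule eigen_cong[OF eigen_Psi_hat[OF MF_subset_M[OF P] eig]]) (rule zeta_Psi)
  moreover have "vle N u (vec_Psi N v)"
    if u: "u \<in> expvecs N" "vdeg N u = Suc (vdeg N v)" "mcoef (emon u) (Psi_hat N P) \<noteq> 0" for u
  proof -
    have "u N > 0" using mcoef_Psi_hat_0[OF P u(1,2)] u(3) by auto
    then obtain u0 where u0: "u0 \<in> expvecs N" "u = vec_Psi N u0"
      using expvecs_Psi_preimage[OF u(1) N_pos] by blast
    then have "vdeg N u0 = vdeg N v" using u(2) vdeg_Psi[OF N_pos, of u0] by simp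
    moreover from this have "mcoef (emon u0) P \<noteq> 0"
      using mcoef_Psi_hat[OF P u0(1)] u(3) u0(2) by auto
    ultimately show ?thesis using supp[OF u0(1)] vle_Psi[OF _ N_pos] u0(2) by simp
  qed
  moreover have "mcoef (emon (vec_Psi N v)) (Psi_hat N P) = lead \<tau> (vec_Psi N v)"
  proof -
    obtain w where w: "set w \<subseteq> {1..<N}" "word_perm w = sigma N v"
      "lead \<tau> v = vact_word w (single \<tau> 1)"
      using lead_word[OF v] \<tau> by metis
    have "lead \<tau> (vec_Psi N v) = vact_word (w @ [1..<N]) (single \<tau> 1)"
      by (rule lead_eq) (use w \<tau> N_pos in \<open>auto simp: word_perm_append sigma_Psi\<close>)
    then show ?thesis using mcoef_Psi_hat[OF P v refl] top w(3) by (simp add: vact_word_append)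
  qed
  ultimately show ?thesis
    using \<tau> MF_Psi_hat[OF P] N_pos by (simp add: J_inv_def d expvecs_Psi)
qed

lemma J_step_support:
  assumes P: "P \<in> MF (Suc (vdeg N v))"
    and supp: "\<And>u. u \<in> expvecs N \<Longrightarrow> vdeg N u = vdeg N v \<Longrightarrow> mcoef (emon u) P \<noteq> 0 \<Longrightarrow> vle N u v"
    and i: "i \<in> {1..<N}" "v i \<le> v (Suc i)"
    and u: "u \<in> expvecs N" "vdeg N u = vdeg N v" "mcoef (emon u) (varsigma i P + mscale c P) \<noteq> 0"
  shows "vle N u (vec_swap i v)"
proof -
  have "mcoef (emon u) (varsigma i P + mscale c P)
      = vact i (mcoef (emon (vec_swap i u)) P) + vscale c (mcoef (emon u) P)"
    using mcoef_varsigma[OF P i(1) u(1,2)] by (simp add: mcoef_add mcoef_mscale)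
  then consider "mcoef (emon (vec_swap i u)) P \<noteq> 0" | "mcoef (emon u) P \<noteq> 0" using u(3) by fastforce
  then show ?thesis
  proof cases
    case 1
    then have "vle N (vec_swap i u) v"
      using supp[of "vec_swap i u"] u i by (simp add: expvecs_swap vdeg_swap)
    then show ?thesis using vle_swap[OF _ i, of "vec_swap i u"] by simp
  next
    case 2
    then show ?thesis using supp u vle_swap_self[OF i] vle_trans by blast
  qed
qed

lemma J_inv_swap:
  assumes "J_inv \<tau> v P" and i: "i \<in> {1..<N}" "v i < v (Suc i)"
  shows "J_inv \<tau> (vec_swap i v) (varsigma i P + mscale (1 / (zeta N v \<tau> (Suc i) - zeta N v \<tau> i)) P)"
proof -
  note inv = J_invD[OF assms(1)]
  note \<tau> = inv(1) and v = inv(2) and P = inv(3) and eig = inv(4) and supp = inv(5) and top = inv(6)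
  let ?Q = "varsigma i P + mscale (1 / (zeta N v \<tau> (Suc i) - zeta N v \<tau> i)) P"
  have sv: "vec_swap i v \<in> expvecs N" using expvecs_swap v i by blast
  have "eigen (zeta N (vec_swap i v) \<tau>) ?Q"
    by (rule eigen_cong[OF eigen_step[OF MF_subset_M[OF P] eig i(1) zeta_neq[OF \<tau> v i(1)]]])
      (use i in \<open>simp add: zeta_swap\<close>)
  moreover have "mcoef (emon (vec_swap i v)) ?Q = lead \<tau> (vec_swap i v)"
  proof -
    obtain w where w: "set w \<subseteq> {1..<N}" "word_perm w = sigma N v"
      "lead \<tau> v = vact_word w (single \<tau> 1)"
      using lead_word[OF v] \<tau> by metis
    \<comment> \<open>\<open>vec_swap i v\<close> lies strictly above \<open>v\<close>, so the added
      multiple of \<open>P\<close> does not contribute to the new leading coefficient.\<close>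
    have "mcoef (emon (vec_swap i v)) P = 0"
      using supp[OF sv] not_vle_swap[OF i] vdeg_swap[OF i(1)] by blast
    moreover have "lead \<tau> (vec_swap i v) = vact_word (w @ [i]) (single \<tau> 1)"
      by (rule lead_eq) (use w \<tau> i in \<open>auto simp: word_perm_append word_perm_Cons sigma_swap\<close>)
    ultimately show ?thesis
      using mcoef_varsigma[OF P i(1) sv vdeg_swap[OF i(1)]] top w(3)
      by (simp add: mcoef_add mcoef_mscale vact_word_def)
  qed
  ultimately show ?thesis
    using \<tau> sv MF_add[OF MF_varsigma[OF P i(1)] MF_mscale[OF P]] J_step_support[OF P supp i(1)] i
    by (simp add: J_inv_def vdeg_swap)
qed

lemma sigma_tie_range:
  assumes "v \<in> expvecs N" "i \<in> {1..<N}" "v i = v (Suc i)"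
  shows "sigma N v i \<in> {1..<N}"
proof -
  have "sigma N v i \<in> {1..N}" "sigma N v (Suc i) \<in> {1..N}"
    using sigma_bij[OF assms(1) N_pos] assms(2) by (auto simp: bij_betw_def)
  then show ?thesis using sigma_Suc[OF assms(2,3)] by simp
qed

lemma J_inv_tab:
  assumes "J_inv \<tau> v P" and i: "i \<in> {1..<N}" "v i = v (Suc i)"
    and CT: "CT \<tau> (sigma N v i) - CT \<tau> (Suc (sigma N v i)) \<ge> 2"
  shows "J_inv (tableau_swap (sigma N v i) \<tau>) v
    (varsigma i P + mscale (1 / (zeta N v \<tau> (Suc i) - zeta N v \<tau> i)) P)"
proof -
  note inv = J_invD[OF assms(1)]
  note \<tau> = inv(1) and v = inv(2) and P = inv(3) and eig = inv(4) and supp = inv(5) and top = inv(6)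
  define c where "c = 1 / (zeta N v \<tau> (Suc i) - zeta N v \<tau> i)"
  let ?Q = "varsigma i P + mscale c P"
  define k where "k = sigma N v i"
  have k: "k \<in> {1..<N}" unfolding k_def using sigma_tie_range[OF v i] .
  let ?\<tau> = "tableau_swap k \<tau>"
  have \<tau>': "?\<tau> \<in> RST lam" by (rule RST_swap[OF \<tau> k]) (use CT in \<open>simp add: k_def\<close>)
  have vs: "vec_swap i v = v" using i(2) by (auto simp: vec_swap_def fun_eq_iff transpose_def)
  have "eigen (zeta N v ?\<tau>) ?Q"
    unfolding c_def k_def
    by (rule eigen_cong[OF eigen_step[OF MF_subset_M[OF P] eig i(1) zeta_neq[OF \<tau> v i(1)]]])
      (rule zeta_tableau_swap[OF v i])
  moreover have "mcoef (emon v) ?Q = lead ?\<tau> v"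
  proof -
    obtain w where w: "set w \<subseteq> {1..<N}" "word_perm w = sigma N v"
      "\<And>\<tau>. \<tau> \<in> RST lam \<Longrightarrow> lead \<tau> v = vact_word w (single \<tau> 1)"
      using lead_word[OF v] by metis
    have c: "c = - diag_coeff k \<tau>"
    proof -
      have "zeta N v \<tau> (Suc i) - zeta N v \<tau> i = - of_int (CT \<tau> k - CT \<tau> (Suc k))"
        using i by (simp add: zeta_def sigma_Suc k_def)
      then show ?thesis by (simp add: c_def diag_coeff_def del: of_int_diff)
    qed
    \<comment> \<open>A gap of at least 2 is the branch of \<open>swap_fun\<close> with value 1, and
      \<open>c\<close> cancels the diagonal term, so exactly the new tableau remains.\<close>
    have "swap_coeff k \<tau> = 1" using CT by (simp add: swap_coeff_def swap_fun_def k_def)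
    then have act: "vact k (single \<tau> 1) + vscale c (single \<tau> 1) = single ?\<tau> 1"
      unfolding c by (simp add: vact_single tableau_act_eq vscale_def single_uminus)
    \<comment> \<open>The letter \<open>i\<close> acting on positions is moved to the front of the
      word, where it acts on the labels \<open>k\<close> and \<open>Suc k\<close>.\<close>
    have "vact_word (w @ [i]) (single \<tau> 1) = vact_word (k # w) (single \<tau> 1)"
    proof (rule V_word_eq)
      show "word_perm (w @ [i]) = word_perm (k # w)"
        using sigma_transpose[OF v i] by (simp add: word_perm_append word_perm_Cons w(2) k_def)
    qed (use w k i V_space_single[OF \<tau>] in auto)
    then have "vact i (lead \<tau> v) = vact_word w (vact k (single \<tau> 1))"
      using w(3)[OF \<tau>] by (simp add: vact_word_def)
    then have "vact i (lead \<tau> v) + vscale c (lead \<tau> v) = vact_word w (single ?\<tau> 1)"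
      unfolding act[symmetric] using w(3)[OF \<tau>] by (simp add: vact_word_add vact_word_vscale)
    then show ?thesis
      using mcoef_varsigma[OF P i(1) v refl] top w(3)[OF \<tau>']
      by (simp add: mcoef_add mcoef_mscale vs)
  qed
  ultimately show ?thesis
    using \<tau>' v MF_add[OF MF_varsigma[OF P i(1)] MF_mscale[OF P]] J_step_support[OF P supp i(1)] i vs
    unfolding c_def[symmetric] k_def[symmetric] by (simp add: J_inv_def)
qed

lemma J_path_snoc: "J_path N lam (p @ [e]) = J_step N (J_path N lam p) e"
  by (simp add: J_path_def)

lemma J_inv_path: "is_path N lam p x \<Longrightarrow> x = Vtx \<tau> v \<Longrightarrow> J_inv \<tau> v (J_path N lam p)"
proof (induction arbitrary: \<tau> v rule: is_path.induct)
  case path_root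
  then show ?case using J_inv_root by (simp add: J_path_def memb_def)
next
  case (path_step p \<tau>0 v0 a u)
  have IH: "J_inv \<tau>0 v0 (J_path N lam p)" using path_step.IH by simp
  from path_step.hyps(2) show ?case
  proof cases
    case edge_Psi
    then show ?thesis using J_inv_Psi[OF IH] path_step.prems by (simp add: J_path_snoc)
  next
    case (edge_vec i)
    then show ?thesis using J_inv_swap[OF IH] path_step.prems by (simp add: J_path_snoc)
  next
    case (edge_tab i)
    then show ?thesis using J_inv_tab[OF IH] path_step.prems by (simp add: J_path_snoc)
  next
    case (edge_Empty i)
    then show ?thesis using path_step.prems by simp
  qed
qed

text \<open>All tableau edges are taken at exponent 0, where labels are positions; the edges after
  that change only the exponent.\<close>

lemma path_exists:
  assumes "\<tau> \<in> RST lam" "v \<in> expvecs N"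
  shows "\<exists>p. is_path N lam p (Vtx \<tau> v)"
  using assms(2) N_pos
proof (induction rule: expvecs_induct)
  case zero
  show ?case using assms(1)
  proof (induction rule: RST_induct)
    case root
    then show ?case using path_root by blast
  next
    case (swap \<tau> i)
    then obtain p where "is_path N lam p (Vtx \<tau> (\<lambda>_. 0))" by blast
    moreover have "is_edge N lam ((\<tau>, \<lambda>_. 0), Lab_s i, Vtx (tableau_swap i \<tau>) (\<lambda>_. 0))"
      using edge_tab[of i N "\<lambda>_. 0" \<tau> lam] swap by (simp add: sigma_zero)
    ultimately show ?case using path_step by blast
  qed
next
  case (Psi v)
  then show ?case using path_step edge_Psi by blast
next
  case (swap v i)
  then show ?case using path_step edge_vec by blast
qed

lemma J_inv_nonzero: "J_inv \<tau> v P \<Longrightarrow> P \<noteq> 0"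
  using lead_nonzero by (auto simp: J_inv_def)

section \<open>Leading monomials\<close>

lemma xmon_eq:
  assumes "v \<in> expvecs N"
  shows "xmon N v \<tau> = tensor (single (emon v) 1) (lead \<tau> v)"
  by (simp add: xmon_def lead_def pvar_power prod_single emon_def)

text \<open>Words act invertibly, so the vectors \<open>lead \<tau> u\<close> span
  \<open>V_space\<close>: apply the reversed word, expand in tableaux, and apply the word.\<close>

lemma tensor_in_span_xmon:
  assumes "u \<in> expvecs N" "t \<in> V_space"
  shows "tensor (single (emon u) 1) t \<in> mmod.span {xmon N u \<tau> | \<tau>. \<tau> \<in> RST lam}"
proof -
  obtain w where w: "set w \<subseteq> {1..<N}" "word_perm w = sigma N u"
    "\<And>\<tau>. \<tau> \<in> RST lam \<Longrightarrow> lead \<tau> u = vact_word w (single \<tau> 1)"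
    using lead_word[OF assms(1)] by metis
  define t' where "t' = vact_word (rev w) t"
  define L where "L s = tensor (single (emon u) 1) (vact_word w s)" for s
  have t: "tensor (single (emon u) 1) t = L t'" by (simp add: L_def t'_def vact_word_rev')
  have "t' \<in> V_space" unfolding t'_def by (rule V_word_closed) (use w assms in auto)
  then have keys: "keys t' \<subseteq> RST lam" by (simp add: V_space_def)
  have one: "L (single \<tau> c) \<in> mmod.span {xmon N u \<tau> | \<tau>. \<tau> \<in> RST lam}" if "\<tau> \<in> RST lam" for \<tau> c
  proof -
    have "single \<tau> c = vscale c (single \<tau> 1)" by (simp add: vscale_def)
    then have "L (single \<tau> c) = mscale c (xmon N u \<tau>)"
      using w(3)[OF that] by (simp add: L_def xmon_eq[OF assms(1)] vact_word_vscale tensor_vscale)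
    then show ?thesis using that by (auto intro: mmod.span_scale mmod.span_base)
  qed
  have "L (\<Sum>\<tau>\<in>B. single \<tau> (lookup t' \<tau>)) \<in> mmod.span {xmon N u \<tau> | \<tau>. \<tau> \<in> RST lam}"
    if "finite B" "B \<subseteq> RST lam" for B
    using that
  proof (induction B)
    case empty
    then show ?case by (simp add: L_def mmod.span_zero)
  next
    case (insert x F)
    have "L (a + b) = L a + L b" for a b by (simp add: L_def vact_word_add tensor_add)
    then show ?case using insert one by (simp add: mmod.span_add)
  qed
  from this[of "keys t'"] show ?thesis
    using keys t by (simp add: poly_mapping_eq_sum_single[symmetric])
qed

lemma J_inv_leading:
  assumes "J_inv \<tau> v P"
  shows "has_leading_monomial N lam (top_component P) v \<tau>"
proof -
  note inv = J_invD[OF assms(1)]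
  note \<tau> = inv(1) and v = inv(2) and P = inv(3) and supp = inv(5) and top = inv(6)
  have ev: "emon v \<in> mons P" using top lead_nonzero[OF \<tau> v] by (simp add: mons_iff)
  have "mdegree P = vdeg N v"
  proof (rule mdegree_eq[OF _ ev mon_degree_emon[OF v]])
    fix m assume "m \<in> mons P"
    with P show "mon_degree m \<le> vdeg N v" by (rule mons_MF) (simp add: mon_degree_emon)
  qed
  define S where "S = {m \<in> mons P. mon_degree m = vdeg N v}"
  have S: "finite S" "emon v \<in> S" using finite_mons ev by (auto simp: S_def mon_degree_emon[OF v])
  have "top_component P = (\<Sum>m\<in>S. tensor (single m 1) (mcoef m P))"
    unfolding top_component_def \<open>mdegree P = vdeg N v\<close> homogeneous_component_eq S_def ..
  also have "\<dots> = tensor (single (emon v) 1) (mcoef (emon v) P)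
      + (\<Sum>m\<in>S - {emon v}. tensor (single m 1) (mcoef m P))"
    using S by (rule sum.remove)
  also have "tensor (single (emon v) 1) (mcoef (emon v) P) = mscale 1 (xmon N v \<tau>)"
    by (simp add: top xmon_eq[OF v])
  finally have Q: "top_component P
    = mscale 1 (xmon N v \<tau>) + (\<Sum>m\<in>S - {emon v}. tensor (single m 1) (mcoef m P))" .
  have "(\<Sum>m\<in>S - {emon v}. tensor (single m 1) (mcoef m P))
    \<in> mmod.span {xmon N v' \<tau>' | v' \<tau>'. v' \<in> expvecs N \<and> \<tau>' \<in> RST lam \<and> lhd N v' v}"
  proof (rule mmod.span_sum)
    fix m assume m: "m \<in> S - {emon v}"
    then have mP: "m \<in> mons P" by (simp add: S_def)
    with P obtain u where u: "u \<in> expvecs N" "m = emon u" by (rule mons_MF)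
    have "vdeg N u = vdeg N v" using m u by (simp add: S_def mon_degree_emon)
    then have "vle N u v" using supp[OF u(1)] mP u by (simp add: mons_iff)
    moreover have "u \<noteq> v" using m u by auto
    ultimately have "lhd N u v" by (rule vle_imp_lhd)
    then have "{xmon N u \<tau> | \<tau>. \<tau> \<in> RST lam}
      \<subseteq> {xmon N v' \<tau>' | v' \<tau>'. v' \<in> expvecs N \<and> \<tau>' \<in> RST lam \<and> lhd N v' v}" using u by blast
    then show "tensor (single m 1) (mcoef m P)
      \<in> mmod.span {xmon N v' \<tau>' | v' \<tau>'. v' \<in> expvecs N \<and> \<tau>' \<in> RST lam \<and> lhd N v' v}"
      using tensor_in_span_xmon[OF u(1) mcoef_V_space[OF MF_subset_M[OF P]]] mmod.span_mono u(2) by blast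
  qed
  then show ?thesis
    unfolding has_leading_monomial_def using Q by (intro exI[of _ 1] exI) auto
qed

section \<open>The basis\<close>

lemma subspace_M: "mmod.subspace M"
  by (simp add: mmod.subspace_def M_0 M_add M_mscale)

text \<open>Every other monomial of \<open>F v \<tau>\<close> has smaller degree, or the same degree
  and smaller \<open>vrank\<close>. \<open>F\<close> is an arbitrary family satisfying the
  invariant, since independence of the path is not yet available.\<close>

lemma tensor_in_span:
  assumes F: "\<And>v \<tau>. v \<in> expvecs N \<Longrightarrow> \<tau> \<in> RST lam \<Longrightarrow> J_inv \<tau> v (F v \<tau>)"
    and "u \<in> expvecs N" "t \<in> V_space"
  shows "tensor (single (emon u) 1) t \<in> mmod.span {F v \<tau> | v \<tau>. v \<in> expvecs N \<and> \<tau> \<in> RST lam}"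
  using assms(2,3)
proof (induction u arbitrary: t rule: wf_induct_rule[OF wf_measures[of "[vdeg N, vrank N]"]])
  case (1 v)
  let ?B = "{F v \<tau> | v \<tau>. v \<in> expvecs N \<and> \<tau> \<in> RST lam}"
  have "xmon N v \<tau> \<in> mmod.span ?B" if \<tau>: "\<tau> \<in> RST lam" for \<tau>
  proof -
    define P where "P = F v \<tau>"
    have inv: "J_inv \<tau> v P" using F 1 \<tau> by (simp add: P_def)
    note P = J_invD(3)[OF inv] and supp = J_invD(5)[OF inv] and top = J_invD(6)[OF inv]
    have ev: "emon v \<in> mons P" using top lead_nonzero[OF \<tau>] 1 by (simp add: mons_iff)
    have "P = tensor (single (emon v) 1) (mcoef (emon v) P)
        + (\<Sum>m\<in>mons P - {emon v}. tensor (single m 1) (mcoef m P))"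
      by (rule trans[OF mons_decomposition sum.remove[OF finite_mons ev]])
    then have "xmon N v \<tau> = P - (\<Sum>m\<in>mons P - {emon v}. tensor (single m 1) (mcoef m P))"
      using top xmon_eq 1 by (simp add: algebra_simps)
    moreover have "P \<in> mmod.span ?B" using 1 \<tau> by (auto simp: P_def intro: mmod.span_base)
    moreover have "(\<Sum>m\<in>mons P - {emon v}. tensor (single m 1) (mcoef m P)) \<in> mmod.span ?B"
    proof (rule mmod.span_sum)
      fix m assume m: "m \<in> mons P - {emon v}"
      then have mP: "m \<in> mons P" by simp
      with P obtain u where u: "u \<in> expvecs N" "m = emon u" "vdeg N u \<le> vdeg N v" by (rule mons_MF)
      have "u \<noteq> v" using m u by auto
      have "vdeg N u < vdeg N v \<or> vdeg N u = vdeg N v \<and> vrank N u < vrank N v"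
      proof (cases "vdeg N u = vdeg N v")
        case True
        then have "vle N u v" using supp[OF u(1)] mP u(2) by (simp add: mons_iff)
        then show ?thesis using vrank_less \<open>u \<noteq> v\<close> u(1) 1 True by simp
      qed (use u in simp)
      then have "(u, v) \<in> measures [vdeg N, vrank N]" by auto
      then show "tensor (single m 1) (mcoef m P) \<in> mmod.span ?B"
        using 1 u mcoef_V_space[OF MF_subset_M[OF P]] by simp
    qed
    ultimately show ?thesis using mmod.span_diff by simp
  qed
  then have "{xmon N v \<tau> | \<tau>. \<tau> \<in> RST lam} \<subseteq> mmod.span ?B" by blast
  then have "mmod.span {xmon N v \<tau> | \<tau>. \<tau> \<in> RST lam} \<subseteq> mmod.span ?B"
    using mmod.span_minimal mmod.subspace_span by blast
  then show ?case using tensor_in_span_xmon 1 by blast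
qed

lemma span_J:
  assumes F: "\<And>v \<tau>. v \<in> expvecs N \<Longrightarrow> \<tau> \<in> RST lam \<Longrightarrow> J_inv \<tau> v (F v \<tau>)"
  shows "mmod.span {F v \<tau> | v \<tau>. v \<in> expvecs N \<and> \<tau> \<in> RST lam} = M" (is "mmod.span ?B = M")
proof
  have "?B \<subseteq> M" using F MF_subset_M unfolding J_inv_def by blast
  then show "mmod.span ?B \<subseteq> M" using mmod.span_minimal subspace_M by blast
  show "M \<subseteq> mmod.span ?B"
  proof
    fix P assume P: "P \<in> M"
    then obtain d where "P \<in> MF d" using M_iff_MF by blast
    then have d: "P \<in> MF (Suc d)" using MF_mono by simp
    have "(\<Sum>m\<in>mons P. tensor (single m 1) (mcoef m P)) \<in> mmod.span ?B"
    proof (rule mmod.span_sum)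
      fix m assume "m \<in> mons P"
      with d obtain u where "u \<in> expvecs N" "m = emon u" by (rule mons_MF)
      then show "tensor (single m 1) (mcoef m P) \<in> mmod.span ?B"
        using tensor_in_span[OF F] mcoef_V_space[OF P] by blast
    qed
    then show "P \<in> mmod.span ?B" unfolding mons_decomposition[symmetric] .
  qed
qed

section \<open>Independence of joint eigenvectors\<close>

lemma eigen_mscale: "eigen z P \<Longrightarrow> eigen z (mscale c P)"
  by (simp add: eigen_def xi_hat_mscale mult.commute)

lemma eigen_diff: "eigen z P \<Longrightarrow> eigen z Q \<Longrightarrow> eigen z (P - Q)"
proof -
  assume "eigen z P" "eigen z Q"
  moreover have "xi_hat N j (P - Q) = xi_hat N j P - xi_hat N j Q" for j
    using xi_hat_add[of j "P - Q" Q] by (simp add: algebra_simps)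
  ultimately show ?thesis by (simp add: eigen_def mmod.scale_right_diff_distrib)
qed

lemma xi_hat_0 [simp]: "xi_hat N j 0 = 0"
  using xi_hat_mscale[of j 0 0] by simp

lemma xi_hat_sum: "finite S \<Longrightarrow> xi_hat N j (\<Sum>k\<in>S. w k) = (\<Sum>k\<in>S. xi_hat N j (w k))"
  by (induction S rule: finite_induct) (simp_all add: xi_hat_add)

text \<open>For each \<open>b\<close>, some \<open>xi_hat N j\<close> separates it from
  \<open>a\<close>; subtracting its eigenvalue at \<open>a\<close> removes \<open>w a\<close> and
  rescales \<open>w b\<close> by a nonzero factor. The family is indexed by \<open>k\<close>, so
  that zero and repeated vectors are allowed.\<close>

lemma joint_eigenvectors_independent:
  assumes "finite S" "\<And>k. k \<in> S \<Longrightarrow> eigen (z k) (w k)"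
    and "\<And>k l. k \<in> S \<Longrightarrow> l \<in> S \<Longrightarrow> k \<noteq> l \<Longrightarrow> \<exists>j\<in>{1..N}. z k j \<noteq> z l j"
    and "(\<Sum>k\<in>S. w k) = 0" and "k \<in> S"
  shows "w k = 0"
  using assms
proof (induction S arbitrary: w k rule: finite_induct)
  case (insert a S)
  have S0: "w b = 0" if b: "b \<in> S" for b
  proof -
    have "a \<noteq> b" using insert.hyps b by blast
    then obtain j where j: "j \<in> {1..N}" "z a j \<noteq> z b j" using insert.prems(2)[of a b] b by blast
    define w' where "w' k = mscale (z k j - z a j) (w k)" for k
    have ew: "xi_hat N j (w k) = mscale (z k j) (w k)" if "k \<in> insert a S" for k
      using insert.prems(1)[OF that] j(1) by (simp add: eigen_def)
    have "(\<Sum>k\<in>insert a S. w' k) = (\<Sum>k\<in>insert a S. xi_hat N j (w k)) - (\<Sum>k\<in>insert a S. mscale (z a j) (w k))"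
      unfolding sum_subtractf[symmetric]
      by (rule sum.cong) (simp_all add: w'_def ew mmod.scale_left_diff_distrib)
    also have "(\<Sum>k\<in>insert a S. xi_hat N j (w k)) = 0"
      using xi_hat_sum[of "insert a S" j w] insert.hyps(1) insert.prems(3) by (metis finite_insert xi_hat_0)
    also have "(\<Sum>k\<in>insert a S. mscale (z a j) (w k)) = mscale (z a j) (\<Sum>k\<in>insert a S. w k)"
      by (simp only: mmod.scale_sum_right)
    finally have "(\<Sum>k\<in>insert a S. w' k) = 0" using insert.prems(3) by (simp only: mmod.scale_zero_right diff_zero)
    then have "(\<Sum>k\<in>S. w' k) = 0" using insert.hyps by (simp add: w'_def)
    moreover have "eigen (z k) (w' k)" if "k \<in> S" for k
      unfolding w'_def using eigen_mscale insert.prems(1) that by simp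
    ultimately have "w' b = 0" using insert.IH[of w' b] insert.prems(2) b by blast
    then show ?thesis using j(2) by (simp add: w'_def)
  qed
  then have "w a = 0" using insert.prems(3) insert.hyps by simp
  then show ?case using S0 insert.prems(4) by blast
qed simp

lemma spectra_distinct:
  assumes "v \<in> expvecs N" "v' \<in> expvecs N" "\<tau> \<in> RST lam" "\<tau>' \<in> RST lam" "(v, \<tau>) \<noteq> (v', \<tau>')"
  shows "\<exists>j\<in>{1..N}. zeta N v \<tau> j \<noteq> zeta N v' \<tau>' j"
  using zeta_inj[OF assms(1,2)] RST_eq_if_contents[OF assms(3,4)] assms(5) by blast

text \<open>Expand \<open>P\<close> in the family. Terms with a spectrum other than that of
  \<open>P\<close> cannot contribute, and if every term is of this kind, then \<open>P\<close> is
  0.\<close>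

lemma eigen_multiple:
  assumes F: "\<And>v \<tau>. v \<in> expvecs N \<Longrightarrow> \<tau> \<in> RST lam \<Longrightarrow> J_inv \<tau> v (F v \<tau>)"
    and P: "P \<in> M" "eigen z P" "P \<noteq> 0"
  obtains v \<tau> c where "v \<in> expvecs N" "\<tau> \<in> RST lam" "\<forall>j\<in>{1..N}. z j = zeta N v \<tau> j"
    "P = mscale c (F v \<tau>)"
proof -
  let ?B = "{F v \<tau> | v \<tau>. v \<in> expvecs N \<and> \<tau> \<in> RST lam}"
  have "P \<in> mmod.span ?B" using span_J[OF F] P(1) by simp
  then obtain T r where T: "finite T" "T \<subseteq> ?B" "P = (\<Sum>a\<in>T. mscale (r a) a)"
    unfolding mmod.span_explicit by blast
  have "\<forall>a\<in>T. \<exists>v \<tau>. v \<in> expvecs N \<and> \<tau> \<in> RST lam \<and> a = F v \<tau>" using T(2) by blast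
  then obtain V U where VU: "\<And>a. a \<in> T \<Longrightarrow> V a \<in> expvecs N \<and> U a \<in> RST lam \<and> a = F (V a) (U a)"
    by metis
  define y where "y a = zeta N (V a) (U a)" for a
  have ey: "eigen (y a) (mscale (r a) a)" if "a \<in> T" for a
    using F[of "V a" "U a"] VU[OF that] by (auto simp: y_def J_inv_def intro: eigen_mscale)
  have dist: "\<exists>j\<in>{1..N}. y a j \<noteq> y b j" if "a \<in> T" "b \<in> T" "a \<noteq> b" for a b
  proof -
    have "(V a, U a) \<noteq> (V b, U b)" using VU[OF that(1)] VU[OF that(2)] that(3) by auto
    then show ?thesis unfolding y_def using spectra_distinct VU that by blast
  qed
  show ?thesis
  proof (cases "\<exists>a\<in>T. \<forall>j\<in>{1..N}. z j = y a j")
    case True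
    then obtain a where a: "a \<in> T" "\<forall>j\<in>{1..N}. z j = y a j" by blast
    \<comment> \<open>\<open>P\<close> is subtracted from the term that shares its spectrum, so the
      members add up to 0 while their spectra stay distinct.\<close>
    define w where "w b = (if b = a then mscale (r a) a - P else mscale (r b) b)" for b
    have eP: "eigen (y a) P" by (rule eigen_cong[OF P(2)]) (use a(2) in simp)
    have "w a = 0"
    proof (rule joint_eigenvectors_independent[of T y w])
      show "eigen (y b) (w b)" if "b \<in> T" for b
        using ey[OF that] eP ey[OF a(1)] by (auto simp: w_def intro: eigen_diff)
      have "(\<Sum>b\<in>T. w b) = w a + (\<Sum>b\<in>T - {a}. w b)" using T(1) a(1) by (rule sum.remove)
      also have "(\<Sum>b\<in>T - {a}. w b) = (\<Sum>b\<in>T - {a}. mscale (r b) b)"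
        by (rule sum.cong) (auto simp: w_def)
      also have "w a + \<dots> = (\<Sum>b\<in>T. mscale (r b) b) - P"
        using sum.remove[OF T(1) a(1), of "\<lambda>b. mscale (r b) b"] by (simp add: w_def)
      finally show "(\<Sum>b\<in>T. w b) = 0" using T(3) by simp
    qed (use T a dist in auto)
    then have Pa: "P = mscale (r a) (F (V a) (U a))" using VU[OF a(1)] by (simp add: w_def)
    show ?thesis
    proof (rule that[OF _ _ _ Pa])
      show "V a \<in> expvecs N" "U a \<in> RST lam" using VU[OF a(1)] by blast+
      show "\<forall>j\<in>{1..N}. z j = zeta N (V a) (U a) j" using a(2) by (simp add: y_def)
    qed
  next
    case False
    \<comment> \<open>No term has the spectrum of \<open>P\<close>, so \<open>- P\<close> joins the
      relation as a further member, under the index \<open>None\<close>.\<close>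
    define w where "w k = (case k of None \<Rightarrow> - P | Some b \<Rightarrow> mscale (r b) b)" for k
    define x where "x k = (case k of None \<Rightarrow> z | Some b \<Rightarrow> y b)" for k
    have "w None = 0"
    proof (rule joint_eigenvectors_independent[of "insert None (Some ` T)" x w])
      show "finite (insert None (Some ` T))" using T(1) by simp
      show "eigen (x k) (w k)" if "k \<in> insert None (Some ` T)" for k
        using that ey eigen_mscale[OF P(2), of "-1"] by (auto simp: w_def x_def)
      show "\<exists>j\<in>{1..N}. x k j \<noteq> x l j" if "k \<in> insert None (Some ` T)" "l \<in> insert None (Some ` T)" "k \<noteq> l" for k l
        using that dist False by (auto simp: x_def split: option.splits) metis+
      have "(\<Sum>k\<in>Some ` T. w k) = (\<Sum>b\<in>T. mscale (r b) b)"
        by (subst sum.reindex) (auto simp: w_def)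
      then show "(\<Sum>k\<in>insert None (Some ` T). w k) = 0"
        using T(1,3) by (subst sum.insert) (auto simp: w_def)
    qed simp
    then show ?thesis using P(3) by (simp add: w_def)
  qed
qed

section \<open>Path independence, the empty vertex and the basis\<close>

definition J :: "expvec \<Rightarrow> tableau \<Rightarrow> mmod" where
  "J v \<tau> = J_path N lam (SOME p. is_path N lam p (Vtx \<tau> v))"

lemma J_inv_J: "v \<in> expvecs N \<Longrightarrow> \<tau> \<in> RST lam \<Longrightarrow> J_inv \<tau> v (J v \<tau>)"
  unfolding J_def using path_exists J_inv_path by (metis someI_ex)

lemma J_inv_unique:
  assumes "J_inv \<tau> v P"
  shows "P = J v \<tau>"
proof -
  have \<tau>: "\<tau> \<in> RST lam" and v: "v \<in> expvecs N" and P: "P \<in> M"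
    and eig: "eigen (zeta N v \<tau>) P" and top: "mcoef (emon v) P = lead \<tau> v"
    using assms MF_subset_M by (auto simp: J_inv_def)
  from J_inv_J P eig J_inv_nonzero[OF assms] obtain v' \<tau>' c where *: "v' \<in> expvecs N" "\<tau>' \<in> RST lam"
    "\<forall>j\<in>{1..N}. zeta N v \<tau> j = zeta N v' \<tau>' j" "P = mscale c (J v' \<tau>')"
    by (rule eigen_multiple)
  then have eq: "v' = v" "\<tau>' = \<tau>" using spectra_distinct[OF v *(1) \<tau> *(2)] by blast+
  have "vscale c (lead \<tau> v) = lead \<tau> v"
    using top *(4) J_inv_J[OF v \<tau>] by (simp add: eq mcoef_mscale J_inv_def)
  moreover obtain \<rho> where "lookup (lead \<tau> v) \<rho> \<noteq> 0"
    using lead_nonzero[OF \<tau> v] by (metis poly_mapping_eqI lookup_zero)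
  ultimately have "c = 1" by (metis lookup_vscale mult_cancel_right1)
  then show ?thesis using *(4) eq by simp
qed

lemma J_path_eq: "is_path N lam p (Vtx \<tau> v) \<Longrightarrow> J_path N lam p = J v \<tau>"
  using J_inv_unique J_inv_path by blast

lemma J_hat_eq:
  assumes "v \<in> expvecs N" "\<tau> \<in> RST lam"
  shows "J_hat N lam v \<tau> = J v \<tau>"
  unfolding J_hat_def
proof (rule the_equality)
  show "\<exists>p. is_path N lam p (Vtx \<tau> v) \<and> J v \<tau> = J_path N lam p"
    using path_exists[OF assms(2,1)] J_path_eq by metis
qed (use J_path_eq in blast)

lemma J_inv_simultaneous: "J_inv \<tau> v P \<Longrightarrow> simultaneous_eigenfunction N (zeta N v \<tau>) P"
proof -
  assume inv: "J_inv \<tau> v P"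
  then have "eigen (zeta N v \<tau>) P" by (simp add: J_inv_def)
  then show ?thesis
    using J_inv_nonzero[OF inv] by (simp add: simultaneous_eigenfunction_def eigen_def)
qed

lemma J_path_Empty:
  assumes "is_path N lam p Empty"
  shows "J_path N lam p = 0"
  using assms
proof cases
  case (path_step p0 \<tau> v a)
  have inv: "J_inv \<tau> v (J_path N lam p0)" using J_inv_path path_step by blast
  then have \<tau>: "\<tau> \<in> RST lam" and v: "v \<in> expvecs N" and P: "J_path N lam p0 \<in> M"
    and eig: "eigen (zeta N v \<tau>) (J_path N lam p0)"
    using MF_subset_M by (auto simp: J_inv_def)
  from path_step(3) obtain i where a: "a = Lab_s i" and i: "i \<in> {1..<N}" "v i = v (Suc i)"
    and not: "tableau_swap (sigma N v i) \<tau> \<notin> RST lam"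
    by cases auto
  let ?k = "sigma N v i" and ?Q = "J_path N lam p"
  have Q: "?Q = varsigma i (J_path N lam p0)
      + mscale (1 / (zeta N v \<tau> (Suc i) - zeta N v \<tau> i)) (J_path N lam p0)"
    using path_step a by (simp add: J_path_snoc)
  have QM: "?Q \<in> M" unfolding Q by (intro M_add M_varsigma M_mscale P i(1))
  have eQ: "eigen (\<lambda>j. zeta N v \<tau> (transpose i (Suc i) j)) ?Q"
    unfolding Q by (rule eigen_step[OF P eig i(1) zeta_neq[OF \<tau> v i(1)]])
  show ?thesis
  proof (rule ccontr)
    assume "?Q \<noteq> 0"
    with J_inv_J QM eQ obtain v' \<tau>' c where *: "v' \<in> expvecs N" "\<tau>' \<in> RST lam"
      "\<forall>j\<in>{1..N}. zeta N v \<tau> (transpose i (Suc i) j) = zeta N v' \<tau>' j"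
      "?Q = mscale c (J v' \<tau>')"
      by (rule eigen_multiple)
    \<comment> \<open>The spectrum of \<open>?Q\<close> is the one formally attached to the
      interchanged filling, although that filling is not an RST.\<close>
    then have "\<And>j. j \<in> {1..N} \<Longrightarrow> zeta N v (tableau_swap ?k \<tau>) j = zeta N v' \<tau>' j"
      using zeta_tableau_swap[OF v i] by simp
    then have CT: "\<forall>i\<in>{1..N}. CT (tableau_swap ?k \<tau>) i = CT \<tau>' i"
      using zeta_inj[OF v *(1)] by blast
    have k: "?k \<in> {1..<N}" using sigma_tie_range[OF v i] .
    have "tableau_swap ?k \<tau> = \<tau>'"
      by (rule filling_eq_if_contents[OF filling_swap[OF RST_filling[OF \<tau>] k]
          swap_diagonal_decreasing[OF \<tau> k] RST_filling[OF *(2)] RST_diagonal_decreasing[OF *(2)]])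
        (use CT in blast)
    then show False using not *(2) by simp
  qed
qed

lemma J_inj: "inj_on (\<lambda>(v, \<tau>). J v \<tau>) (expvecs N \<times> RST lam)"
proof (rule inj_onI, clarify)
  fix v \<tau> v' \<tau>'
  assume *: "v \<in> expvecs N" "\<tau> \<in> RST lam" "v' \<in> expvecs N" "\<tau>' \<in> RST lam" "J v \<tau> = J v' \<tau>'"
  have "zeta N v \<tau> j = zeta N v' \<tau>' j" if "j \<in> {1..N}" for j
  proof -
    have "xi_hat N j (J v \<tau>) = mscale (zeta N v \<tau> j) (J v \<tau>)"
      "xi_hat N j (J v' \<tau>') = mscale (zeta N v' \<tau>' j) (J v' \<tau>')"
      using J_inv_J[OF *(1,2)] J_inv_J[OF *(3,4)] that unfolding J_inv_def eigen_def by blast+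
    then have "mscale (zeta N v \<tau> j) (J v \<tau>) = mscale (zeta N v' \<tau>' j) (J v \<tau>)"
      using *(5) by metis
    then show ?thesis using J_inv_nonzero[OF J_inv_J[OF *(1,2)]] by simp
  qed
  then show "v = v' \<and> \<tau> = \<tau>'" using spectra_distinct[OF *(1,3,2,4)] by blast
qed

lemma J_independent: "mmod.independent ((\<lambda>(v, \<tau>). J v \<tau>) ` (expvecs N \<times> RST lam))"
  unfolding mmod.independent_explicit_module
proof (intro allI impI)
  fix T r a
  assume T: "finite T" "T \<subseteq> (\<lambda>(v, \<tau>). J v \<tau>) ` (expvecs N \<times> RST lam)"
    and sum: "(\<Sum>b\<in>T. mscale (r b) b) = 0" and a: "a \<in> T"
  have "\<forall>a\<in>T. \<exists>v \<tau>. v \<in> expvecs N \<and> \<tau> \<in> RST lam \<and> a = J v \<tau>"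
  proof
    fix a assume "a \<in> T"
    then obtain x where "x \<in> expvecs N \<times> RST lam" "a = (\<lambda>(v, \<tau>). J v \<tau>) x" using T(2) by blast
    then show "\<exists>v \<tau>. v \<in> expvecs N \<and> \<tau> \<in> RST lam \<and> a = J v \<tau>" by (cases x) auto
  qed
  then obtain V U where VU: "\<And>a. a \<in> T \<Longrightarrow> V a \<in> expvecs N \<and> U a \<in> RST lam \<and> a = J (V a) (U a)"
    by metis
  have "mscale (r a) a = 0"
  proof (rule joint_eigenvectors_independent[OF T(1), where w = "\<lambda>b. mscale (r b) b" and k = a
        and z = "\<lambda>b. zeta N (V b) (U b)"])
    show "eigen (zeta N (V b) (U b)) (mscale (r b) b)" if "b \<in> T" for b
      using J_inv_J[of "V b" "U b"] VU[OF that] by (auto simp: J_inv_def intro: eigen_mscale)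
    show "\<exists>j\<in>{1..N}. zeta N (V b) (U b) j \<noteq> zeta N (V c) (U c) j" if "b \<in> T" "c \<in> T" "b \<noteq> c" for b c
    proof -
      have "(V b, U b) \<noteq> (V c, U c)" using VU[OF that(1)] VU[OF that(2)] that(3) by auto
      then show ?thesis using spectra_distinct VU that by blast
    qed
  qed (use sum a in auto)
  moreover have "a \<noteq> 0" using VU[OF a] J_inv_nonzero[OF J_inv_J] by metis
  ultimately show "r a = 0" by simp
qed

end

theorem theorem7p5:
  fixes N :: nat and lam :: "nat list"
  assumes "is_partition lam" and "sum_list lam = N" and "N \<ge> 1"
  shows
    "(\<forall>p \<tau> v. is_path N lam p (Vtx \<tau> v) \<longrightarrow>
        simultaneous_eigenfunction N (zeta N v \<tau>) (J_path N lam p)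
        \<and> has_leading_monomial N lam (top_component (J_path N lam p)) v \<tau>)
     \<and> (\<forall>p q \<tau> v. is_path N lam p (Vtx \<tau> v) \<longrightarrow> is_path N lam q (Vtx \<tau> v) \<longrightarrow>
        J_path N lam p = J_path N lam q)
     \<and> (\<forall>\<tau>\<in>RST lam. \<forall>v\<in>expvecs N. \<exists>p. is_path N lam p (Vtx \<tau> v))
     \<and> (\<forall>\<tau>\<in>RST lam. \<forall>v\<in>expvecs N.
        simultaneous_eigenfunction N (zeta N v \<tau>) (J_hat N lam v \<tau>))
     \<and> inj_on (\<lambda>(v, \<tau>). J_hat N lam v \<tau>) (expvecs N \<times> RST lam)
     \<and> mmod.independent ((\<lambda>(v, \<tau>). J_hat N lam v \<tau>) ` (expvecs N \<times> RST lam))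
     \<and> mmod.span ((\<lambda>(v, \<tau>). J_hat N lam v \<tau>) ` (expvecs N \<times> RST lam)) = M_space N lam
     \<and> (\<forall>p. is_path N lam p Empty \<longrightarrow> J_path N lam p = 0)"
proof -
  interpret shape lam N by unfold_locales (use assms in auto)
  let ?I = "expvecs N \<times> RST lam"
  have img: "(\<lambda>(v, \<tau>). J_hat N lam v \<tau>) ` ?I = (\<lambda>(v, \<tau>). J v \<tau>) ` ?I"
    by (rule image_cong) (auto simp: J_hat_eq)
  have inj: "inj_on (\<lambda>(v, \<tau>). J_hat N lam v \<tau>) ?I"
    using J_inj by (rule inj_on_cong[THEN iffD1, rotated]) (auto simp: J_hat_eq)
  have "(\<lambda>(v, \<tau>). J v \<tau>) ` ?I = {J v \<tau> | v \<tau>. v \<in> expvecs N \<and> \<tau> \<in> RST lam}" by auto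
  then have span: "mmod.span ((\<lambda>(v, \<tau>). J_hat N lam v \<tau>) ` ?I) = M_space N lam"
    using span_J[of J, OF J_inv_J] img by simp
  show ?thesis
  proof (intro conjI)
    show "\<forall>p \<tau> v. is_path N lam p (Vtx \<tau> v) \<longrightarrow>
        simultaneous_eigenfunction N (zeta N v \<tau>) (J_path N lam p)
        \<and> has_leading_monomial N lam (top_component (J_path N lam p)) v \<tau>"
      using J_inv_path J_inv_simultaneous J_inv_leading by blast
    show "\<forall>p q \<tau> v. is_path N lam p (Vtx \<tau> v) \<longrightarrow> is_path N lam q (Vtx \<tau> v) \<longrightarrow>
        J_path N lam p = J_path N lam q"
      using J_path_eq by metis
    show "\<forall>\<tau>\<in>RST lam. \<forall>v\<in>expvecs N. \<exists>p. is_path N lam p (Vtx \<tau> v)"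
      using path_exists by blast
    show "\<forall>\<tau>\<in>RST lam. \<forall>v\<in>expvecs N.
        simultaneous_eigenfunction N (zeta N v \<tau>) (J_hat N lam v \<tau>)"
      using J_inv_simultaneous J_inv_J by (simp add: J_hat_eq)
    show "mmod.independent ((\<lambda>(v, \<tau>). J_hat N lam v \<tau>) ` ?I)"
      unfolding img by (rule J_independent)
    show "\<forall>p. is_path N lam p Empty \<longrightarrow> J_path N lam p = 0"
      using J_path_Empty by blast
  qed (rule inj span)+
qed

end
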